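(* Let $t_0<t_1$, let $c_1,c_2,c_s,y_s>0$ satisfy $\frac{y_s^2}{c_1y_s+c_2}<1$, and let $w\in\left(\frac{y_s^2}{c_1y_s+c_2},1\right)$. Let $\rho_0$ be a finite nonnegative Borel measure on $\mathbb{R}\times\mathbb{R}$ with support included in $[0,1]\times[0,y_s]$. Assume that $$t_1>\hat t_0,\qquad 2y_s-c_1>0,\qquad c_s>\frac{a(y_s)+b(y_s)}{y_s}.$$ Then, among all admissible controls $u\in L^\infty((t_0,t_1);[w,1])$, there exists an optimal control $u_*$ for the problem of minimizing $J(u)$ over $u\in L^\infty((t_0,t_1);[w,1])$ such that, for some $t_*\in[t_0,t_1]$, $$u_*=w\ \text{ in }(t_0,t_* )\quad\text{and}\quad u_*=1\ \text{ in }(t_*,t_1).$$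
   Context: Functions: $a(y):=-y^2$, $b(y):=c_1y+c_2$, and $c(y):=c_s$ if $y\in[0,y_s)$, $c(y):=0$ if $y\in[y_s,\infty)$. Controls: $L^\infty((t_0,t_1);[w,1])$ is the set of (classes of) measurable functions $u:(t_0,t_1)\to[w,1]$; equalities between controls are understood almost everywhere. Characteristics: for $y_0\in[0,y_s]$ and $u\in L^\infty((t_0,t_1);[w,1])$, $t\mapsto\Psi(t,y_0,u)$ is the (Carathéodory) solution of $$\frac{\partial\Psi}{\partial t}(t,y_0,u)=a(\Psi(t,y_0,u))+b(\Psi(t,y_0,u))u(t),\qquad \Psi(t_0,y_0,u)=y_0 .$$ It takes values in $[0,\bar y]$, where $\bar y=\frac{c_1+\sqrt{c_1^2+4c_2}}{2}$. Exit time: the condition on $w$ implies $a(y)+b(y)u>0$ for all $y\in[0,y_s]$, $u\in[w,1]$. $\hat t_0$ is the unique time (possibly larger than $t_1$) such that the solution of $\dot y=a(y)+b(y)w$, $y(t_0)=0$ (constant control $w$), satisfies $y(\hat t_0)=y_s$. Solution of the conservation law: the Cauchy problem is $$\rho_t+\rho_x+((a(y)+b(y)u)\rho)_y=c(y)\rho,\quad t\in(t_0,t_1),\ x>0,\ y>0,$$ with zero boundary data at $x=0$ and at $y=0$ and initial datum $\rho_0$ at time $t_0$. Its solution is by definition the map $\rho$ from $[t_0,t_1]$ to the Borel measures on $K:=[0,t_1-t_0+1]\times[0,\bar y]$ such that, for every $\varphi\in C^0(K)$, $$\iint_K\varphi(\alpha,\beta)\,d\rho(t,\alpha,\beta)=\iint_K\varphi(x_0+t-t_0,\Psi(t,y_0,u))\,e^{\int_{t_0}^tc(\Psi(s,y_0,u))\,ds}\,d\rho_0(x_0,y_0).$$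 Cost function: $$J(u):=-\int_0^{+\infty}\int_0^{+\infty}y\,d\rho(t_1,x,y)=-\iint\Psi(t_1,y_0,u)\,e^{\int_{t_0}^{t_1}c(\Psi(s,y_0,u))\,ds}\,d\rho_0(x_0,y_0).$$ *)

theory Defs
  imports "HOL-Analysis.Analysis"
begin

definition fun_a :: "real \<Rightarrow> real" where
  "fun_a y = - (y ^ 2)"

definition fun_b :: "real \<Rightarrow> real \<Rightarrow> real \<Rightarrow> real" where
  "fun_b c1 c2 y = c1 * y + c2"

text \<open>Only the values on \<open>[0, \<infinity>)\<close> matter; outside, the function is extended by \<open>0\<close>.\<close>

definition fun_c :: "real \<Rightarrow> real \<Rightarrow> real \<Rightarrow> real" where
  "fun_c cs ys y = (if 0 \<le> y \<and> y < ys then cs else 0)"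

definition ybar :: "real \<Rightarrow> real \<Rightarrow> real" where
  "ybar c1 c2 = (c1 + sqrt (c1 ^ 2 + 4 * c2)) / 2"

definition K_set :: "real \<Rightarrow> real \<Rightarrow> real \<Rightarrow> real \<Rightarrow> (real \<times> real) set" where
  "K_set t0 t1 c1 c2 = {0..t1 - t0 + 1} \<times> {0..ybar c1 c2}"

definition measure_support :: "'a::topological_space measure \<Rightarrow> 'a set" where
  "measure_support M = {x. \<forall>U. open U \<and> x \<in> U \<longrightarrow> emeasure M U > 0}"

text \<open>Controls are functions, compared almost everywhere, instead of equivalence classes;
  their values outside \<open>(t\<^sub>0, t\<^sub>1)\<close> are irrelevant.\<close>

definition admissible_control :: "real \<Rightarrow> real \<Rightarrow> real \<Rightarrow> (real \<Rightarrow> real) \<Rightarrow> bool" where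
  "admissible_control t0 t1 w u \<longleftrightarrow>
     u \<in> borel_measurable (lebesgue_on {t0<..<t1}) \<and> (\<forall>t\<in>{t0<..<t1}. u t \<in> {w..1})"

text \<open>Absolute continuity on a compact interval \<open>[p, q]\<close>: \<open>d\<close> ranges over the finite families of
  non-overlapping compact subintervals, and \<open>Inf k\<close>, \<open>Sup k\<close> are the endpoints of \<open>k\<close>.\<close>

definition abs_continuous_on_interval :: "real \<Rightarrow> real \<Rightarrow> (real \<Rightarrow> real) \<Rightarrow> bool" where
  "abs_continuous_on_interval p q F \<longleftrightarrow>
     (\<forall>\<epsilon>>0. \<exists>\<delta>>0. \<forall>d. d division_of \<Union>d \<and> \<Union>d \<subseteq> {p..q} \<and> (\<Sum>k\<in>d. Sup k - Inf k) < \<delta> \<longrightarrow>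
        (\<Sum>k\<in>d. \<bar>F (Sup k) - F (Inf k)\<bar>) < \<epsilon>)"

definition caratheodory_solution ::
  "real \<Rightarrow> real \<Rightarrow> real \<Rightarrow> real \<Rightarrow> real \<Rightarrow> (real \<Rightarrow> real) \<Rightarrow> (real \<Rightarrow> real) \<Rightarrow> bool" where
  "caratheodory_solution t0 t1 c1 c2 y0 u \<psi> \<longleftrightarrow>
     abs_continuous_on_interval t0 t1 \<psi> \<and>
     (AE t in lebesgue. t \<in> {t0<..<t1} \<longrightarrow>
        (\<psi> has_real_derivative (fun_a (\<psi> t) + fun_b c1 c2 (\<psi> t) * u t)) (at t)) \<and>
     \<psi> t0 = y0"

text \<open>The characteristic \<open>t \<mapsto> \<Psi>(t, y\<^sub>0, u)\<close>; extensionality on \<open>[t\<^sub>0, t\<^sub>1]\<close> makes the solution unique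
  as a total function.\<close>

definition Psi ::
  "real \<Rightarrow> real \<Rightarrow> real \<Rightarrow> real \<Rightarrow> real \<Rightarrow> real \<Rightarrow> (real \<Rightarrow> real) \<Rightarrow> real" where
  "Psi t0 t1 c1 c2 t y0 u =
     (THE \<psi>. \<psi> \<in> extensional {t0..t1} \<and> caratheodory_solution t0 t1 c1 c2 y0 u \<psi>) t"

text \<open>For a constant control the characteristic equation is an autonomous smooth equation, whose
  solution is considered on all of \<open>[t\<^sub>0, \<infinity>)\<close> because the exit time may exceed \<open>t\<^sub>1\<close>.\<close>

definition exit_time :: "real \<Rightarrow> real \<Rightarrow> real \<Rightarrow> real \<Rightarrow> real \<Rightarrow> real" where
  "exit_time t0 c1 c2 ys w =
     (THE T. t0 \<le> T \<and>
        (\<exists>y. y t0 = 0 \<and>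
             (\<forall>t\<ge>t0. (y has_real_derivative (fun_a (y t) + fun_b c1 c2 (y t) * w)) (at t within {t0..})) \<and>
             y T = ys))"

text \<open>The right-hand side is integrated over \<open>[0, 1] \<times> [0, y\<^sub>s]\<close>, which contains the support of
  \<open>\<rho>\<^sub>0\<close>: off this set neither \<open>\<Psi>\<close> nor the composition with \<open>\<phi>\<close> is specified. Each \<open>\<rho> t\<close> is a measure
  whose underlying space is \<open>K_set\<close>; finiteness rules out default values of the integral on the
  left-hand side.\<close>

definition transport_solution ::
  "real \<Rightarrow> real \<Rightarrow> real \<Rightarrow> real \<Rightarrow> real \<Rightarrow> real \<Rightarrow> (real \<times> real) measure \<Rightarrow> (real \<Rightarrow> real) \<Rightarrow>
   (real \<Rightarrow> (real \<times> real) measure) \<Rightarrow> bool" where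
  "transport_solution t0 t1 c1 c2 cs ys \<rho>0 u \<rho> \<longleftrightarrow>
     \<rho> \<in> extensional {t0..t1} \<and>
     (\<forall>t\<in>{t0..t1}.
        sets (\<rho> t) = sets (restrict_space borel (K_set t0 t1 c1 c2)) \<and>
        finite_measure (\<rho> t) \<and>
        (\<forall>\<phi> :: real \<times> real \<Rightarrow> real. continuous_on (K_set t0 t1 c1 c2) \<phi> \<longrightarrow>
           (LINT z|\<rho> t. \<phi> z) =
           (LINT z:{0..1} \<times> {0..ys}|\<rho>0.
              \<phi> (fst z + t - t0, Psi t0 t1 c1 c2 t (snd z) u) *
              exp (LINT s:{t0..t}|lebesgue. fun_c cs ys (Psi t0 t1 c1 c2 s (snd z) u)))))"

definition rho_sol ::
  "real \<Rightarrow> real \<Rightarrow> real \<Rightarrow> real \<Rightarrow> real \<Rightarrow> real \<Rightarrow> (real \<times> real) measure \<Rightarrow> (real \<Rightarrow> real) \<Rightarrow>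
   real \<Rightarrow> (real \<times> real) measure" where
  "rho_sol t0 t1 c1 c2 cs ys \<rho>0 u = (THE \<rho>. transport_solution t0 t1 c1 c2 cs ys \<rho>0 u \<rho>)"

text \<open>The integral over the quadrant is the integral over \<open>K_set\<close>, the space of the measure.\<close>

definition J_cost ::
  "real \<Rightarrow> real \<Rightarrow> real \<Rightarrow> real \<Rightarrow> real \<Rightarrow> real \<Rightarrow> (real \<times> real) measure \<Rightarrow> (real \<Rightarrow> real) \<Rightarrow> real" where
  "J_cost t0 t1 c1 c2 cs ys \<rho>0 u = - (LINT z|rho_sol t0 t1 c1 c2 cs ys \<rho>0 u t1. snd z)"

definition optimal_control ::
  "real \<Rightarrow> real \<Rightarrow> real \<Rightarrow> real \<Rightarrow> real \<Rightarrow> real \<Rightarrow> real \<Rightarrow> (real \<times> real) measure \<Rightarrow> (real \<Rightarrow> real) \<Rightarrow> bool" where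
  "optimal_control t0 t1 c1 c2 cs ys w \<rho>0 u \<longleftrightarrow>
     admissible_control t0 t1 w u \<and>
     (\<forall>v. admissible_control t0 t1 w v \<longrightarrow>
        J_cost t0 t1 c1 c2 cs ys \<rho>0 u \<le> J_cost t0 t1 c1 c2 cs ys \<rho>0 v)"

end

theory Submission
  imports Defs
begin

text \<open>The coordinate \<open>\<zeta> = ln (c\<^sub>1 y + c\<^sub>2)\<close> turns the characteristic equation into
  \<open>\<zeta>' = c\<^sub>1 u - g\<close> with \<open>dg/d\<zeta> \<ge> 0\<close> increasing in \<open>y\<close>; let \<open>H\<close> be its value at \<open>y\<^sub>s\<close>. Given a
  control \<open>v\<close>, let \<open>u\<close> be the control equal to \<open>w\<close> and then to \<open>1\<close> with
  \<open>\<integral> e\<^sup>H\<^sup>t u = \<integral> e\<^sup>H\<^sup>t v\<close>, so that \<open>\<integral> e\<^sup>H\<^sup>t (u - v) \<le> 0\<close> up to any time. Below \<open>y\<^sub>s\<close>, where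
  \<open>dg/d\<zeta> \<le> H\<close>, this makes the \<open>u\<close>-characteristic lag behind the \<open>v\<close>-characteristic, so it exits
  later; above \<open>y\<^sub>s\<close>, where \<open>dg/d\<zeta> \<ge> H\<close>, the lag in \<open>\<zeta>\<close> does not grow beyond its value at the
  later exit time. Since \<open>ln y\<close> grows above \<open>y\<^sub>s\<close> at a rate at most \<open>(a(y\<^sub>s) + b(y\<^sub>s)) / y\<^sub>s < c\<^sub>s\<close>, the
  longer growth phase outweighs the lag. So \<open>u\<close> is at least as good as \<open>v\<close> on every single
  characteristic, hence for every \<open>\<rho>\<^sub>0\<close>, and it remains to maximize a continuous function of the
  switching time over \<open>[t\<^sub>0, t\<^sub>1]\<close>.\<close>

section \<open>Absolutely continuous and Lipschitz functions\<close>

text \<open>The switching time has to serve all characteristics at once, whatever their starting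
  point. This is why the weight is tied to the fixed level \<open>ys\<close>: the rate
  \<open>zrate\<close> increases with \<open>y\<close>, so its value \<open>H\<close> at
  \<open>ys\<close> bounds it from above before the exit and from below after it, for every
  \<open>y0\<close>. With the integrating factor \<open>exp (H * t)\<close> the control terms of two
  characteristics integrate to a quantity that does not involve \<open>y0\<close>, and what remains
  has a known sign on either side of \<open>ys\<close>. The final comparison returns from
  \<open>c1 * y + c2\<close> to \<open>y\<close>, which works because all values involved are at
  least \<open>ys\<close>. Characteristics have a derivative only almost everywhere, so every
  differential inequality is integrated through one monotonicity criterion for absolutely continuous
  functions; as controls are bounded, the estimates themselves concern Lipschitz functions. The
  definite descriptions in \<open>Psi\<close>, \<open>exit_time\<close> and \<open>rho_sol\<close>
  require existence and uniqueness proofs before any estimate says something about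
  \<open>J_cost\<close>.\<close>

lemma abs_continuous_nonincreasing:
  fixes F :: "real \<Rightarrow> real"
  assumes ab: "a \<le> b" and ac: "abs_continuous_on_interval a b F"
    and ae: "AE t in lebesgue. t \<in> {a<..<b} \<longrightarrow> (\<exists>D\<le>0. (F has_real_derivative D) (at t))"
  shows "F b \<le> F a"
proof (cases "a = b")
  case False
  then have ab: "a < b" using ab by simp
  \<comment> \<open>One \<open>e\<close> pays for the intervals tagged in the exceptional null set,
    \<open>e * (b - a)\<close> for all the others.\<close>
  have approx: "F b \<le> F a + e * (1 + (b - a))" if e: "e > 0" for e
  proof -
    obtain \<delta> where \<delta>: "\<delta> > 0" and acd: "\<And>d. d division_of \<Union>d \<Longrightarrow> \<Union>d \<subseteq> {a..b} \<Longrightarrow>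
        (\<Sum>k\<in>d. Sup k - Inf k) < \<delta> \<Longrightarrow> (\<Sum>k\<in>d. \<bar>F (Sup k) - F (Inf k)\<bar>) < e"
      using ac[unfolded abs_continuous_on_interval_def, rule_format, OF e] by blast
    obtain N0 where N0: "N0 \<in> null_sets lebesgue"
      "{t \<in> space lebesgue. \<not> (t \<in> {a<..<b} \<longrightarrow> (\<exists>D\<le>0. (F has_real_derivative D) (at t)))} \<subseteq> N0"
      using ae unfolding eventually_ae_filter by blast
    \<comment> \<open>The endpoints join the null set because the derivative is controlled only in
      the open interval.\<close>
    define N where "N = N0 \<union> {a, b}"
    have Nnull: "N \<in> null_sets lebesgue"
      unfolding N_def by (intro null_sets.Un N0) (auto simp flip: negligible_iff_null_sets)
    obtain V where V: "open V" "N \<subseteq> V" "V - N \<in> lmeasurable" "emeasure lebesgue (V - N) < ennreal \<delta>"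
      using sets_lebesgue_outer_open[of N \<delta>] Nnull \<delta> by (auto dest: null_setsD2)
    have Vm: "V \<in> sets lebesgue" using V(1) by auto
    have "emeasure lebesgue V = emeasure lebesgue (V - N)"
      using emeasure_Diff_null_set[OF Nnull Vm] by simp
    then have Vless: "emeasure lebesgue V < ennreal \<delta>" using V by simp
    have Vl: "V \<in> lmeasurable"
      using Vm Vless by (intro fmeasurableI) (auto intro: less_trans simp: top.not_eq_extremum)
    have Vmeas: "measure lebesgue V < \<delta>"
      using Vless \<delta> Vl by (simp add: emeasure_eq_measure2 ennreal_less_iff)
    have "\<exists>r>0. \<exists>D\<le>0. \<forall>y. \<bar>y - x\<bar> < r \<longrightarrow> \<bar>F y - F x - D * (y - x)\<bar> \<le> e * \<bar>y - x\<bar>"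
      if "x \<in> {a..b} - N" for x
    proof -
      have "x \<notin> N0" "x \<in> {a<..<b}" using that unfolding N_def by auto
      then obtain D where D: "D \<le> 0" "(F has_real_derivative D) (at x)"
        using N0(2) by auto
      then have "(F has_derivative (\<lambda>h. D * h)) (at x)"
        by (simp add: has_field_derivative_def)
      then obtain r where "r > 0" "\<And>y. norm (y - x) < r \<Longrightarrow> norm (F y - F x - D * (y - x)) \<le> e * norm (y - x)"
        unfolding has_derivative_at_alt using e by blast
      then show ?thesis using D(1) by (intro exI[of _ r]) auto
    qed
    then obtain r where r: "\<And>x. x \<in> {a..b} - N \<Longrightarrow> r x > 0"
      "\<And>x. x \<in> {a..b} - N \<Longrightarrow> \<exists>D\<le>0. \<forall>y. \<bar>y - x\<bar> < r x \<longrightarrow> \<bar>F y - F x - D * (y - x)\<bar> \<le> e * \<bar>y - x\<bar>"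
      by metis
    \<comment> \<open>Intervals tagged in the exceptional null set have small total length, so absolute continuity
      controls them; on the others the sign of the derivative at the tag does.\<close>
    define \<gamma> where "\<gamma> x = (if x \<in> N then V else if x \<in> {a..b} then ball x (r x) else ball x 1)" for x
    have "gauge \<gamma>"
      unfolding gauge_def \<gamma>_def using V(1,2) r(1) by auto
    then obtain p where p: "p tagged_division_of {a..b}" "\<gamma> fine p"
      by (rule fine_division_exists_real)
    have finp: "finite p" using p(1) by auto
    define q where "q = {(x, k) \<in> p. x \<in> N}"
    have qsub: "q \<subseteq> p" unfolding q_def by auto
    have q: "q tagged_division_of \<Union>(snd ` q)"
      using p(1) qsub tagged_division_of_def tagged_partial_division_of_Union_self
        tagged_partial_division_subset by metis
    define d where "d = snd ` q"
    have d: "d division_of \<Union>d"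
      unfolding d_def using division_of_tagged_division[OF q] .
    have kform: "\<exists>u v. k = {u..v} \<and> u \<le> x \<and> x \<le> v \<and> a \<le> u \<and> v \<le> b" if xk: "(x, k) \<in> p" for x k
    proof -
      obtain u v where "k = cbox u v" using tagged_division_ofD(4)[OF p(1) xk] by blast
      moreover have "x \<in> k" "k \<subseteq> {a..b}" using tagged_division_ofD(2,3)[OF p(1) xk] by auto
      ultimately show ?thesis by (intro exI[of _ u] exI[of _ v]) auto
    qed
    have dab: "\<Union>d \<subseteq> {a..b}"
      using kform qsub unfolding d_def by fastforce
    have dV: "\<Union>d \<subseteq> V"
      using p(2) unfolding d_def q_def fine_def \<gamma>_def by fastforce
    have "(\<Sum>k\<in>d. Sup k - Inf k) = (\<Sum>k\<in>d. measure lebesgue k)"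
    proof (rule sum.cong)
      fix k assume "k \<in> d"
      then obtain x where "(x, k) \<in> p" unfolding d_def using qsub by auto
      from kform[OF this] show "Sup k - Inf k = measure lebesgue k" by auto
    qed simp
    also have "\<dots> = measure lebesgue (\<Union>d)"
      using content_division[OF d] by simp
    also have "\<dots> \<le> measure lebesgue V"
      using dV Vl by (intro measure_mono_fmeasurable fmeasurableD lmeasurable_division[OF d])
    finally have "(\<Sum>k\<in>d. \<bar>F (Sup k) - F (Inf k)\<bar>) < e"
      using acd[OF d dab] Vmeas by simp
    moreover have "(\<Sum>(x, k)\<in>q. \<bar>F (Sup k) - F (Inf k)\<bar>) = (\<Sum>k\<in>d. \<bar>F (Sup k) - F (Inf k)\<bar>)"
    proof -
      \<comment> \<open>The reindexing lemma asks for the value 0 on every interval with empty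
        interior, the empty one included, where \<open>Sup\<close> and \<open>Inf\<close> are
        unspecified.\<close>
      let ?f = "\<lambda>k. if k = {} then 0 else \<bar>F (Sup k) - F (Inf k)\<bar>"
      have "(\<Sum>(x, k)\<in>q. ?f k) = sum ?f d"
        unfolding d_def
      proof (rule sum.over_tagged_division_lemma[OF q])
        fix u v :: real assume "box u v = {}"
        then show "?f (cbox u v) = 0"
          by (cases "u = v") auto
      qed
      moreover have "(\<Sum>(x, k)\<in>q. ?f k) = (\<Sum>(x, k)\<in>q. \<bar>F (Sup k) - F (Inf k)\<bar>)"
        using tagged_division_ofD(2)[OF q] by (intro sum.cong) fastforce+
      moreover have "sum ?f d = (\<Sum>k\<in>d. \<bar>F (Sup k) - F (Inf k)\<bar>)"
        using division_ofD(3)[OF d] by (intro sum.cong) auto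
      ultimately show ?thesis by simp
    qed
    ultimately have qsum: "(\<Sum>(x, k)\<in>q. F (Sup k) - F (Inf k)) \<le> e"
      using sum_mono[of q "\<lambda>(x, k). F (Sup k) - F (Inf k)" "\<lambda>(x, k). \<bar>F (Sup k) - F (Inf k)\<bar>"]
      by fastforce
    have "(\<Sum>(x, k)\<in>p - q. F (Sup k) - F (Inf k)) \<le> (\<Sum>(x, k)\<in>p - q. e * (Sup k - Inf k))"
    proof (rule sum_mono, clarify)
      fix x k assume xk: "(x, k) \<in> p" "(x, k) \<notin> q"
      then have xN: "x \<notin> N" unfolding q_def by auto
      obtain u v where uv: "k = {u..v}" "u \<le> x" "x \<le> v" "a \<le> u" "v \<le> b"
        using kform[OF xk(1)] by blast
      then have xab: "x \<in> {a..b} - N" using xN by auto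
      have "k \<subseteq> ball x (r x)"
        using fineD[OF p(2) xk(1)] xab xN unfolding \<gamma>_def by simp
      moreover have "u \<in> k" "v \<in> k" using uv by auto
      ultimately have "\<bar>u - x\<bar> < r x" "\<bar>v - x\<bar> < r x"
        unfolding ball_def dist_real_def by (auto simp: abs_minus_commute)
      then obtain D where D: "D \<le> 0" "\<bar>F u - F x - D * (u - x)\<bar> \<le> e * \<bar>u - x\<bar>"
          "\<bar>F v - F x - D * (v - x)\<bar> \<le> e * \<bar>v - x\<bar>"
        using r(2)[OF xab] by blast
      \<comment> \<open>Straddle estimate: as the tag \<open>x\<close> lies between \<open>u\<close>
        and \<open>v\<close>, the linear terms combine to \<open>D * (v - u)\<close>, which is at
        most 0, and the two errors add up to \<open>e * (v - u)\<close>.\<close>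
      have "D * (v - x) - D * (u - x) \<le> 0"
        using D(1) uv by (simp add: algebra_simps mult_le_cancel_left)
      moreover have "e * \<bar>u - x\<bar> + e * \<bar>v - x\<bar> = e * (v - u)"
        using uv by (simp add: algebra_simps)
      ultimately have "F v - F u \<le> e * (v - u)"
        using D by linarith
      then show "F (Sup k) - F (Inf k) \<le> e * (Sup k - Inf k)" using uv by auto
    qed
    also have "\<dots> \<le> (\<Sum>(x, k)\<in>p. e * (Sup k - Inf k))"
    proof (intro sum_mono2 finp Diff_subset)
      fix z assume "z \<in> p - (p - q)"
      then obtain x k where xk: "z = (x, k)" "(x, k) \<in> p" by (cases z) auto
      from kform[OF xk(2)] obtain u v where "k = {u..v}" "u \<le> x" "x \<le> v" by blast
      then show "0 \<le> (case z of (x, k) \<Rightarrow> e * (Sup k - Inf k))" using e xk(1) by simp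
    qed
    also have "\<dots> = e * (b - a)"
      using additive_tagged_division_1[OF less_imp_le[OF ab] p(1), of "\<lambda>x. x"]
      by (simp add: sum_distrib_left[symmetric] case_prod_unfold)
    finally have "(\<Sum>(x, k)\<in>p - q. F (Sup k) - F (Inf k)) \<le> e * (b - a)" .
    moreover have "(\<Sum>(x, k)\<in>p. F (Sup k) - F (Inf k)) = (\<Sum>(x, k)\<in>p - q. F (Sup k) - F (Inf k))
        + (\<Sum>(x, k)\<in>q. F (Sup k) - F (Inf k))"
      by (rule sum.subset_diff[OF qsub finp])
    moreover have "(\<Sum>(x, k)\<in>p. F (Sup k) - F (Inf k)) = F b - F a"
      using additive_tagged_division_1[OF less_imp_le[OF ab] p(1), of F] .
    ultimately show ?thesis using qsum by (simp add: algebra_simps)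
  qed
  show ?thesis
  proof (rule field_le_epsilon)
    fix e :: real assume "e > 0"
    then have "F b \<le> F a + e / (1 + (b - a)) * (1 + (b - a))"
      using ab by (intro approx) simp
    then show "F b \<le> F a + e" using ab by simp
  qed
qed simp

lemma abs_continuous_on_interval_subset:
  assumes "abs_continuous_on_interval a b F" "a \<le> a'" "b' \<le> b"
  shows "abs_continuous_on_interval a' b' F"
proof -
  have "{a'..b'} \<subseteq> {a..b}" using assms by auto
  then show ?thesis using assms(1) unfolding abs_continuous_on_interval_def
    by (meson order_trans)
qed

lemma abs_continuous_on_interval_add:
  assumes "abs_continuous_on_interval a b F" "abs_continuous_on_interval a b G"
  shows "abs_continuous_on_interval a b (\<lambda>x. F x + G x)"
  unfolding abs_continuous_on_interval_def
proof (intro allI impI)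
  fix e :: real assume e: "e > 0"
  then have e2: "e / 2 > 0" by simp
  obtain d1 where d1: "d1 > 0" and D1: "\<And>d. d division_of \<Union>d \<Longrightarrow> \<Union>d \<subseteq> {a..b} \<Longrightarrow>
        (\<Sum>k\<in>d. Sup k - Inf k) < d1 \<Longrightarrow> (\<Sum>k\<in>d. \<bar>F (Sup k) - F (Inf k)\<bar>) < e / 2"
    using assms(1)[unfolded abs_continuous_on_interval_def, rule_format, OF e2] by blast
  obtain d2 where d2: "d2 > 0" and D2: "\<And>d. d division_of \<Union>d \<Longrightarrow> \<Union>d \<subseteq> {a..b} \<Longrightarrow>
        (\<Sum>k\<in>d. Sup k - Inf k) < d2 \<Longrightarrow> (\<Sum>k\<in>d. \<bar>G (Sup k) - G (Inf k)\<bar>) < e / 2"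
    using assms(2)[unfolded abs_continuous_on_interval_def, rule_format, OF e2] by blast
  show "\<exists>\<delta>>0. \<forall>d. d division_of \<Union> d \<and> \<Union> d \<subseteq> {a..b} \<and> (\<Sum>k\<in>d. Sup k - Inf k) < \<delta> \<longrightarrow>
         (\<Sum>k\<in>d. \<bar>F (Sup k) + G (Sup k) - (F (Inf k) + G (Inf k))\<bar>) < e"
  proof (intro exI[of _ "min d1 d2"] conjI allI impI)
    fix d :: "real set set" assume d: "d division_of \<Union> d \<and> \<Union> d \<subseteq> {a..b} \<and> (\<Sum>k\<in>d. Sup k - Inf k) < min d1 d2"
    have "(\<Sum>k\<in>d. \<bar>F (Sup k) + G (Sup k) - (F (Inf k) + G (Inf k))\<bar>)
        \<le> (\<Sum>k\<in>d. \<bar>F (Sup k) - F (Inf k)\<bar> + \<bar>G (Sup k) - G (Inf k)\<bar>)"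
      by (intro sum_mono) linarith
    also have "\<dots> < e / 2 + e / 2"
      unfolding sum.distrib using d by (intro add_strict_mono D1 D2) auto
    finally show "(\<Sum>k\<in>d. \<bar>F (Sup k) + G (Sup k) - (F (Inf k) + G (Inf k))\<bar>) < e" by simp
  qed (use d1 d2 in auto)
qed

lemma abs_continuous_on_interval_minus:
  "abs_continuous_on_interval a b F \<Longrightarrow> abs_continuous_on_interval a b (\<lambda>x. - F x)"
  unfolding abs_continuous_on_interval_def by (simp add: abs_minus_commute)

lemma lipschitz_imp_abs_continuous_on_interval:
  assumes "C-lipschitz_on {a..b} F"
  shows "abs_continuous_on_interval a b F"
  unfolding abs_continuous_on_interval_def
proof (intro allI impI)
  fix e :: real assume e: "e > 0"
  have C: "C \<ge> 0" using assms by (rule lipschitz_on_nonneg)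
  show "\<exists>\<delta>>0. \<forall>d. d division_of \<Union> d \<and> \<Union> d \<subseteq> {a..b} \<and> (\<Sum>k\<in>d. Sup k - Inf k) < \<delta> \<longrightarrow>
         (\<Sum>k\<in>d. \<bar>F (Sup k) - F (Inf k)\<bar>) < e"
  proof (intro exI[of _ "e / (C + 1)"] conjI allI impI)
    fix d assume d: "d division_of \<Union> d \<and> \<Union> d \<subseteq> {a..b} \<and> (\<Sum>k\<in>d. Sup k - Inf k) < e / (C + 1)"
    have "\<bar>F (Sup k) - F (Inf k)\<bar> \<le> C * (Sup k - Inf k) \<and> 0 \<le> Sup k - Inf k" if k: "k \<in> d" for k
    proof -
      obtain u v where uv: "k = {u..v}" "u \<le> v"
        using division_ofD(3,4)[of d "\<Union>d" k] d k by fastforce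
      have "k \<subseteq> {a..b}" using d k by blast
      then have "u \<in> {a..b}" "v \<in> {a..b}" using uv by auto
      then show ?thesis
        using lipschitz_onD[OF assms, of v u] uv by (simp add: dist_real_def)
    qed
    then have "(\<Sum>k\<in>d. \<bar>F (Sup k) - F (Inf k)\<bar>) \<le> (\<Sum>k\<in>d. C * (Sup k - Inf k))"
      "(\<Sum>k\<in>d. Sup k - Inf k) \<ge> 0"
      by (auto intro!: sum_mono sum_nonneg)
    then have "(\<Sum>k\<in>d. \<bar>F (Sup k) - F (Inf k)\<bar>) \<le> (C + 1) * (\<Sum>k\<in>d. Sup k - Inf k)"
      by (simp add: sum_distrib_left[symmetric] distrib_right)
    also have "\<dots> < (C + 1) * (e / (C + 1))"
      using d C by (intro mult_strict_left_mono) auto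
    finally show "(\<Sum>k\<in>d. \<bar>F (Sup k) - F (Inf k)\<bar>) < e" using C by simp
  qed (use e C in auto)
qed

text \<open>Both \<open>F t - C * t\<close> and \<open>- F t - C * t\<close> are nonincreasing. This
  is how Caratheodory solutions turn out to be Lipschitz.\<close>

lemma abs_continuous_on_interval_bounded_derivative:
  assumes ac: "abs_continuous_on_interval a b F" and C: "C \<ge> 0"
    and ae: "AE t in lebesgue. t \<in> {a<..<b} \<longrightarrow> (\<exists>D. \<bar>D\<bar> \<le> C \<and> (F has_real_derivative D) (at t))"
  shows "C-lipschitz_on {a..b} F"
proof (rule lipschitz_on_leI[OF _ C])
  fix x y assume xy: "x \<in> {a..b}" "y \<in> {a..b}" "x \<le> y"
  have sub: "abs_continuous_on_interval x y F"
    using ac xy by (auto intro: abs_continuous_on_interval_subset)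
  have lin: "abs_continuous_on_interval x y (\<lambda>t. - C * t)"
  proof (rule lipschitz_imp_abs_continuous_on_interval)
    show "C-lipschitz_on {x..y} (\<lambda>t. - C * t)"
      using lipschitz_on_cmult_real[OF lipschitz_on_id, where a = "- C"] C by simp
  qed
  have "F y + - C * y \<le> F x + - C * x"
  proof (rule abs_continuous_nonincreasing[OF xy(3) abs_continuous_on_interval_add[OF sub lin]])
    show "AE t in lebesgue. t \<in> {x<..<y} \<longrightarrow> (\<exists>D\<le>0. ((\<lambda>t. F t + - C * t) has_real_derivative D) (at t))"
      using ae
    proof eventually_elim
      case (elim t)
      show ?case
      proof
        assume "t \<in> {x<..<y}"
        then obtain D where D: "\<bar>D\<bar> \<le> C" "(F has_real_derivative D) (at t)" using elim xy by auto
        then show "\<exists>D\<le>0. ((\<lambda>t. F t + - C * t) has_real_derivative D) (at t)"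
          by (intro exI[of _ "D + - C"] conjI DERIV_add) (auto intro!: derivative_eq_intros)
      qed
    qed
  qed
  moreover have "- F y + - C * y \<le> - F x + - C * x"
  proof (rule abs_continuous_nonincreasing[OF xy(3) abs_continuous_on_interval_add[OF abs_continuous_on_interval_minus[OF sub] lin]])
    show "AE t in lebesgue. t \<in> {x<..<y} \<longrightarrow> (\<exists>D\<le>0. ((\<lambda>t. - F t + - C * t) has_real_derivative D) (at t))"
      using ae
    proof eventually_elim
      case (elim t)
      show ?case
      proof
        assume "t \<in> {x<..<y}"
        then obtain D where D: "\<bar>D\<bar> \<le> C" "(F has_real_derivative D) (at t)" using elim xy by auto
        then show "\<exists>D\<le>0. ((\<lambda>t. - F t + - C * t) has_real_derivative D) (at t)"
          by (intro exI[of _ "- D + - C"] conjI DERIV_add DERIV_minus) (auto intro!: derivative_eq_intros)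
      qed
    qed
  qed
  ultimately show "dist (F x) (F y) \<le> C * dist x y"
    using xy by (simp add: dist_real_def abs_if algebra_simps)
qed

section \<open>Lipschitz functions, monotonicity and barriers\<close>

text \<open>The constant is hidden because only closure properties and monotonicity matter later.
  Unlike absolute continuity, this property passes to compositions, which the logarithmic coordinate
  relies on.\<close>

definition lip_on :: "real \<Rightarrow> real \<Rightarrow> (real \<Rightarrow> real) \<Rightarrow> bool" where
  "lip_on a b F \<longleftrightarrow> (\<exists>C. C-lipschitz_on {a..b} F)"

lemma lip_on_subset: "lip_on a b F \<Longrightarrow> a \<le> a' \<Longrightarrow> b' \<le> b \<Longrightarrow> lip_on a' b' F"
  unfolding lip_on_def by (meson atLeastatMost_subset_iff lipschitz_on_subset)

lemma lip_on_cong: "lip_on a b F \<Longrightarrow> (\<And>x. x \<in> {a..b} \<Longrightarrow> F x = G x) \<Longrightarrow> lip_on a b G"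
  unfolding lip_on_def using lipschitz_on_transform by metis

lemma lip_on_const [simp, intro]: "lip_on a b (\<lambda>x. c)"
  unfolding lip_on_def using lipschitz_on_constant by blast

lemma lip_on_add [intro]: "lip_on a b F \<Longrightarrow> lip_on a b G \<Longrightarrow> lip_on a b (\<lambda>x. F x + G x)"
  unfolding lip_on_def using lipschitz_on_add by blast

lemma lip_on_minus [intro]: "lip_on a b F \<Longrightarrow> lip_on a b (\<lambda>x. - F x)"
  unfolding lip_on_def using lipschitz_on_minus by blast

lemma lip_on_diff [intro]: "lip_on a b F \<Longrightarrow> lip_on a b G \<Longrightarrow> lip_on a b (\<lambda>x. F x - G x)"
  unfolding lip_on_def using lipschitz_on_diff by blast

lemma lip_on_continuous: "lip_on a b F \<Longrightarrow> continuous_on {a..b} F"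
  unfolding lip_on_def using lipschitz_on_continuous_on by blast

lemma lip_on_bounded:
  assumes "lip_on a b F"
  obtains B where "B \<ge> 0" "\<And>x. x \<in> {a..b} \<Longrightarrow> \<bar>F x\<bar> \<le> B"
proof -
  have "bounded (F ` {a..b})"
    by (intro compact_imp_bounded compact_continuous_image lip_on_continuous assms compact_Icc)
  then obtain B where "\<forall>x\<in>{a..b}. \<bar>F x\<bar> \<le> B" unfolding bounded_iff by auto
  then show ?thesis by (intro that[of "max B 0"]) (auto simp: le_max_iff_disj)
qed

lemma lip_on_mult [intro]:
  assumes "lip_on a b F" "lip_on a b G"
  shows "lip_on a b (\<lambda>x. F x * G x)"
proof -
  obtain B where B: "B \<ge> 0" "\<And>x. x \<in> {a..b} \<Longrightarrow> \<bar>F x\<bar> \<le> B" using lip_on_bounded[OF assms(1)] by blast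
  obtain B' where B': "B' \<ge> 0" "\<And>x. x \<in> {a..b} \<Longrightarrow> \<bar>G x\<bar> \<le> B'" using lip_on_bounded[OF assms(2)] by blast
  obtain C where C: "C-lipschitz_on {a..b} F" using assms(1) unfolding lip_on_def by blast
  obtain C' where C': "C'-lipschitz_on {a..b} G" using assms(2) unfolding lip_on_def by blast
  have n: "C \<ge> 0" "C' \<ge> 0" using C C' by (auto intro: lipschitz_on_nonneg)
  have "(B * C' + C * B')-lipschitz_on {a..b} (\<lambda>x. F x * G x)"
  proof (rule lipschitz_onI)
    fix x y assume xy: "x \<in> {a..b}" "y \<in> {a..b}"
    have "\<bar>F x * G x - F y * G y\<bar> = \<bar>F x * (G x - G y) + (F x - F y) * G y\<bar>"
      by (simp add: algebra_simps)
    also have "\<dots> \<le> \<bar>F x\<bar> * \<bar>G x - G y\<bar> + \<bar>F x - F y\<bar> * \<bar>G y\<bar>"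
      by (metis abs_mult abs_triangle_ineq)
    also have "\<dots> \<le> B * (C' * \<bar>x - y\<bar>) + (C * \<bar>x - y\<bar>) * B'"
      using B(2)[OF xy(1)] B'(2)[OF xy(2)] B(1) B'(1) n
        lipschitz_onD[OF C xy] lipschitz_onD[OF C' xy]
      by (intro add_mono mult_mono) (auto simp: dist_real_def)
    finally show "dist (F x * G x) (F y * G y) \<le> (B * C' + C * B') * dist x y"
      by (simp add: dist_real_def algebra_simps)
  qed (use B(1) B'(1) n in auto)
  then show ?thesis unfolding lip_on_def by (rule exI)
qed

lemma lip_on_C1:
  assumes "\<And>x. x \<in> {a..b} \<Longrightarrow> (F has_real_derivative F' x) (at x within {a..b})"
    and "continuous_on {a..b} F'"
  shows "lip_on a b F"
proof -
  have "bounded (F' ` {a..b})"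
    by (intro compact_imp_bounded compact_continuous_image assms compact_Icc)
  then obtain B where B: "\<forall>x\<in>{a..b}. \<bar>F' x\<bar> \<le> B" unfolding bounded_iff by auto
  have "(max B 0)-lipschitz_on {a..b} F"
  proof (rule lipschitz_onI)
    fix x y assume xy: "x \<in> {a..b}" "y \<in> {a..b}"
    have "norm (F x - F y) \<le> max B 0 * norm (x - y)"
      by (rule field_differentiable_bound[of "{a..b}" F F']) (use assms B xy in \<open>auto simp: le_max_iff_disj\<close>)
    then show "dist (F x) (F y) \<le> max B 0 * dist x y" by (simp add: dist_real_def)
  qed auto
  then show ?thesis unfolding lip_on_def by (rule exI)
qed

lemma lip_on_compose:
  assumes "lip_on a b F" "lip_on c d G" "\<And>x. x \<in> {a..b} \<Longrightarrow> F x \<in> {c..d}"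
  shows "lip_on a b (\<lambda>x. G (F x))"
proof -
  obtain C where C: "C-lipschitz_on {a..b} F" using assms(1) unfolding lip_on_def by blast
  obtain C' where C': "C'-lipschitz_on {c..d} G" using assms(2) unfolding lip_on_def by blast
  have "(C' * C)-lipschitz_on {a..b} (\<lambda>x. G (F x))"
    by (rule lipschitz_on_compose2[OF C lipschitz_on_subset[OF C']]) (use assms(3) in auto)
  then show ?thesis unfolding lip_on_def by (rule exI)
qed

lemma lip_on_id [simp, intro]: "lip_on a b (\<lambda>x. x)"
  unfolding lip_on_def using lipschitz_on_id by blast

lemma lip_on_exp [intro]: "lip_on a b (\<lambda>x. exp (c * x))"
  by (rule lip_on_C1[where F' = "\<lambda>x. c * exp (c * x)"]) (auto intro!: derivative_eq_intros continuous_intros)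

lemma lip_on_nonincreasing:
  assumes "a \<le> b" "lip_on a b F"
    and "AE t in lebesgue. t \<in> {a<..<b} \<longrightarrow> (\<exists>D\<le>0. (F has_real_derivative D) (at t))"
  shows "F b \<le> F a"
  using assms abs_continuous_nonincreasing lipschitz_imp_abs_continuous_on_interval
  unfolding lip_on_def by blast

text \<open>The sublevel set is closed and so contains its supremum. It serves to reduce a claim to
  a final stretch on which a bound is violated throughout.\<close>

lemma last_time_le:
  fixes F :: "real \<Rightarrow> real"
  assumes "continuous_on {a..b} F" "F a \<le> c" "a \<le> b"
  obtains s where "s \<in> {a..b}" "F s \<le> c" "\<And>x. x \<in> {s<..b} \<Longrightarrow> F x > c"
proof -
  define S where "S = {a..b} \<inter> F -` {..c}"
  have "closed S"
    unfolding S_def using assms(1) by (intro continuous_closed_preimage) auto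
  moreover have "a \<in> S" using assms S_def by auto
  moreover have bdd: "bdd_above S" by (rule bdd_aboveI[of _ b]) (auto simp: S_def)
  ultimately have S: "Sup S \<in> S" using closed_contains_Sup by blast
  show ?thesis
  proof (rule that[of "Sup S"])
    fix x assume x: "x \<in> {Sup S<..b}"
    then have "x \<notin> S" using cSup_upper[OF _ bdd] by fastforce
    then show "F x > c" using x S by (auto simp: S_def)
  qed (use S in \<open>auto simp: S_def\<close>)
qed

text \<open>Gronwall on the stretch after the last time with \<open>F \<le> c\<close>: there
  \<open>exp (- L * x) * (F x - c)\<close> is nonincreasing and starts at a value at most 0. The
  differential inequality is required only where \<open>F > c\<close>, so applications may exploit
  the sign information that holds there.\<close>

lemma lip_on_barrier:
  assumes lip: "lip_on a b F" and a: "F a \<le> c" and t: "t \<in> {a..b}"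
    and ae: "AE t in lebesgue. t \<in> {a<..<b} \<longrightarrow> F t > c \<longrightarrow>
      (\<exists>D. D \<le> L * (F t - c) \<and> (F has_real_derivative D) (at t))"
  shows "F t \<le> c"
proof (rule ccontr)
  assume Ft: "\<not> F t \<le> c"
  have cont: "continuous_on {a..t} F"
    using lip_on_continuous[OF lip] t by (auto intro: continuous_on_subset)
  obtain s where s: "s \<in> {a..t}" "F s \<le> c" "\<And>x. x \<in> {s<..t} \<Longrightarrow> F x > c"
    using last_time_le[OF cont a] t by auto
  have lipst: "lip_on s t F" using lip_on_subset[OF lip] s(1) t by auto
  let ?G = "\<lambda>x. exp ((- L) * x) * (F x - c)"
  have "?G t \<le> ?G s"
  proof (rule lip_on_nonincreasing[where F = ?G])
    show "lip_on s t ?G"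
      by (intro lip_on_mult lip_on_exp lip_on_diff lipst lip_on_const)
    show "AE x in lebesgue. x \<in> {s<..<t} \<longrightarrow> (\<exists>D\<le>0. (?G has_real_derivative D) (at x))"
      using ae
    proof eventually_elim
      case (elim x)
      show ?case
      proof
        assume x: "x \<in> {s<..<t}"
        then obtain D where D: "D \<le> L * (F x - c)" "(F has_real_derivative D) (at x)"
          using elim s t by auto
        have "(?G has_real_derivative exp ((- L) * x) * (D - L * (F x - c))) (at x)"
          by (rule derivative_eq_intros refl D(2))+ (simp add: algebra_simps)
        moreover have "exp ((- L) * x) * (D - L * (F x - c)) \<le> 0"
          using D(1) by (simp add: mult_le_0_iff)
        ultimately show "\<exists>D\<le>0. (?G has_real_derivative D) (at x)" by blast
      qed
    qed
  qed (use s in auto)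
  moreover have "?G s \<le> 0" using s(2) by (simp add: mult_le_0_iff)
  moreover have "?G t > 0" using Ft by simp
  ultimately show False by linarith
qed

section \<open>Almost everywhere differentiability of indefinite integrals\<close>

text \<open>Averages over intervals to the right of \<open>x\<close> converge off a null set; the
  same fact for the reflected function \<open>f (- x)\<close> handles averages to the left. These
  averages do not see the lower limit, so a single null set serves every \<open>a\<close>.\<close>

lemma lebesgue_differentiation:
  fixes f :: "real \<Rightarrow> real"
  assumes f: "\<And>a b. f integrable_on {a..b}"
  shows "AE x in lebesgue. \<forall>a<x. ((\<lambda>t. integral {a..t} f) has_real_derivative f x) (at x)"
proof -
  obtain N where N: "negligible N"
    "\<And>x e. x \<notin> N \<Longrightarrow> 0 < e \<Longrightarrow> \<exists>d>0. \<forall>h. 0 < h \<and> h < d \<longrightarrow> \<bar>integral {x..x + h} f / h - f x\<bar> < e"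
    using integrable_ccontinuous_explicit[of f] f by (auto simp: divide_inverse mult.commute)
  have f': "(\<lambda>x. f (- x)) integrable_on {a..b}" for a b
    using f[of "- b" "- a"] Henstock_Kurzweil_Integration.integrable_reflect_real[of f "- a" "- b"] by simp
  obtain N' where N': "negligible N'"
    "\<And>x e. x \<notin> N' \<Longrightarrow> 0 < e \<Longrightarrow> \<exists>d>0. \<forall>h. 0 < h \<and> h < d \<longrightarrow>
       \<bar>integral {x..x + h} (\<lambda>x. f (- x)) / h - f (- x)\<bar> < e"
    using integrable_ccontinuous_explicit[of "\<lambda>x. f (- x)"] f' by (auto simp: divide_inverse mult.commute)
  have refl: "integral {x..x + h} (\<lambda>x. f (- x)) = integral {- x - h..- x} f" for x h :: real
    using Henstock_Kurzweil_Integration.integral_reflect_real[of "- x" "- x - h" f]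
    by (simp add: add.commute)
  have neg: "negligible (N \<union> uminus ` N')"
    by (intro negligible_Un N(1) negligible_differentiable_image_negligible[OF order_refl N'(1)])
      (auto intro!: derivative_intros simp: differentiable_on_def)
  have "((\<lambda>t. integral {a..t} f) has_real_derivative f x) (at x)" if x: "x \<notin> N \<union> uminus ` N'" and a: "a < x" for x a
    unfolding DERIV_def LIM_def
  proof (intro allI impI)
    fix e :: real assume e: "e > 0"
    have "x \<notin> N" "- x \<notin> N'" using x by force+
    obtain d1 where d1: "d1 > 0" "\<And>h. 0 < h \<Longrightarrow> h < d1 \<Longrightarrow> \<bar>integral {x..x + h} f / h - f x\<bar> < e"
      using N(2)[OF \<open>x \<notin> N\<close> e] by blast
    obtain d2 where d2: "d2 > 0" "\<And>h. 0 < h \<Longrightarrow> h < d2 \<Longrightarrow> \<bar>integral {x - h..x} f / h - f x\<bar> < e"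
      using N'(2)[OF \<open>- x \<notin> N'\<close> e] unfolding refl minus_minus by blast
    show "\<exists>s>0. \<forall>h. h \<noteq> 0 \<and> dist h 0 < s \<longrightarrow>
       dist ((integral {a..x + h} f - integral {a..x} f) / h) (f x) < e"
    proof (intro exI[of _ "min (x - a) (min d1 d2)"] conjI allI impI)
      fix h :: real assume h: "h \<noteq> 0 \<and> dist h 0 < min (x - a) (min d1 d2)"
      show "dist ((integral {a..x + h} f - integral {a..x} f) / h) (f x) < e"
      proof (cases "h > 0")
        case True
        have "integral {a..x} f + integral {x..x + h} f = integral {a..x + h} f"
          using True a by (intro Henstock_Kurzweil_Integration.integral_combine f) auto
        then have "integral {a..x + h} f - integral {a..x} f = integral {x..x + h} f" by simp
        then show ?thesis using d1(2)[of h] True h by (simp only: dist_real_def) simp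
      next
        case False
        have "integral {a..x + h} f + integral {x + h..x} f = integral {a..x} f"
          using False a h by (intro Henstock_Kurzweil_Integration.integral_combine f) (auto simp: dist_real_def)
        then have "integral {a..x + h} f - integral {a..x} f = - integral {x - (- h)..x} f" by simp
        then have "(integral {a..x + h} f - integral {a..x} f) / h = integral {x - (- h)..x} f / (- h)"
          by simp
        then show ?thesis using d2(2)[of "- h"] False h by (simp only: dist_real_def) simp
      qed
    qed (use d1(1) d2(1) a in auto)
  qed
  then show ?thesis
    using neg by (auto simp: negligible_iff_null_sets intro!: AE_I'[of "N \<union> uminus ` N'"])
qed

section \<open>Comparison of characteristics\<close>

definition rhs :: "real \<Rightarrow> real \<Rightarrow> real \<Rightarrow> real \<Rightarrow> real" where
  "rhs c1 c2 y v = fun_a y + fun_b c1 c2 y * v"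

text \<open>In the coordinate \<open>zeta\<close> the control enters additively: along a characteristic,
  \<open>zeta\<close> has derivative \<open>c1 * u - zdrift\<close>, and \<open>zrate\<close> is the derivative of \<open>zdrift\<close> with
  respect to \<open>zeta\<close>.\<close>

definition zeta :: "real \<Rightarrow> real \<Rightarrow> real \<Rightarrow> real" where
  "zeta c1 c2 y = ln (fun_b c1 c2 y)"

definition zdrift :: "real \<Rightarrow> real \<Rightarrow> real \<Rightarrow> real" where
  "zdrift c1 c2 y = c1 * y ^ 2 / fun_b c1 c2 y"

definition zrate :: "real \<Rightarrow> real \<Rightarrow> real \<Rightarrow> real" where
  "zrate c1 c2 y = (c1 * y ^ 2 + 2 * c2 * y) / fun_b c1 c2 y"

text \<open>No initial value is fixed, so that the notion restricts to any subinterval, such as the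
  stretches before and after an exit. Nonnegativity is included because it keeps
  \<open>fun_b\<close> positive and hence \<open>zeta\<close> meaningful along the solution.\<close>

definition is_sol :: "real \<Rightarrow> real \<Rightarrow> real \<Rightarrow> real \<Rightarrow> (real \<Rightarrow> real) \<Rightarrow> (real \<Rightarrow> real) \<Rightarrow> bool" where
  "is_sol c1 c2 a b u y \<longleftrightarrow> lip_on a b y \<and> (\<forall>t\<in>{a..b}. 0 \<le> y t) \<and>
     (AE t in lebesgue. t \<in> {a<..<b} \<longrightarrow> (y has_real_derivative rhs c1 c2 (y t) (u t)) (at t))"

lemma is_sol_subset:
  assumes "is_sol c1 c2 a b u y" "a \<le> a'" "b' \<le> b"
  shows "is_sol c1 c2 a' b' u y"
proof -
  have "AE t in lebesgue. t \<in> {a'<..<b'} \<longrightarrow> (y has_real_derivative rhs c1 c2 (y t) (u t)) (at t)"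
    using assms unfolding is_sol_def by (auto elim!: eventually_mono)
  moreover have "lip_on a' b' y" using assms lip_on_subset unfolding is_sol_def by blast
  ultimately show ?thesis using assms unfolding is_sol_def by auto
qed

lemma is_sol_lip: "is_sol c1 c2 a b u y \<Longrightarrow> lip_on a b y"
  and is_sol_nonneg: "is_sol c1 c2 a b u y \<Longrightarrow> t \<in> {a..b} \<Longrightarrow> 0 \<le> y t"
  and is_sol_ae: "is_sol c1 c2 a b u y \<Longrightarrow>
     AE t in lebesgue. t \<in> {a<..<b} \<longrightarrow> (y has_real_derivative rhs c1 c2 (y t) (u t)) (at t)"
  unfolding is_sol_def by auto

section \<open>Monotonicity in the logarithmic coordinate\<close>

locale riccati =
  fixes c1 c2 :: real
  assumes c1: "c1 > 0" and c2: "c2 > 0"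
begin

lemma fun_b_pos: "0 \<le> y \<Longrightarrow> fun_b c1 c2 y > 0"
  using c1 c2 by (simp add: fun_b_def add_nonneg_pos)

lemma zeta_le_iff: "0 \<le> x \<Longrightarrow> 0 \<le> y \<Longrightarrow> zeta c1 c2 x \<le> zeta c1 c2 y \<longleftrightarrow> x \<le> y"
  using fun_b_pos[of x] fun_b_pos[of y] c1 by (simp add: zeta_def fun_b_def)

lemma zdrift_mono:
  assumes "0 \<le> x" "x \<le> y"
  shows "zdrift c1 c2 x \<le> zdrift c1 c2 y"
proof -
  have "0 \<le> c1 * (c1 * x * y * (y - x) + c2 * ((y - x) * (y + x)))"
    using assms c1 c2 by (intro mult_nonneg_nonneg add_nonneg_nonneg) auto
  also have "\<dots> = c1 * y ^ 2 * fun_b c1 c2 x - c1 * x ^ 2 * fun_b c1 c2 y"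
    by (simp add: fun_b_def algebra_simps power2_eq_square)
  finally show ?thesis
    using fun_b_pos[of x] fun_b_pos[of y] assms by (simp add: zdrift_def divide_simps mult.commute)
qed

lemma zrate_mono:
  assumes "0 \<le> x" "x \<le> y"
  shows "zrate c1 c2 x \<le> zrate c1 c2 y"
proof -
  \<comment> \<open>Polynomial division splits \<open>zrate\<close> into two increasing
    summands.\<close>
  have eq: "zrate c1 c2 z = z + (c2 / c1) * (1 - c2 / fun_b c1 c2 z)" if "z \<ge> 0" for z
    using fun_b_pos[OF that] c1 by (simp add: zrate_def fun_b_def field_simps power2_eq_square)
  have "c2 / fun_b c1 c2 y \<le> c2 / fun_b c1 c2 x"
    using assms c1 c2 fun_b_pos[of x] by (intro divide_left_mono mult_pos_pos fun_b_pos) (auto simp: fun_b_def)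
  then have "(c2 / c1) * (1 - c2 / fun_b c1 c2 x) \<le> (c2 / c1) * (1 - c2 / fun_b c1 c2 y)"
    using c1 c2 by (intro mult_left_mono) auto
  then show ?thesis using assms eq[of x] eq[of y] by simp
qed

lemma zrate_nonneg: "0 \<le> y \<Longrightarrow> zrate c1 c2 y \<ge> 0"
  using zrate_mono[of 0 y] by (simp add: zrate_def)

text \<open>The difference of \<open>H * zeta - zdrift\<close> between two solutions is what drives
  their weighted distance in \<open>gap_deriv\<close>. Choosing \<open>H\<close> as
  \<open>zrate\<close> at a level \<open>z\<close> makes this potential increase up to
  \<open>z\<close> and decrease beyond it, because \<open>zrate\<close> is monotone;
  \<open>zpot_mono\<close> and \<open>zpot_antimono\<close> record the two halves.\<close>

lemma zpot_deriv:
  assumes "0 \<le> y"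
  shows "((\<lambda>y. H * zeta c1 c2 y - zdrift c1 c2 y) has_real_derivative
           c1 / fun_b c1 c2 y * (H - zrate c1 c2 y)) (at y)"
proof -
  have b: "c1 * y + c2 > 0" using fun_b_pos[OF assms] by (simp add: fun_b_def)
  have "((\<lambda>y. H * ln (c1 * y + c2) - c1 * y ^ 2 / (c1 * y + c2)) has_real_derivative
     H * (c1 / (c1 * y + c2)) - (c1 * (2 * y) * (c1 * y + c2) - c1 * y ^ 2 * c1) / ((c1 * y + c2) * (c1 * y + c2))) (at y)"
    using b by (auto intro!: derivative_eq_intros simp: mult.commute mult.left_commute)
  moreover have "H * (c1 / (c1 * y + c2)) - (c1 * (2 * y) * (c1 * y + c2) - c1 * y ^ 2 * c1) / ((c1 * y + c2) * (c1 * y + c2))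
     = c1 / (c1 * y + c2) * (H - (c1 * y ^ 2 + 2 * c2 * y) / (c1 * y + c2))"
  proof -
    have num: "c1 * (2 * y) * (c1 * y + c2) - c1 * y ^ 2 * c1 = c1 * (c1 * y ^ 2 + 2 * c2 * y)"
      by (simp add: algebra_simps power2_eq_square)
    show ?thesis unfolding num using b by (simp add: right_diff_distrib mult.commute)
  qed
  ultimately show ?thesis
    unfolding zeta_def zdrift_def zrate_def fun_b_def by simp
qed

lemma zpot_mono:
  assumes "0 \<le> x" "x \<le> y" "y \<le> z"
  shows "zrate c1 c2 z * zeta c1 c2 x - zdrift c1 c2 x \<le> zrate c1 c2 z * zeta c1 c2 y - zdrift c1 c2 y"
proof (rule DERIV_nonneg_imp_nondecreasing[OF assms(2)])
  fix v assume v: "x \<le> v" "v \<le> y"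
  then have "0 \<le> c1 / fun_b c1 c2 v * (zrate c1 c2 z - zrate c1 c2 v)"
    using assms c1 fun_b_pos[of v] zrate_mono[of v z] by (intro mult_nonneg_nonneg divide_nonneg_pos) auto
  then show "\<exists>D. ((\<lambda>y. zrate c1 c2 z * zeta c1 c2 y - zdrift c1 c2 y) has_real_derivative D) (at v) \<and> 0 \<le> D"
    using zpot_deriv[of v "zrate c1 c2 z"] v assms by fastforce
qed

lemma zpot_antimono:
  assumes "0 \<le> z" "z \<le> x" "x \<le> y"
  shows "zrate c1 c2 z * zeta c1 c2 y - zdrift c1 c2 y \<le> zrate c1 c2 z * zeta c1 c2 x - zdrift c1 c2 x"
proof (rule DERIV_nonpos_imp_nonincreasing[OF assms(3)])
  fix v assume v: "x \<le> v" "v \<le> y"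
  then have "c1 / fun_b c1 c2 v * (zrate c1 c2 z - zrate c1 c2 v) \<le> 0"
    using assms c1 fun_b_pos[of v] zrate_mono[of z v] by (intro mult_nonneg_nonpos divide_nonneg_pos) auto
  then show "\<exists>D. ((\<lambda>y. zrate c1 c2 z * zeta c1 c2 y - zdrift c1 c2 y) has_real_derivative D) (at v) \<and> D \<le> 0"
    using zpot_deriv[of v "zrate c1 c2 z"] v assms by fastforce
qed

lemma zeta_comp_deriv:
  assumes "(y has_real_derivative rhs c1 c2 (y t) v) (at t)" "0 \<le> y t"
  shows "((\<lambda>t. zeta c1 c2 (y t)) has_real_derivative c1 * v - zdrift c1 c2 (y t)) (at t)"
proof -
  have b: "c1 * y t + c2 > 0" using fun_b_pos[OF assms(2)] by (simp add: fun_b_def)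
  have "((\<lambda>t. ln (c1 * y t + c2)) has_real_derivative c1 * rhs c1 c2 (y t) v / (c1 * y t + c2)) (at t)"
    using b by (auto intro!: derivative_eq_intros assms(1))
  moreover have "c1 * rhs c1 c2 (y t) v / (c1 * y t + c2) = c1 * v - c1 * (y t) ^ 2 / (c1 * y t + c2)"
    using b by (simp add: rhs_def fun_a_def fun_b_def field_simps)
  ultimately show ?thesis unfolding zeta_def zdrift_def fun_b_def by simp
qed

lemma zeta_comp_lip:
  assumes "is_sol c1 c2 a b u y"
  shows "lip_on a b (\<lambda>t. zeta c1 c2 (y t))"
proof -
  obtain B where B: "B \<ge> 0" "\<And>t. t \<in> {a..b} \<Longrightarrow> \<bar>y t\<bar> \<le> B"
    using lip_on_bounded[OF is_sol_lip[OF assms]] by blast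
  have "lip_on 0 B (\<lambda>x. ln (c1 * x + c2))"
  proof (rule lip_on_C1[where F' = "\<lambda>x. c1 / (c1 * x + c2)"])
    fix x assume "x \<in> {0..B}"
    then have "c1 * x + c2 > 0" using fun_b_pos[of x] by (simp add: fun_b_def)
    then show "((\<lambda>x. ln (c1 * x + c2)) has_real_derivative c1 / (c1 * x + c2)) (at x within {0..B})"
      by (auto intro!: derivative_eq_intros)
  next
    have "c1 * x + c2 \<noteq> 0" if "x \<in> {0..B}" for x
      using fun_b_pos[of x] that by (simp add: fun_b_def)
    then show "continuous_on {0..B} (\<lambda>x. c1 / (c1 * x + c2))"
      by (intro continuous_intros) auto
  qed
  then show ?thesis
    unfolding zeta_def fun_b_def
    by (rule lip_on_compose[OF is_sol_lip[OF assms]]) (use B is_sol_nonneg[OF assms] in fastforce)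
qed

text \<open>Only the controls can enlarge the distance in \<open>zeta\<close>: the larger solution
  has the larger drift, which pulls it back. Nonnegativity of \<open>N\<close> ensures that an
  excess over \<open>N\<close> already means \<open>y2 t \<le> y1 t\<close>, so that the drift has
  the right sign and the barrier argument runs with \<open>L = 0\<close>.\<close>

lemma zeta_comparison:
  assumes sol: "is_sol c1 c2 a b u1 y1" "is_sol c1 c2 a b u2 y2"
    and N: "lip_on a b N" "\<And>t. t \<in> {a..b} \<Longrightarrow> 0 \<le> N t"
      "AE t in lebesgue. t \<in> {a<..<b} \<longrightarrow> (\<exists>D\<ge>c1 * (u1 t - u2 t). (N has_real_derivative D) (at t))"
    and init: "zeta c1 c2 (y1 a) - zeta c1 c2 (y2 a) \<le> N a" and t: "t \<in> {a..b}"
  shows "zeta c1 c2 (y1 t) - zeta c1 c2 (y2 t) \<le> N t"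
proof -
  let ?F = "\<lambda>t. (zeta c1 c2 (y1 t) - zeta c1 c2 (y2 t)) - N t"
  have "?F t \<le> 0"
  proof (rule lip_on_barrier[OF _ _ t, where L = 0])
    show "lip_on a b ?F"
      by (intro lip_on_diff zeta_comp_lip[OF sol(1)] zeta_comp_lip[OF sol(2)] N(1))
    show "?F a \<le> 0" using init by simp
    show "AE t in lebesgue. t \<in> {a<..<b} \<longrightarrow> 0 < ?F t \<longrightarrow> (\<exists>D. D \<le> 0 * (?F t - 0) \<and> (?F has_real_derivative D) (at t))"
      using is_sol_ae[OF sol(1)] is_sol_ae[OF sol(2)] N(3)
    proof eventually_elim
      case (elim t)
      show ?case
      proof (intro impI)
        assume t: "t \<in> {a<..<b}" and pos: "0 < ?F t"
        then have n: "0 \<le> y1 t" "0 \<le> y2 t" "0 \<le> N t"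
          using is_sol_nonneg[OF sol(1)] is_sol_nonneg[OF sol(2)] N(2) by auto
        obtain D where D: "D \<ge> c1 * (u1 t - u2 t)" "(N has_real_derivative D) (at t)"
          using elim(3) t by blast
        have "zeta c1 c2 (y2 t) \<le> zeta c1 c2 (y1 t)" using pos n by simp
        then have "zdrift c1 c2 (y2 t) \<le> zdrift c1 c2 (y1 t)"
          using n zeta_le_iff zdrift_mono by simp
        moreover have "(?F has_real_derivative
            (c1 * u1 t - zdrift c1 c2 (y1 t)) - (c1 * u2 t - zdrift c1 c2 (y2 t)) - D) (at t)"
          using elim t n by (intro DERIV_diff zeta_comp_deriv D(2)) auto
        ultimately show "\<exists>D. D \<le> 0 * (?F t - 0) \<and> (?F has_real_derivative D) (at t)"
          using D(1) by (intro exI conjI) (auto simp: algebra_simps)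
      qed
    qed
  qed
  then show ?thesis by simp
qed

lemma sol_mono:
  assumes sol: "is_sol c1 c2 a b u1 y1" "is_sol c1 c2 a b u2 y2"
    and u: "AE t in lebesgue. t \<in> {a<..<b} \<longrightarrow> u1 t \<le> u2 t"
    and init: "y1 a \<le> y2 a" and t: "t \<in> {a..b}"
  shows "y1 t \<le> y2 t"
proof -
  have "a \<in> {a..b}" using t by auto
  then have n: "0 \<le> y1 a" "0 \<le> y2 a" "0 \<le> y1 t" "0 \<le> y2 t"
    using is_sol_nonneg[OF sol(1)] is_sol_nonneg[OF sol(2)] t by blast+
  have "zeta c1 c2 (y1 t) - zeta c1 c2 (y2 t) \<le> 0"
  proof (rule zeta_comparison[OF sol, where N = "\<lambda>_. 0"])
    show "AE t in lebesgue. t \<in> {a<..<b} \<longrightarrow> (\<exists>D\<ge>c1 * (u1 t - u2 t). ((\<lambda>_. 0) has_real_derivative D) (at t))"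
      using u by eventually_elim (use c1 in \<open>auto intro!: exI[of _ 0] simp: mult_le_0_iff\<close>)
  qed (use init n t zeta_le_iff in auto)
  then show ?thesis using n zeta_le_iff by simp
qed

section \<open>Comparison with an exponential weight\<close>

text \<open>The term \<open>c1 * R t\<close> removes the contribution of the controls: when
  \<open>R\<close> is the integral of \<open>exp (H * t) * (u2 - u1)\<close>, the controls cancel in
  the derivative and only a difference of the potentials \<open>H * zeta - zdrift\<close>
  remains.\<close>

definition gap :: "real \<Rightarrow> (real \<Rightarrow> real) \<Rightarrow> (real \<Rightarrow> real) \<Rightarrow> (real \<Rightarrow> real) \<Rightarrow> real \<Rightarrow> real" where
  "gap H y1 y2 R t = exp (H * t) * (zeta c1 c2 (y2 t) - zeta c1 c2 (y1 t)) - c1 * R t"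

lemma gap_lip:
  assumes sol: "is_sol c1 c2 a b u1 y1" "is_sol c1 c2 a b u2 y2" and R: "lip_on a b R"
  shows "lip_on a b (gap H y1 y2 R)"
  unfolding gap_def
  by (intro lip_on_diff lip_on_mult lip_on_exp lip_on_const R zeta_comp_lip[OF sol(1)] zeta_comp_lip[OF sol(2)])

lemma gap_deriv:
  assumes "(y1 has_real_derivative rhs c1 c2 (y1 t) v1) (at t)" "0 \<le> y1 t"
    "(y2 has_real_derivative rhs c1 c2 (y2 t) v2) (at t)" "0 \<le> y2 t"
    "(R has_real_derivative exp (H * t) * (v2 - v1)) (at t)"
  shows "(gap H y1 y2 R has_real_derivative exp (H * t) *
      ((H * zeta c1 c2 (y2 t) - zdrift c1 c2 (y2 t)) - (H * zeta c1 c2 (y1 t) - zdrift c1 c2 (y1 t)))) (at t)"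
  unfolding gap_def
  by (rule derivative_eq_intros refl zeta_comp_deriv[OF assms(1,2)] zeta_comp_deriv[OF assms(3,4)] assms(5))+
    (simp add: algebra_simps)

text \<open>It is \<open>gap\<close>, not the difference of the solutions, that is kept nonpositive;
  since \<open>R \<le> 0\<close>, this is more than the claim. The comparison is not a pointwise one
  of controls: \<open>u2\<close> may exceed \<open>u1\<close> as long as the weighted integral of
  the difference stays nonpositive.\<close>

lemma comparison_below:
  assumes sol: "is_sol c1 c2 a b u1 y1" "is_sol c1 c2 a b u2 y2"
    and ys: "0 \<le> ys" "\<And>t. t \<in> {a..b} \<Longrightarrow> y1 t \<le> ys" "\<And>t. t \<in> {a..b} \<Longrightarrow> y2 t \<le> ys"
    and R: "lip_on a b R" "0 \<le> R a" "\<And>t. t \<in> {a..b} \<Longrightarrow> R t \<le> 0"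
      "AE t in lebesgue. t \<in> {a<..<b} \<longrightarrow> (R has_real_derivative exp (zrate c1 c2 ys * t) * (u2 t - u1 t)) (at t)"
    and init: "y2 a \<le> y1 a" and t: "t \<in> {a..b}"
  shows "y2 t \<le> y1 t"
proof -
  let ?H = "zrate c1 c2 ys"
  note n1 = is_sol_nonneg[OF sol(1)] and n2 = is_sol_nonneg[OF sol(2)]
  have H: "?H \<ge> 0" using zrate_nonneg ys(1) by blast
  have "gap ?H y1 y2 R t \<le> 0"
  proof (rule lip_on_barrier[OF gap_lip[OF sol R(1)] _ t, where L = ?H])
    have "zeta c1 c2 (y2 a) \<le> zeta c1 c2 (y1 a)"
      using init t n1[of a] n2[of a] by (auto simp: zeta_le_iff)
    then have "exp (?H * a) * (zeta c1 c2 (y2 a) - zeta c1 c2 (y1 a)) \<le> 0"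
      by (simp add: mult_le_0_iff)
    moreover have "c1 * R a \<ge> 0" using R(2) c1 by simp
    ultimately show "gap ?H y1 y2 R a \<le> 0"
      unfolding gap_def by linarith
    show "AE t in lebesgue. t \<in> {a<..<b} \<longrightarrow> gap ?H y1 y2 R t > 0 \<longrightarrow>
        (\<exists>D. D \<le> ?H * (gap ?H y1 y2 R t - 0) \<and> (gap ?H y1 y2 R has_real_derivative D) (at t))"
      using is_sol_ae[OF sol(1)] is_sol_ae[OF sol(2)] R(4)
    proof eventually_elim
      case (elim t)
      show ?case
      proof (intro impI)
        assume t: "t \<in> {a<..<b}" and pos: "gap ?H y1 y2 R t > 0"
        then have tt: "t \<in> {a..b}" by auto
        let ?D = "exp (?H * t) * ((?H * zeta c1 c2 (y2 t) - zdrift c1 c2 (y2 t)) - (?H * zeta c1 c2 (y1 t) - zdrift c1 c2 (y1 t)))"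
        have d: "(gap ?H y1 y2 R has_real_derivative ?D) (at t)"
          using elim t n1[OF tt] n2[OF tt] by (intro gap_deriv) auto
        have "?D \<le> ?H * gap ?H y1 y2 R t"
        \<comment> \<open>In the expected order the potential, increasing below \<open>ys\<close>,
          makes \<open>gap\<close> decrease. In the wrong order the drift difference is simply
          dropped; what is left is at most \<open>?H * gap\<close>, since \<open>R \<le> 0\<close>,
          and the barrier tolerates this growth.\<close>
        proof (cases "y2 t \<le> y1 t")
          case True
          then have "?D \<le> 0"
            using zpot_mono[OF n2[OF tt] True ys(2)[OF tt]] by (simp add: mult_le_0_iff)
          then show ?thesis using H pos by (meson less_imp_le mult_nonneg_nonneg order_trans)
        next
          case False
          then have "zdrift c1 c2 (y1 t) \<le> zdrift c1 c2 (y2 t)"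
            using zdrift_mono n1[OF tt] by simp
          then have "?D \<le> exp (?H * t) * (?H * (zeta c1 c2 (y2 t) - zeta c1 c2 (y1 t)))"
            by (intro mult_left_mono) (auto simp: algebra_simps)
          also have "\<dots> = ?H * (gap ?H y1 y2 R t + c1 * R t)"
            unfolding gap_def by (simp add: algebra_simps)
          also have "\<dots> \<le> ?H * gap ?H y1 y2 R t"
            using R(3)[OF tt] c1 H by (intro mult_left_mono) (auto simp: mult_le_0_iff)
          finally show ?thesis .
        qed
        then show "\<exists>D. D \<le> ?H * (gap ?H y1 y2 R t - 0) \<and> (gap ?H y1 y2 R has_real_derivative D) (at t)"
          using d by auto
      qed
    qed
  qed
  then have "exp (?H * t) * (zeta c1 c2 (y2 t) - zeta c1 c2 (y1 t)) \<le> c1 * R t"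
    unfolding gap_def by simp
  also have "\<dots> \<le> 0" using R(3)[OF t] c1 by (simp add: mult_le_0_iff)
  finally have "zeta c1 c2 (y2 t) \<le> zeta c1 c2 (y1 t)" by (simp add: mult_le_0_iff)
  then show ?thesis using n1[OF t] n2[OF t] zeta_le_iff by simp
qed

text \<open>Above \<open>ys\<close> the potential decreases, so \<open>gap\<close> can only grow
  while \<open>y2\<close> is behind. Here \<open>R\<close> may be negative at the start, but it has
  recovered by time \<open>b\<close>, and this makes up for what the controls took away in
  between.\<close>

lemma comparison_above:
  assumes sol: "is_sol c1 c2 a b u1 y1" "is_sol c1 c2 a b u2 y2" and ab: "a \<le> b"
    and ys: "0 \<le> ys" "\<And>t. t \<in> {a..b} \<Longrightarrow> ys \<le> y1 t" "\<And>t. t \<in> {a..b} \<Longrightarrow> ys \<le> y2 t"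
    and R: "lip_on a b R" "0 \<le> R b" "\<And>t. t \<in> {a..b} \<Longrightarrow> R t \<le> 0"
      "AE t in lebesgue. t \<in> {a<..<b} \<longrightarrow> (R has_real_derivative exp (zrate c1 c2 ys * t) * (u2 t - u1 t)) (at t)"
    and init: "y2 a \<le> y1 a"
  shows "zeta c1 c2 (y2 a) - zeta c1 c2 (y1 a) \<le> zeta c1 c2 (y2 b) - zeta c1 c2 (y1 b)"
proof -
  let ?H = "zrate c1 c2 ys"
  let ?d = "\<lambda>t. zeta c1 c2 (y2 t) - zeta c1 c2 (y1 t)"
  note n1 = is_sol_nonneg[OF sol(1)] and n2 = is_sol_nonneg[OF sol(2)]
  have H: "?H \<ge> 0" using zrate_nonneg ys(1) by blast
  have da: "?d a \<le> 0" using init n1[of a] n2[of a] ab by (auto simp: zeta_le_iff)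
  have "continuous_on {a..b} (\<lambda>t. - ?d t)"
    by (intro lip_on_continuous lip_on_minus lip_on_diff zeta_comp_lip[OF sol(1)] zeta_comp_lip[OF sol(2)])
  \<comment> \<open>After \<open>s\<close> the lag exceeds its initial size, so \<open>y2\<close> is
    certainly behind \<open>y1\<close> there, which is the order that the potential estimate
    requires.\<close>
  then obtain s where s: "s \<in> {a..b}" "- ?d s \<le> - ?d a" "\<And>x. x \<in> {s<..b} \<Longrightarrow> - ?d x > - ?d a"
    using last_time_le[of a b "\<lambda>t. - ?d t" "- ?d a"] ab by auto
  have "- gap ?H y1 y2 R b \<le> - gap ?H y1 y2 R s"
  proof (rule lip_on_nonincreasing[where F = "\<lambda>t. - gap ?H y1 y2 R t"])
    show "s \<le> b" using s(1) by simp
    show "lip_on s b (\<lambda>t. - gap ?H y1 y2 R t)"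
      using lip_on_subset[OF gap_lip[OF sol R(1)]] s(1) by auto
    show "AE t in lebesgue. t \<in> {s<..<b} \<longrightarrow> (\<exists>D\<le>0. ((\<lambda>t. - gap ?H y1 y2 R t) has_real_derivative D) (at t))"
      using is_sol_ae[OF sol(1)] is_sol_ae[OF sol(2)] R(4)
    proof eventually_elim
      case (elim t)
      show ?case
      proof
        assume t: "t \<in> {s<..<b}"
        then have tt: "t \<in> {a..b}" using s(1) by auto
        have "?d t \<le> 0" using s(3)[of t] da t by auto
        then have le: "y2 t \<le> y1 t" using n1[OF tt] n2[OF tt] zeta_le_iff by simp
        let ?D = "exp (?H * t) * ((?H * zeta c1 c2 (y2 t) - zdrift c1 c2 (y2 t)) - (?H * zeta c1 c2 (y1 t) - zdrift c1 c2 (y1 t)))"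
        have "(gap ?H y1 y2 R has_real_derivative ?D) (at t)"
          using elim t s(1) n1[OF tt] n2[OF tt] by (intro gap_deriv) auto
        moreover have "?D \<ge> 0"
          using zpot_antimono[OF ys(1) ys(3)[OF tt] le] by simp
        ultimately show "\<exists>D\<le>0. ((\<lambda>t. - gap ?H y1 y2 R t) has_real_derivative D) (at t)"
          by (intro exI[of _ "- ?D"] conjI DERIV_minus) auto
      qed
    qed
  qed
  moreover have "c1 * R b \<ge> 0" "c1 * R s \<le> 0" using R(2,3) s(1) c1 by (auto simp: mult_le_0_iff)
  ultimately have le: "exp (?H * s) * ?d s \<le> exp (?H * b) * ?d b"
    unfolding gap_def by linarith
  show ?thesis
  \<comment> \<open>Comparing \<open>?d s\<close> with \<open>?d b\<close> means removing the
    factors \<open>exp (?H * s)\<close> and \<open>exp (?H * b)\<close>. For negative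
    \<open>?d s\<close> the larger factor at \<open>b\<close> works in favour of the claim;
    otherwise \<open>?d b\<close> is nonnegative while \<open>?d a\<close> is not positive.\<close>
  proof (cases "?d s \<ge> 0")
    case True
    then have "0 \<le> exp (?H * b) * ?d b" using le by (meson exp_ge_zero mult_nonneg_nonneg order_trans)
    then show ?thesis using da by (simp add: zero_le_mult_iff)
  next
    case False
    have "exp (?H * s) \<le> exp (?H * b)" using H s(1) by (auto intro: mult_left_mono)
    then have "exp (?H * b) * ?d s \<le> exp (?H * s) * ?d s" using False by (intro mult_right_mono_neg) auto
    then have "exp (?H * b) * ?d s \<le> exp (?H * b) * ?d b" using le by linarith
    then have "?d s \<le> ?d b" by simp
    then show ?thesis using s(2) by linarith
  qed
qed

end

section \<open>Exit time and exchange of controls\<close>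

locale riccati_exit = riccati +
  fixes ys w :: real
  assumes ys: "ys > 0" and wlo: "ys ^ 2 / (c1 * ys + c2) < w" and whi: "w < 1"
begin

lemma w_pos: "w > 0"
  using wlo ys c1 c2 by (smt (verit) divide_nonneg_pos mult_pos_pos zero_le_power2)

lemma rhs_ys_pos: "rhs c1 c2 ys w > 0"
proof -
  have "ys ^ 2 < w * (c1 * ys + c2)"
    using wlo ys c1 c2 by (simp add: divide_less_eq add_pos_pos)
  then show ?thesis by (simp add: rhs_def fun_a_def fun_b_def mult.commute)
qed

lemma rhs_mono: "0 \<le> y \<Longrightarrow> u \<le> v \<Longrightarrow> rhs c1 c2 y u \<le> rhs c1 c2 y v"
  using fun_b_pos[of y] by (simp add: rhs_def)

lemma rhs_pos_below:
  assumes "0 \<le> y" "y \<le> ys" "w \<le> u"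
  shows "rhs c1 c2 y u > 0"
proof -
  \<comment> \<open>Concavity made explicit: the right-hand side at \<open>y\<close> is its chord
    between \<open>0\<close> and \<open>ys\<close> plus the excess \<open>y * (ys - y)\<close>, all
    multiplied by \<open>ys\<close>. Both end values, \<open>c2 * w\<close> and
    \<open>rhs c1 c2 ys w\<close>, are positive.\<close>
  have "ys * rhs c1 c2 y w = (ys - y) * (c2 * w) + y * rhs c1 c2 ys w + ys * y * (ys - y)"
    by (simp add: rhs_def fun_a_def fun_b_def algebra_simps power2_eq_square)
  also have "\<dots> > 0"
  proof (cases "y = ys")
    case True
    then show ?thesis using rhs_ys_pos ys by simp
  next
    case False
    then show ?thesis
      using assms c2 w_pos rhs_ys_pos ys by (intro add_pos_nonneg mult_pos_pos mult_nonneg_nonneg) auto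
  qed
  finally have "rhs c1 c2 y w > 0" using ys by (simp add: zero_less_mult_iff)
  then show ?thesis using rhs_mono[of y w u] assms by linarith
qed

lemma sol_stays_above:
  assumes sol: "is_sol c1 c2 a b u y" and u: "AE t in lebesgue. t \<in> {a<..<b} \<longrightarrow> w \<le> u t"
    and ya: "ys \<le> y a" and t: "t \<in> {a..b}"
  shows "ys \<le> y t"
proof -
  have "- y t \<le> - ys"
  proof (rule lip_on_barrier[where F = "\<lambda>t. - y t" and a = a and b = b and L = 0])
    show "AE t in lebesgue. t \<in> {a<..<b} \<longrightarrow> - ys < - y t \<longrightarrow>
        (\<exists>D. D \<le> 0 * (- y t - - ys) \<and> ((\<lambda>t. - y t) has_real_derivative D) (at t))"
      using is_sol_ae[OF sol] u
    proof eventually_elim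
      case (elim t)
      then show ?case
        using is_sol_nonneg[OF sol, of t] rhs_pos_below[of "y t" "u t"]
        by (auto intro!: exI[of _ "- rhs c1 c2 (y t) (u t)"] DERIV_minus)
    qed
  qed (use is_sol_lip[OF sol] ya t in auto)
  then show ?thesis by simp
qed

text \<open>Strictness rules out lingering at the level \<open>ys\<close>: it makes the exit time
  unique and leaves only a null set on which the jump of \<open>fun_c\<close> is met. The solution
  is compared with that of \<open>z' = m - L * (z - ys)\<close> started at \<open>ys\<close>, which
  rises immediately.\<close>

lemma sol_above_strict:
  assumes sol: "is_sol c1 c2 a b u y" and u: "AE t in lebesgue. t \<in> {a<..<b} \<longrightarrow> w \<le> u t"
    and ya: "ys \<le> y a" and t: "t \<in> {a<..b}"
  shows "ys < y t"
proof -
  obtain B where B: "B \<ge> 0" "\<And>t. t \<in> {a..b} \<Longrightarrow> \<bar>y t\<bar> \<le> B"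
    using lip_on_bounded[OF is_sol_lip[OF sol]] by blast
  \<comment> \<open>Chosen so that the factor \<open>w * c1 - y s - ys\<close> below is at least
    \<open>- L\<close> when \<open>y s \<le> B\<close>; the summand 1 only makes \<open>L\<close>
    safely positive.\<close>
  define L where "L = ys + B + 1"
  define m where "m = rhs c1 c2 ys w"
  have m: "m > 0" unfolding m_def by (rule rhs_ys_pos)
  have L: "L > 0" unfolding L_def using B(1) ys by simp
  have at: "a \<le> t" "t \<le> b" using t by auto
  have solt: "is_sol c1 c2 a t u y" using is_sol_subset[OF sol] at by simp
  let ?G = "\<lambda>s. exp (L * s) * (ys + m / L - y s)"
  have "?G t \<le> ?G a"
  proof (rule lip_on_nonincreasing[where F = ?G, OF at(1)])
    show "lip_on a t ?G"
      by (intro lip_on_mult lip_on_exp lip_on_diff lip_on_const is_sol_lip[OF solt])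
    show "AE s in lebesgue. s \<in> {a<..<t} \<longrightarrow> (\<exists>D\<le>0. (?G has_real_derivative D) (at s))"
      using is_sol_ae[OF solt] u
    proof eventually_elim
      case (elim s)
      show ?case
      proof
        assume s: "s \<in> {a<..<t}"
        then have sab: "s \<in> {a..b}" using at by auto
        have yb: "ys \<le> y s" using sol_stays_above[OF sol u ya sab] .
        have yB: "y s \<le> B" using B(2)[OF sab] by auto
        have "rhs c1 c2 (y s) w - m = (y s - ys) * (w * c1 - y s - ys)"
          unfolding m_def by (simp add: rhs_def fun_a_def fun_b_def algebra_simps power2_eq_square)
        also have "\<dots> \<ge> (y s - ys) * (- L)"
          using yb yB mult_pos_pos[OF w_pos c1] unfolding L_def by (intro mult_left_mono) auto
        finally have "m - L * (y s - ys) \<le> rhs c1 c2 (y s) w" by (simp add: algebra_simps)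
        also have "\<dots> \<le> rhs c1 c2 (y s) (u s)"
          using rhs_mono[of "y s" w "u s"] elim s at yb ys by auto
        finally have le: "L * (ys - y s) + m - rhs c1 c2 (y s) (u s) \<le> 0" by (simp add: algebra_simps)
        have "(?G has_real_derivative exp (L * s) * (L * (ys - y s) + m - rhs c1 c2 (y s) (u s))) (at s)"
          using elim(1) s L by (auto intro!: derivative_eq_intros simp: algebra_simps)
        moreover have "exp (L * s) * (L * (ys - y s) + m - rhs c1 c2 (y s) (u s)) \<le> 0"
          using le by (simp add: mult_le_0_iff)
        ultimately show "\<exists>D\<le>0. (?G has_real_derivative D) (at s)" by blast
      qed
    qed
  qed
  also have "?G a \<le> exp (L * a) * (m / L)"
    using ya by (intro mult_left_mono) auto
  also have "\<dots> < exp (L * t) * (m / L)"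
    using t L m by (intro mult_strict_right_mono) auto
  finally have "exp (L * t) * (ys + m / L - y t) < exp (L * t) * (m / L)" .
  then have "ys + m / L - y t < m / L" by (simp only: mult_less_cancel_left_pos exp_gt_zero)
  then show ?thesis by simp
qed

lemma exit_time_exists:
  assumes sol: "is_sol c1 c2 a b u y" and u: "AE t in lebesgue. t \<in> {a<..<b} \<longrightarrow> w \<le> u t"
    and ab: "a \<le> b" and ya: "y a \<le> ys" and yb: "ys \<le> y b"
  obtains \<tau> where "\<tau> \<in> {a..b}" "y \<tau> = ys" "\<And>t. t \<in> {a..<\<tau>} \<Longrightarrow> y t < ys" "\<And>t. t \<in> {\<tau><..b} \<Longrightarrow> ys < y t"
proof -
  obtain \<tau> where \<tau>: "a \<le> \<tau>" "\<tau> \<le> b" "y \<tau> = ys"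
    using IVT'[OF ya yb ab lip_on_continuous[OF is_sol_lip[OF sol]]] by blast
  have strict: "ys < y t" if "s \<in> {a..b}" "ys \<le> y s" "t \<in> {s<..b}" for s t
  proof (rule sol_above_strict[of s b u y])
    show "is_sol c1 c2 s b u y" using is_sol_subset[OF sol] that by simp
    show "AE t in lebesgue. t \<in> {s<..<b} \<longrightarrow> w \<le> u t"
      using u by eventually_elim (use that in auto)
  qed (use that in auto)
  show ?thesis
  proof (rule that[of \<tau>])
    fix t assume t: "t \<in> {a..<\<tau>}"
    then show "y t < ys" using strict[of t \<tau>] \<tau> by force
  next
    fix t assume "t \<in> {\<tau><..b}"
    then show "ys < y t" using strict[of \<tau> t] \<tau> by auto
  qed (use \<tau> in auto)
qed

lemma growth_above:
  assumes sol: "is_sol c1 c2 a b u y" and u: "AE t in lebesgue. t \<in> {a<..<b} \<longrightarrow> u t \<le> 1"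
    and ab: "a \<le> b" and above: "\<And>t. t \<in> {a..b} \<Longrightarrow> ys \<le> y t"
    and \<kappa>: "(fun_a ys + fun_b c1 c2 ys) / ys \<le> \<kappa>"
  shows "y b \<le> y a * exp (\<kappa> * (b - a))"
proof -
  let ?G = "\<lambda>t. exp ((- \<kappa>) * t) * y t"
  have "?G b \<le> ?G a"
  proof (rule lip_on_nonincreasing[where F = ?G, OF ab])
    show "lip_on a b ?G"
      by (intro lip_on_mult lip_on_exp is_sol_lip[OF sol])
    show "AE t in lebesgue. t \<in> {a<..<b} \<longrightarrow> (\<exists>D\<le>0. (?G has_real_derivative D) (at t))"
      using is_sol_ae[OF sol] u
    proof eventually_elim
      case (elim t)
      show ?case
      proof
        assume t: "t \<in> {a<..<b}"
        have yt: "ys \<le> y t" using above[of t] t by auto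
        have "rhs c1 c2 (y t) (u t) \<le> rhs c1 c2 (y t) 1"
          using rhs_mono elim(2) t yt ys by auto
        also have "\<dots> \<le> (fun_a ys + fun_b c1 c2 ys) / ys * y t"
        proof -
          \<comment> \<open>The quotient \<open>rhs c1 c2 y 1 / y = - y + c1 + c2 / y\<close>
            decreases in \<open>y\<close>; cleared of denominators, its comparison with the value at
            \<open>ys\<close> is this product.\<close>
          have "0 \<le> (y t - ys) * (c2 + ys * y t)" using yt ys c2 by (intro mult_nonneg_nonneg) auto
          then show ?thesis using ys
            by (simp add: rhs_def fun_a_def fun_b_def field_simps power2_eq_square)
        qed
        also have "\<dots> \<le> \<kappa> * y t" using \<kappa> yt ys by (intro mult_right_mono) auto
        finally have le: "rhs c1 c2 (y t) (u t) - \<kappa> * y t \<le> 0" by simp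
        have "(?G has_real_derivative exp ((- \<kappa>) * t) * (rhs c1 c2 (y t) (u t) - \<kappa> * y t)) (at t)"
          using elim(1) t by (auto intro!: derivative_eq_intros simp: algebra_simps)
        moreover have "exp ((- \<kappa>) * t) * (rhs c1 c2 (y t) (u t) - \<kappa> * y t) \<le> 0"
          using le by (simp add: mult_le_0_iff)
        ultimately show "\<exists>D\<le>0. (?G has_real_derivative D) (at t)" by blast
      qed
    qed
  qed
  then have "exp (\<kappa> * b) * ?G b \<le> exp (\<kappa> * b) * ?G a" by (intro mult_left_mono) auto
  moreover have "exp (\<kappa> * b) * ?G b = y b"
    by (simp add: mult.assoc[symmetric] exp_add[symmetric])
  moreover have "exp (\<kappa> * b) * ?G a = y a * exp (\<kappa> * (b - a))"
    unfolding mult.assoc[symmetric] exp_add[symmetric] by (simp add: algebra_simps)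
  ultimately show ?thesis by linarith
qed

text \<open>Here \<open>u1\<close> is an arbitrary control and \<open>u2\<close> its rearrangement.
  Each side of the conclusion is the final position times the growth collected before the exit. The
  sign of \<open>R\<close> from \<open>a\<close> onwards is used before the exits, its return to 0
  at \<open>b\<close> after them.\<close>

lemma exchange:
  assumes sol: "is_sol c1 c2 a b u1 y1" "is_sol c1 c2 a b u2 y2"
    and u1: "AE t in lebesgue. t \<in> {a<..<b} \<longrightarrow> w \<le> u1 t \<and> u1 t \<le> 1"
    and u2: "AE t in lebesgue. t \<in> {a<..<b} \<longrightarrow> w \<le> u2 t \<and> u2 t \<le> 1"
    and ab: "a \<le> b" and init: "y2 a = y1 a"
    and R: "lip_on a b R" "R a = 0" "R b = 0" "\<And>t. t \<in> {a..b} \<Longrightarrow> R t \<le> 0"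
      "AE t in lebesgue. t \<in> {a<..<b} \<longrightarrow> (R has_real_derivative exp (zrate c1 c2 ys * t) * (u2 t - u1 t)) (at t)"
    and \<tau>1: "\<tau>1 \<in> {a..b}" "y1 \<tau>1 = ys" "\<And>t. t \<in> {a..<\<tau>1} \<Longrightarrow> y1 t < ys" "\<And>t. t \<in> {\<tau>1<..b} \<Longrightarrow> ys < y1 t"
    and \<tau>2: "\<tau>2 \<in> {a..b}" "y2 \<tau>2 = ys" "\<And>t. t \<in> {a..<\<tau>2} \<Longrightarrow> y2 t < ys" "\<And>t. t \<in> {\<tau>2<..b} \<Longrightarrow> ys < y2 t"
    and cs: "(fun_a ys + fun_b c1 c2 ys) / ys \<le> cs"
  shows "y1 b * exp (cs * (\<tau>1 - a)) \<le> y2 b * exp (cs * (\<tau>2 - a))"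
proof -
  have ys0: "0 \<le> ys" using ys by simp
  have below1: "y1 t \<le> ys" if "t \<in> {a..\<tau>1}" for t using \<tau>1(2) \<tau>1(3)[of t] that by (cases "t = \<tau>1") auto
  have below2: "y2 t \<le> ys" if "t \<in> {a..\<tau>2}" for t using \<tau>2(2) \<tau>2(3)[of t] that by (cases "t = \<tau>2") auto
  have above1: "ys \<le> y1 t" if "t \<in> {\<tau>1..b}" for t using \<tau>1(2) \<tau>1(4)[of t] that by (cases "t = \<tau>1") auto
  have above2: "ys \<le> y2 t" if "t \<in> {\<tau>2..b}" for t using \<tau>2(2) \<tau>2(4)[of t] that by (cases "t = \<tau>2") auto
  have le: "\<tau>1 \<le> \<tau>2"
  proof (rule ccontr)
    \<comment> \<open>Up to \<open>\<tau>2\<close> both solutions would then stay below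
      \<open>ys\<close>, so that \<open>comparison_below\<close> puts \<open>y1\<close> at
      \<open>ys\<close> or higher at \<open>\<tau>2\<close>, before its own exit.\<close>
    assume "\<not> \<tau>1 \<le> \<tau>2"
    then have lt: "\<tau>2 < \<tau>1" by simp
    have "y2 \<tau>2 \<le> y1 \<tau>2"
    proof (rule comparison_below[of a \<tau>2 u1 y1 u2 y2 ys R])
      show "is_sol c1 c2 a \<tau>2 u1 y1" "is_sol c1 c2 a \<tau>2 u2 y2"
        using is_sol_subset[OF sol(1)] is_sol_subset[OF sol(2)] \<tau>2 by auto
      show "lip_on a \<tau>2 R" using lip_on_subset[OF R(1)] \<tau>2(1) by auto
      show "AE t in lebesgue. t \<in> {a<..<\<tau>2} \<longrightarrow> (R has_real_derivative exp (zrate c1 c2 ys * t) * (u2 t - u1 t)) (at t)"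
        using R(5) by eventually_elim (use \<tau>2(1) in auto)
    qed (use ys0 below1 below2 lt R \<tau>2(1) init in auto)
    then show False using \<tau>1(3)[of \<tau>2] lt \<tau>2 by auto
  qed
  have sols: "is_sol c1 c2 \<tau>2 b u1 y1" "is_sol c1 c2 \<tau>2 b u2 y2" "is_sol c1 c2 \<tau>1 \<tau>2 u1 y1"
    using is_sol_subset[OF sol(1)] is_sol_subset[OF sol(2)] \<tau>2 \<tau>1 by auto
  have "zeta c1 c2 (y2 \<tau>2) - zeta c1 c2 (y1 \<tau>2) \<le> zeta c1 c2 (y2 b) - zeta c1 c2 (y1 b)"
  proof (rule comparison_above[of \<tau>2 b u1 y1 u2 y2 ys R, OF sols(1,2)])
    show "lip_on \<tau>2 b R" using lip_on_subset[OF R(1)] \<tau>2(1) by auto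
    show "AE t in lebesgue. t \<in> {\<tau>2<..<b} \<longrightarrow> (R has_real_derivative exp (zrate c1 c2 ys * t) * (u2 t - u1 t)) (at t)"
      using R(5) by eventually_elim (use \<tau>2(1) in auto)
  qed (use ys0 above1 above2 le R \<tau>2 in auto)
  \<comment> \<open>As \<open>y2 \<tau>2 = ys\<close>, the bound on the lag between
    \<open>\<tau>2\<close> and \<open>b\<close> becomes a product inequality.\<close>
  then have z: "ln (fun_b c1 c2 (y1 b) * fun_b c1 c2 ys) \<le> ln (fun_b c1 c2 (y2 b) * fun_b c1 c2 (y1 \<tau>2))"
    using fun_b_pos is_sol_nonneg[OF sol(1)] is_sol_nonneg[OF sol(2)] ab \<tau>2 ys
    by (simp add: zeta_def ln_mult_pos)
  have nn: "0 \<le> y1 b" "ys \<le> y2 b" "ys \<le> y1 \<tau>2" "ys \<le> y1 b"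
    using is_sol_nonneg[OF sol(1)] above1 above2 ab le \<tau>1 \<tau>2 by auto
  have z2: "(c1 * y1 b + c2) * (c1 * ys + c2) \<le> (c1 * y2 b + c2) * (c1 * y1 \<tau>2 + c2)"
    using z nn ys c1 c2 by (subst (asm) ln_le_cancel_iff) (auto simp: fun_b_def add_pos_pos add_nonneg_pos mult_pos_pos)
  \<comment> \<open>Removing \<open>c1\<close> and \<open>c2\<close>: if
    \<open>y2 b * y1 \<tau>2\<close> were smaller than \<open>y1 b * ys\<close>, then, both factors
    being at least \<open>ys\<close>, also the sum \<open>y2 b + y1 \<tau>2\<close> would be smaller
    than \<open>y1 b + ys\<close>. Every term in the expansion of \<open>z2\<close> would then point
    the wrong way.\<close>
  have key: "y1 b * ys \<le> y2 b * y1 \<tau>2"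
  proof (rule ccontr)
    assume "\<not> y1 b * ys \<le> y2 b * y1 \<tau>2"
    then have lt: "y2 b * y1 \<tau>2 < y1 b * ys" by simp
    have "(y2 b - ys) * (y1 \<tau>2 - ys) \<ge> 0" using nn by simp
    then have "ys * (y2 b + y1 \<tau>2) \<le> y2 b * y1 \<tau>2 + ys * ys" by (simp add: algebra_simps)
    also have "\<dots> < ys * (y1 b + ys)" using lt by (simp add: algebra_simps)
    finally have "y2 b + y1 \<tau>2 < y1 b + ys" using ys by (simp add: mult_less_cancel_left)
    then have "c1 * c2 * (y2 b + y1 \<tau>2) < c1 * c2 * (y1 b + ys)" using c1 c2 by simp
    moreover have "c1 * c1 * (y2 b * y1 \<tau>2) < c1 * c1 * (y1 b * ys)" using lt c1 by simp
    ultimately show False using z2 by (simp add: algebra_simps)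
  qed
  have "y1 \<tau>2 \<le> y1 \<tau>1 * exp (cs * (\<tau>2 - \<tau>1))"
  proof (rule growth_above[OF sols(3) _ le _ cs])
    show "AE t in lebesgue. t \<in> {\<tau>1<..<\<tau>2} \<longrightarrow> u1 t \<le> 1"
      using u1 by eventually_elim (use \<tau>1 \<tau>2 in auto)
  qed (use above1 \<tau>2 in auto)
  then have "y2 b * y1 \<tau>2 \<le> y2 b * (ys * exp (cs * (\<tau>2 - \<tau>1)))"
    using \<tau>1(2) nn ys by (intro mult_left_mono) auto
  with key have "y1 b * ys \<le> (y2 b * exp (cs * (\<tau>2 - \<tau>1))) * ys" by (simp add: algebra_simps)
  then have "y1 b \<le> y2 b * exp (cs * (\<tau>2 - \<tau>1))" using ys by simp
  then have "y1 b * exp (cs * (\<tau>1 - a)) \<le> (y2 b * exp (cs * (\<tau>2 - \<tau>1))) * exp (cs * (\<tau>1 - a))"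
    by (intro mult_right_mono) auto
  also have "\<dots> = y2 b * exp (cs * (\<tau>2 - a))"
    by (simp add: mult.assoc exp_add[symmetric] algebra_simps)
  finally show "y1 b * exp (cs * (\<tau>1 - a)) \<le> y2 b * exp (cs * (\<tau>2 - a))" .
qed

end

section \<open>Existence and uniqueness of characteristics\<close>

lemma indefinite_integral_deriv:
  fixes g :: "real \<Rightarrow> real"
  assumes g: "g integrable_on {a..b}"
  shows "AE x in lebesgue. x \<in> {a<..<b} \<longrightarrow> ((\<lambda>t. integral {a..t} g) has_real_derivative g x) (at x)"
proof -
  define h where "h x = (if x \<in> {a..b} then g x else 0)" for x
  have "h integrable_on UNIV"
    unfolding h_def using g by (subst integrable_restrict_UNIV)
  then have "h integrable_on {p..q}" for p q
    using integrable_on_subinterval by blast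
  then have "AE x in lebesgue. \<forall>a<x. ((\<lambda>t. integral {a..t} h) has_real_derivative h x) (at x)"
    by (rule lebesgue_differentiation)
  then show ?thesis
  proof eventually_elim
    case (elim x)
    show ?case
    proof
      assume x: "x \<in> {a<..<b}"
      then have "((\<lambda>t. integral {a..t} h) has_real_derivative g x) (at x)"
        using elim by (auto simp: h_def)
      then show "((\<lambda>t. integral {a..t} g) has_real_derivative g x) (at x)"
      proof (rule has_field_derivative_transform_within_open[OF _ open_greaterThanLessThan x])
        fix t assume "t \<in> {a<..<b}"
        then show "integral {a..t} h = integral {a..t} g"
          by (intro integral_cong) (auto simp: h_def)
      qed
    qed
  qed
qed

lemma indefinite_integral_lip:
  fixes g :: "real \<Rightarrow> real"
  assumes g: "g integrable_on {a..b}" and B: "\<And>x. x \<in> {a..b} \<Longrightarrow> \<bar>g x\<bar> \<le> B" "B \<ge> 0"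
  shows "lip_on a b (\<lambda>t. integral {a..t} g)"
  unfolding lip_on_def
proof (rule exI, rule lipschitz_on_leI[OF _ B(2)])
  fix x y assume xy: "x \<in> {a..b}" "y \<in> {a..b}" "x \<le> y"
  have gy: "g integrable_on {a..y}" "g integrable_on {x..y}"
    using integrable_on_subinterval[OF g] xy by auto
  have "integral {a..x} g + integral {x..y} g = integral {a..y} g"
    using xy by (intro Henstock_Kurzweil_Integration.integral_combine gy(1)) auto
  then have "dist (integral {a..x} g) (integral {a..y} g) = norm (integral {x..y} g)"
    by (simp add: dist_real_def)
  also have "\<dots> \<le> integral {x..y} (\<lambda>_. B)"
    using xy B(1) by (intro integral_norm_bound_integral gy(2)) auto
  also have "\<dots> = B * dist x y" using xy by (simp add: dist_real_def mult.commute)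
  finally show "dist (integral {a..x} g) (integral {a..y} g) \<le> B * dist x y" .
qed

lemma measurable_bounded_integrable:
  fixes g :: "real \<Rightarrow> real"
  assumes g: "g \<in> borel_measurable (lebesgue_on {a<..<b})" and B: "\<And>x. x \<in> {a<..<b} \<Longrightarrow> \<bar>g x\<bar> \<le> B"
  shows "g integrable_on {a..b}"
proof -
  have "finite_measure (lebesgue_on {a<..<b})"
    by (rule finite_measure_lebesgue_on) (simp add: lmeasurable_interval)
  then have "integrable (lebesgue_on {a<..<b}) g"
    by (rule finite_measure.integrable_const_bound[where B = B]) (use g B in auto)
  then have "g integrable_on {a<..<b}"
    by (intro integrable_on_lebesgue_on) auto
  then show ?thesis by (simp add: integrable_on_Icc_iff_Ioo)
qed

text \<open>The integral form is needed because a control makes \<open>f\<close> merely measurable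
  in time; the assumption \<open>int\<close> packages the measurability that the iteration uses. The
  Lipschitz bound is global in \<open>x\<close>, so the whole interval is covered without gluing
  local solutions.\<close>

lemma picard_lindelof_integral:
  fixes f :: "real \<Rightarrow> real \<Rightarrow> real"
  assumes ab: "a \<le> b" and L: "L > 0" "\<And>s x y. \<bar>f s x - f s y\<bar> \<le> L * \<bar>x - y\<bar>"
    and int: "\<And>X. continuous_on {a..b} X \<Longrightarrow> (\<lambda>s. f s (X s)) integrable_on {a..b}"
  obtains X where "continuous_on {a..b} X"
    "\<And>t. t \<in> {a..b} \<Longrightarrow> X t = x0 + integral {a..t} (\<lambda>s. f s (X s))"
proof -
  define T where "T X t = x0 + integral {a..t} (\<lambda>s. f s (X s))" for X t
  have contT: "continuous_on {a..b} (T X)" if "continuous_on {a..b} X" for X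
    unfolding T_def by (intro continuous_intros indefinite_integral_continuous_1 int that)
  define Y where "Y n = (T ^^ n) (\<lambda>_. x0)" for n
  have YS: "Y (Suc n) = T (Y n)" for n unfolding Y_def by simp
  have contY: "continuous_on {a..b} (Y n)" for n
    by (induction n) (auto simp: YS contT, simp add: Y_def)
  have Tdiff: "\<bar>T X t - T Z t\<bar> \<le> integral {a..t} h"
    if "continuous_on {a..b} X" "continuous_on {a..b} Z" "t \<in> {a..b}" "h integrable_on {a..t}"
      "\<And>s. s \<in> {a..t} \<Longrightarrow> L * \<bar>X s - Z s\<bar> \<le> h s" for X Z t h
  proof -
    have i: "(\<lambda>s. f s (X s)) integrable_on {a..t}" "(\<lambda>s. f s (Z s)) integrable_on {a..t}"
      using integrable_on_subinterval[OF int[OF that(1)]] integrable_on_subinterval[OF int[OF that(2)]] that(3) by auto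
    have "T X t - T Z t = integral {a..t} (\<lambda>s. f s (X s) - f s (Z s))"
      unfolding T_def using Henstock_Kurzweil_Integration.integral_diff[OF i] by simp
    also have "norm \<dots> \<le> integral {a..t} h"
    proof (intro integral_norm_bound_integral integrable_diff i that(4))
      fix s assume "s \<in> {a..t}"
      then show "norm (f s (X s) - f s (Z s)) \<le> h s"
        using that(5)[of s] L(2)[of s "X s" "Z s"] by simp
    qed
    finally show ?thesis by simp
  qed
  have "bounded ((\<lambda>t. Y 1 t - Y 0 t) ` {a..b})"
    by (intro compact_imp_bounded compact_continuous_image continuous_intros contY compact_Icc)
  then obtain C where "\<forall>t\<in>{a..b}. \<bar>Y 1 t - Y 0 t\<bar> \<le> C"
    unfolding bounded_iff by auto
  then have C: "\<And>t. t \<in> {a..b} \<Longrightarrow> \<bar>Y 1 t - Y 0 t\<bar> \<le> C" by blast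
  have C0: "C \<ge> 0" using C[of a] ab by force
  let ?e = "\<lambda>t. exp (2 * L * (t - a))"
  \<comment> \<open>Weighted by this exponential, the iteration contracts by \<open>1 / 2\<close>.\<close>
  have step: "\<bar>Y (Suc n) t - Y n t\<bar> \<le> C / 2 ^ n * ?e t" if "t \<in> {a..b}" for n t
    using that
  proof (induction n arbitrary: t)
    case 0
    have "C * 1 \<le> C * ?e t" using C0 L(1) 0 by (intro mult_left_mono) auto
    then show ?case using C[OF 0] by simp
  next
    case (Suc n)
    define D where "D = C / 2 ^ n"
    have D0: "D \<ge> 0" unfolding D_def using C0 by simp
    have hi: "((\<lambda>s. L * (D * ?e s)) has_integral (D / 2 * ?e t - D / 2 * ?e a)) {a..t}"
    proof (rule fundamental_theorem_of_calculus)
      fix s assume "s \<in> {a..t}"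
      show "((\<lambda>s. D / 2 * ?e s) has_vector_derivative L * (D * ?e s)) (at s within {a..t})"
        unfolding has_real_derivative_iff_has_vector_derivative[symmetric]
        by (auto intro!: derivative_eq_intros)
    qed (use Suc in auto)
    have "\<bar>T (Y (Suc n)) t - T (Y n) t\<bar> \<le> integral {a..t} (\<lambda>s. L * (D * ?e s))"
    proof (rule Tdiff[OF contY contY Suc.prems has_integral_integrable[OF hi]])
      fix s assume "s \<in> {a..t}"
      then have "\<bar>Y (Suc n) s - Y n s\<bar> \<le> D * ?e s"
        using Suc.IH[of s] Suc.prems unfolding D_def by auto
      then show "L * \<bar>Y (Suc n) s - Y n s\<bar> \<le> L * (D * ?e s)"
        using L(1) by (intro mult_left_mono) auto
    qed
    also have "\<dots> = D / 2 * ?e t - D / 2" using integral_unique[OF hi] by simp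
    also have "\<dots> \<le> D / 2 * ?e t" using D0 by simp
    finally show ?case unfolding YS[of "Suc n"] YS[of n, symmetric] D_def
      by (simp add: YS mult.commute)
  qed
  have bound: "norm (Y (Suc n) t - Y n t) \<le> C * ?e b * (1 / 2) ^ n" if "t \<in> {a..b}" for n t
  proof -
    have "\<bar>Y (Suc n) t - Y n t\<bar> \<le> C / 2 ^ n * ?e t" using step that .
    also have "\<dots> \<le> C / 2 ^ n * ?e b"
      using C0 L(1) that by (intro mult_left_mono) auto
    finally show ?thesis by (simp add: power_one_over divide_simps)
  qed
  have "uniform_limit {a..b} (\<lambda>n t. \<Sum>k<n. Y (Suc k) t - Y k t) (\<lambda>t. \<Sum>k. Y (Suc k) t - Y k t) sequentially"
    using bound by (intro Weierstrass_m_test[where M = "\<lambda>n. C * ?e b * (1 / 2) ^ n"]) (auto intro!: summable_mult summable_geometric)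
  then have "uniform_limit {a..b} (\<lambda>n t. x0 + (\<Sum>k<n. Y (Suc k) t - Y k t)) (\<lambda>t. x0 + (\<Sum>k. Y (Suc k) t - Y k t)) sequentially"
    by (intro uniform_limit_intros)
  moreover have "x0 + (\<Sum>k<n. Y (Suc k) t - Y k t) = Y n t" for n t
    by (subst sum_lessThan_telescope) (simp add: Y_def)
  ultimately obtain X where X: "uniform_limit {a..b} Y X sequentially"
    by (auto simp: fun_eq_iff)
  have contX: "continuous_on {a..b} X"
    by (rule uniform_limit_theorem[OF _ X]) (auto simp: contY)
  have "X t = T X t" if t: "t \<in> {a..b}" for t
  proof (rule LIMSEQ_unique)
    show "(\<lambda>n. Y (Suc n) t) \<longlonglongrightarrow> X t"
      using tendsto_uniform_limitI[OF X t] by (rule LIMSEQ_Suc)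
    have "\<bar>Y (Suc n) t - T X t\<bar> \<le> L * (b - a) * e"
      if e: "\<And>s. s \<in> {a..b} \<Longrightarrow> \<bar>Y n s - X s\<bar> \<le> e" for n e
    proof -
      have e0: "e \<ge> 0" using e[OF t] by linarith
      have "\<bar>T (Y n) t - T X t\<bar> \<le> integral {a..t} (\<lambda>_. L * e)"
        using e t L(1) by (intro Tdiff contY contX) auto
      also have "\<dots> = L * e * (t - a)" using t by simp
      also have "\<dots> \<le> L * e * (b - a)" using t L(1) e0 by (intro mult_left_mono) auto
      finally show ?thesis unfolding YS by (simp add: algebra_simps)
    qed
    note close = this
    show "(\<lambda>n. Y (Suc n) t) \<longlonglongrightarrow> T X t"
    proof (rule metric_LIMSEQ_I)
      fix r :: real assume r: "r > 0"
      define e where "e = r / (L * (b - a) + 1)"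
      have p: "L * (b - a) + 1 > 0" using L(1) ab by (simp add: add_nonneg_pos)
      then have e: "e > 0" unfolding e_def using r by simp
      obtain N where N: "\<And>n s. n \<ge> N \<Longrightarrow> s \<in> {a..b} \<Longrightarrow> dist (Y n s) (X s) < e"
        using uniform_limitD[OF X e] unfolding eventually_sequentially by blast
      have "dist (Y (Suc n) t) (T X t) < r" if n: "n \<ge> N" for n
      proof -
        have "\<bar>Y (Suc n) t - T X t\<bar> \<le> L * (b - a) * e"
          using N[OF n] by (intro close) (force simp: dist_real_def)
        also have "\<dots> < (L * (b - a) + 1) * e" using e by simp
        also have "\<dots> = r" unfolding e_def using p by simp
        finally show ?thesis by (simp add: dist_real_def)
      qed
      then show "\<exists>no. \<forall>n\<ge>no. dist (Y (Suc n) t) (T X t) < r" by blast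
    qed
  qed
  then show ?thesis using that contX unfolding T_def by blast
qed

lemma abs_continuous_on_interval_continuous:
  assumes "abs_continuous_on_interval a b F"
  shows "continuous_on {a..b} F"
  unfolding continuous_on_iff
proof (intro ballI allI impI)
  fix x e :: real assume x: "x \<in> {a..b}" and e: "e > 0"
  obtain d where d: "d > 0" and D: "\<And>p. p division_of \<Union>p \<Longrightarrow> \<Union>p \<subseteq> {a..b} \<Longrightarrow>
        (\<Sum>k\<in>p. Sup k - Inf k) < d \<Longrightarrow> (\<Sum>k\<in>p. \<bar>F (Sup k) - F (Inf k)\<bar>) < e"
    using assms[unfolded abs_continuous_on_interval_def, rule_format, OF e] by blast
  have close: "\<bar>F v - F u\<bar> < e" if "u \<in> {a..b}" "v \<in> {a..b}" "u \<le> v" "v - u < d" for u v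
    using D[of "{{u..v}}"] division_of_self[of u v] that by auto
  show "\<exists>d>0. \<forall>x'\<in>{a..b}. dist x' x < d \<longrightarrow> dist (F x') (F x) < e"
  proof (intro exI[of _ d] conjI ballI impI)
    fix x' assume x': "x' \<in> {a..b}" "dist x' x < d"
    show "dist (F x') (F x) < e"
      using close[OF x x'(1)] close[OF x'(1) x] x'(2) by (cases "x \<le> x'") (auto simp: dist_real_def abs_minus_commute)
  qed (use d in auto)
qed

lemma is_sol_cong:
  assumes "is_sol c1 c2 a b u y" "\<And>t. t \<in> {a..b} \<Longrightarrow> y t = z t"
  shows "is_sol c1 c2 a b u z"
proof -
  have "AE t in lebesgue. t \<in> {a<..<b} \<longrightarrow> (z has_real_derivative rhs c1 c2 (z t) (u t)) (at t)"
    using is_sol_ae[OF assms(1)]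
  proof eventually_elim
    case (elim t)
    show ?case
    proof
      assume t: "t \<in> {a<..<b}"
      then have "(y has_real_derivative rhs c1 c2 (z t) (u t)) (at t)" using elim assms(2)[of t] by auto
      then show "(z has_real_derivative rhs c1 c2 (z t) (u t)) (at t)"
        by (rule has_field_derivative_transform_within_open[OF _ open_greaterThanLessThan t])
          (use assms(2) in auto)
    qed
  qed
  moreover have "lip_on a b z" using lip_on_cong[OF is_sol_lip[OF assms(1)]] assms(2) by blast
  ultimately show ?thesis using assms unfolding is_sol_def by auto
qed

section \<open>Well-posedness of the characteristic equation\<close>

context riccati
begin

lemma ybar_props: "ybar c1 c2 > 0" "rhs c1 c2 (ybar c1 c2) 1 = 0"
proof -
  define s where "s = sqrt (c1 ^ 2 + 4 * c2)"
  have s: "s ^ 2 = c1 ^ 2 + 4 * c2" "s \<ge> 0" unfolding s_def using c1 c2 by auto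
  show "ybar c1 c2 > 0" using c1 s(2) unfolding ybar_def s_def[symmetric] by simp
  show "rhs c1 c2 (ybar c1 c2) 1 = 0"
    using s(1) unfolding ybar_def s_def[symmetric] rhs_def fun_a_def fun_b_def
    by (simp add: power2_eq_square field_simps)
qed

lemma rhs_lipschitz:
  assumes "\<bar>x\<bar> \<le> B" "\<bar>y\<bar> \<le> B" "\<bar>v\<bar> \<le> 1"
  shows "\<bar>rhs c1 c2 x v - rhs c1 c2 y v\<bar> \<le> (2 * B + c1) * \<bar>x - y\<bar>"
proof -
  have "rhs c1 c2 x v - rhs c1 c2 y v = (- (x + y) + c1 * v) * (x - y)"
    by (simp add: rhs_def fun_a_def fun_b_def algebra_simps power2_eq_square)
  moreover have "\<bar>c1 * v\<bar> \<le> c1" using assms(3) c1 by (simp add: abs_mult mult_left_le)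
  then have "\<bar>- (x + y) + c1 * v\<bar> \<le> 2 * B + c1" using assms by linarith
  ultimately show ?thesis by (simp add: abs_mult mult_right_mono)
qed

lemma rhs_bound:
  assumes "\<bar>x\<bar> \<le> B" "\<bar>v\<bar> \<le> 1"
  shows "\<bar>rhs c1 c2 x v\<bar> \<le> (2 * B + c1) * B + c2"
proof -
  have B: "B \<ge> 0" using assms by linarith
  have "\<bar>rhs c1 c2 x v - rhs c1 c2 0 v\<bar> \<le> (2 * B + c1) * \<bar>x - 0\<bar>"
    using assms B by (intro rhs_lipschitz) auto
  also have "\<dots> \<le> (2 * B + c1) * B" using assms B c1 by (intro mult_left_mono) auto
  finally have "\<bar>rhs c1 c2 x v - rhs c1 c2 0 v\<bar> \<le> (2 * B + c1) * B" .
  moreover have "\<bar>rhs c1 c2 0 v\<bar> \<le> c2" using assms(2) c2 by (simp add: rhs_def fun_a_def fun_b_def abs_mult mult_left_le)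
  ultimately show ?thesis by linarith
qed

lemma sol_exists:
  assumes ab: "a \<le> b" and u: "u \<in> borel_measurable (lebesgue_on {a<..<b})" "\<And>t. t \<in> {a<..<b} \<Longrightarrow> 0 \<le> u t \<and> u t \<le> 1"
    and y0: "y0 \<in> {0..ybar c1 c2}"
  obtains y where "is_sol c1 c2 a b u y" "y a = y0" "\<And>t. t \<in> {a..b} \<Longrightarrow> y t \<le> ybar c1 c2"
proof -
  define B where "B = ybar c1 c2"
  have B: "B > 0" "rhs c1 c2 B 1 = 0" using ybar_props unfolding B_def by auto
  \<comment> \<open>The right-hand side is quadratic, hence Lipschitz only on bounded sets. It is
    made global by projecting onto the interval from 0 to \<open>B\<close>; the barriers
    \<open>nonneg\<close> and \<open>upper\<close> show afterwards that the projection never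
    acts.\<close>
  define clip where "clip x = max 0 (min B x)" for x
  have clip: "\<bar>clip x\<bar> \<le> B" "0 \<le> clip x" for x using B(1) by (auto simp: clip_def)
  have clip_lip: "\<bar>clip x - clip y\<bar> \<le> \<bar>x - y\<bar>" for x y by (auto simp: clip_def)
  \<comment> \<open>Control values outside the open interval are arbitrary; setting them to 0 makes
    the bounds on \<open>f\<close> hold at all times.\<close>
  define v where "v t = (if t \<in> {a<..<b} then u t else 0)" for t
  have v: "0 \<le> v t" "v t \<le> 1" "\<bar>v t\<bar> \<le> 1" for t using u(2)[of t] by (auto simp: v_def)
  have vm: "v \<in> borel_measurable (lebesgue_on {a<..<b})"
    using u(1) by (subst measurable_cong[of _ v u]) (auto simp: v_def)
  define f where "f s x = rhs c1 c2 (clip x) (v s)" for s x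
  have L: "2 * B + c1 > 0" using B(1) c1 by simp
  have fb: "\<bar>f s x\<bar> \<le> (2 * B + c1) * B + c2" for s x
    unfolding f_def by (intro rhs_bound clip v)
  have fL: "\<bar>f s x - f s y\<bar> \<le> (2 * B + c1) * \<bar>x - y\<bar>" for s x y
  proof -
    have "\<bar>f s x - f s y\<bar> \<le> (2 * B + c1) * \<bar>clip x - clip y\<bar>"
      unfolding f_def by (intro rhs_lipschitz clip v)
    also have "\<dots> \<le> (2 * B + c1) * \<bar>x - y\<bar>" using L clip_lip by (intro mult_left_mono) auto
    finally show ?thesis .
  qed
  have int: "(\<lambda>s. f s (X s)) integrable_on {a..b}" if X: "continuous_on {a..b} X" for X
  proof (rule measurable_bounded_integrable[OF _ fb])
    have "continuous_on {a<..<b} (\<lambda>s. clip (X s))"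
      unfolding clip_def using X by (intro continuous_intros) (auto intro: continuous_on_subset)
    then have "(\<lambda>s. clip (X s)) \<in> borel_measurable (lebesgue_on {a<..<b})"
      by (intro continuous_imp_measurable_on_sets_lebesgue) auto
    then show "(\<lambda>s. f s (X s)) \<in> borel_measurable (lebesgue_on {a<..<b})"
      unfolding f_def rhs_def fun_a_def fun_b_def using vm by measurable
  qed
  obtain X where X: "continuous_on {a..b} X" "\<And>t. t \<in> {a..b} \<Longrightarrow> X t = y0 + integral {a..t} (\<lambda>s. f s (X s))"
    using picard_lindelof_integral[OF ab L fL int, of y0] by blast
  have lip: "lip_on a b X"
  proof (rule lip_on_cong)
    show "lip_on a b (\<lambda>t. y0 + integral {a..t} (\<lambda>s. f s (X s)))"
      using order_trans[OF abs_ge_zero fb] by (intro lip_on_add lip_on_const indefinite_integral_lip[OF int[OF X(1)] fb])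
  qed (use X(2) in auto)
  have ae: "AE t in lebesgue. t \<in> {a<..<b} \<longrightarrow> (X has_real_derivative f t (X t)) (at t)"
    using indefinite_integral_deriv[OF int[OF X(1)]]
  proof eventually_elim
    case (elim t)
    show ?case
    proof
      assume t: "t \<in> {a<..<b}"
      then have "((\<lambda>t. y0 + integral {a..t} (\<lambda>s. f s (X s))) has_real_derivative f t (X t)) (at t)"
        using elim by (auto intro!: derivative_eq_intros)
      then show "(X has_real_derivative f t (X t)) (at t)"
        by (rule has_field_derivative_transform_within_open[OF _ open_greaterThanLessThan t])
          (use X(2) in auto)
    qed
  qed
  have X0: "X a = y0" using X(2)[of a] ab by simp
  have nonneg: "0 \<le> X t" if t: "t \<in> {a..b}" for t
  proof -
    have "- X t \<le> 0"
    proof (rule lip_on_barrier[where F = "\<lambda>t. - X t" and a = a and b = b and L = 0, OF lip_on_minus[OF lip] _ t])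
      show "AE t in lebesgue. t \<in> {a<..<b} \<longrightarrow> 0 < - X t \<longrightarrow>
          (\<exists>D. D \<le> 0 * (- X t - 0) \<and> ((\<lambda>t. - X t) has_real_derivative D) (at t))"
        using ae
      proof eventually_elim
        case (elim t)
        show ?case
        proof (intro impI)
          assume t: "t \<in> {a<..<b}" and neg: "0 < - X t"
          then have "f t (X t) = c2 * v t" by (simp add: f_def clip_def rhs_def fun_a_def fun_b_def)
          then have "- f t (X t) \<le> 0" using c2 v by simp
          then show "\<exists>D. D \<le> 0 * (- X t - 0) \<and> ((\<lambda>t. - X t) has_real_derivative D) (at t)"
            using elim t by (intro exI[of _ "- f t (X t)"] conjI DERIV_minus) auto
        qed
      qed
    qed (use X0 y0 in auto)
    then show ?thesis by simp
  qed
  \<comment> \<open>The level \<open>B\<close> is the equilibrium for control 1, the fastest one, so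
    beyond \<open>B\<close> the projected right-hand side is nonpositive.\<close>
  have upper: "X t \<le> B" if t: "t \<in> {a..b}" for t
  proof (rule lip_on_barrier[where L = 0, OF lip _ t])
    show "AE t in lebesgue. t \<in> {a<..<b} \<longrightarrow> B < X t \<longrightarrow>
        (\<exists>D. D \<le> 0 * (X t - B) \<and> (X has_real_derivative D) (at t))"
      using ae
    proof eventually_elim
      case (elim t)
      show ?case
      proof (intro impI)
        assume t: "t \<in> {a<..<b}" and gt: "B < X t"
        then have "f t (X t) = rhs c1 c2 B (v t)" using B(1) by (simp add: f_def clip_def)
        also have "\<dots> \<le> rhs c1 c2 B 1"
          using v fun_b_pos[of B] B(1) by (simp add: rhs_def)
        finally have "f t (X t) \<le> 0" using B(2) by simp
        then show "\<exists>D. D \<le> 0 * (X t - B) \<and> (X has_real_derivative D) (at t)"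
          using elim t by auto
      qed
    qed
  qed (use X0 y0 in \<open>auto simp: B_def\<close>)
  have "AE t in lebesgue. t \<in> {a<..<b} \<longrightarrow> (X has_real_derivative rhs c1 c2 (X t) (u t)) (at t)"
    using ae
  proof eventually_elim
    case (elim t)
    then show ?case using nonneg[of t] upper[of t] by (auto simp: f_def clip_def v_def)
  qed
  then have "is_sol c1 c2 a b u X" using lip nonneg unfolding is_sol_def by auto
  then show ?thesis using that X0 upper unfolding B_def by blast
qed

lemma sol_unique:
  assumes lip: "lip_on a b y1" "lip_on a b y2"
    and ae: "AE t in lebesgue. t \<in> {a<..<b} \<longrightarrow> (y1 has_real_derivative rhs c1 c2 (y1 t) (u t)) (at t)"
      "AE t in lebesgue. t \<in> {a<..<b} \<longrightarrow> (y2 has_real_derivative rhs c1 c2 (y2 t) (u t)) (at t)"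
    and u: "\<And>t. t \<in> {a<..<b} \<Longrightarrow> \<bar>u t\<bar> \<le> 1" and init: "y1 a = y2 a" and t: "t \<in> {a..b}"
  shows "y1 t = y2 t"
proof -
  obtain B1 where B1: "B1 \<ge> 0" "\<And>t. t \<in> {a..b} \<Longrightarrow> \<bar>y1 t\<bar> \<le> B1" using lip_on_bounded[OF lip(1)] by blast
  obtain B2 where B2: "B2 \<ge> 0" "\<And>t. t \<in> {a..b} \<Longrightarrow> \<bar>y2 t\<bar> \<le> B2" using lip_on_bounded[OF lip(2)] by blast
  define B where "B = max B1 B2"
  have B: "\<bar>y1 t\<bar> \<le> B" "\<bar>y2 t\<bar> \<le> B" if "t \<in> {a..b}" for t
    using B1(2)[OF that] B2(2)[OF that] by (auto simp: B_def)
  let ?F = "\<lambda>t. (y1 t - y2 t) * (y1 t - y2 t)"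
  have "?F t \<le> 0"
  proof (rule lip_on_barrier[where F = ?F and L = "2 * (2 * B + c1)", OF _ _ t])
    show "lip_on a b ?F" by (intro lip_on_mult lip_on_diff lip)
    show "AE t in lebesgue. t \<in> {a<..<b} \<longrightarrow> 0 < ?F t \<longrightarrow>
        (\<exists>D. D \<le> 2 * (2 * B + c1) * (?F t - 0) \<and> (?F has_real_derivative D) (at t))"
      using ae
    proof eventually_elim
      case (elim t)
      show ?case
      proof (intro impI)
        assume t: "t \<in> {a<..<b}"
        let ?d = "y1 t - y2 t" and ?r = "rhs c1 c2 (y1 t) (u t) - rhs c1 c2 (y2 t) (u t)"
        have "?d * ?r \<le> \<bar>?d\<bar> * \<bar>?r\<bar>" by (metis abs_ge_self abs_mult)
        also have "\<dots> \<le> \<bar>?d\<bar> * ((2 * B + c1) * \<bar>?d\<bar>)"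
          using rhs_lipschitz[OF B[of t] u[of t]] t by (intro mult_left_mono) auto
        also have "\<dots> = (2 * B + c1) * (?d * ?d)" by (simp add: abs_mult_self_eq)
        finally have "2 * (?d * ?r) \<le> 2 * ((2 * B + c1) * (?d * ?d))" by linarith
        then have "2 * (?d * ?r) \<le> 2 * (2 * B + c1) * (?F t - 0)" by (simp only: mult.assoc diff_zero)
        moreover have "(?F has_real_derivative 2 * (?d * ?r)) (at t)"
          using elim t by (auto intro!: derivative_eq_intros simp: algebra_simps)
        ultimately show "\<exists>D. D \<le> 2 * (2 * B + c1) * (?F t - 0) \<and> (?F has_real_derivative D) (at t)" by blast
      qed
    qed
  qed (use init in auto)
  moreover have "?F t \<ge> 0" by simp
  ultimately have "?F t = 0" by linarith
  then show ?thesis by simp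
qed

text \<open>A bootstrap: absolute continuity gives continuity, hence boundedness, hence a bounded
  right-hand side.\<close>

lemma caratheodory_lip:
  assumes car: "caratheodory_solution a b c1 c2 y0 u y" and u: "\<And>t. t \<in> {a<..<b} \<Longrightarrow> \<bar>u t\<bar> \<le> 1"
  shows "lip_on a b y"
proof -
  have ac: "abs_continuous_on_interval a b y"
    and ae: "AE t in lebesgue. t \<in> {a<..<b} \<longrightarrow> (y has_real_derivative rhs c1 c2 (y t) (u t)) (at t)"
    using car unfolding caratheodory_solution_def rhs_def by auto
  have "bounded (y ` {a..b})"
    by (intro compact_imp_bounded compact_continuous_image abs_continuous_on_interval_continuous ac compact_Icc)
  then obtain B where B: "\<And>t. t \<in> {a..b} \<Longrightarrow> \<bar>y t\<bar> \<le> B" unfolding bounded_iff by fastforce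
  define M where "M = \<bar>(2 * B + c1) * B + c2\<bar>"
  have "M-lipschitz_on {a..b} y"
  proof (rule abs_continuous_on_interval_bounded_derivative[OF ac])
    show "AE t in lebesgue. t \<in> {a<..<b} \<longrightarrow> (\<exists>D. \<bar>D\<bar> \<le> M \<and> (y has_real_derivative D) (at t))"
      using ae
    proof eventually_elim
      case (elim t)
      show ?case
      proof
        assume t: "t \<in> {a<..<b}"
        have "\<bar>rhs c1 c2 (y t) (u t)\<bar> \<le> M"
          using rhs_bound[OF B[of t] u[OF t]] t unfolding M_def by auto
        then show "\<exists>D. \<bar>D\<bar> \<le> M \<and> (y has_real_derivative D) (at t)" using elim t by blast
      qed
    qed
  qed (simp add: M_def)
  then show ?thesis unfolding lip_on_def by (rule exI)
qed

text \<open>Resolves the definite description in \<open>Psi\<close>; extensionality is what turns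
  uniqueness on the interval into equality of functions.\<close>

lemma Psi_is_sol:
  assumes ab: "a \<le> b" and u: "admissible_control a b w u" "0 \<le> w"
    and y0: "y0 \<in> {0..ybar c1 c2}"
  shows "is_sol c1 c2 a b u (\<lambda>t. Psi a b c1 c2 t y0 u)" "Psi a b c1 c2 a y0 u = y0"
    "\<And>t. t \<in> {a..b} \<Longrightarrow> Psi a b c1 c2 t y0 u \<le> ybar c1 c2"
proof -
  have um: "u \<in> borel_measurable (lebesgue_on {a<..<b})" and ub: "\<And>t. t \<in> {a<..<b} \<Longrightarrow> 0 \<le> u t \<and> u t \<le> 1"
    using u unfolding admissible_control_def by (auto intro: order_trans)
  have ub': "\<And>t. t \<in> {a<..<b} \<Longrightarrow> \<bar>u t\<bar> \<le> 1" using ub by auto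
  obtain y where y: "is_sol c1 c2 a b u y" "y a = y0" "\<And>t. t \<in> {a..b} \<Longrightarrow> y t \<le> ybar c1 c2"
    using sol_exists[OF ab um ub y0] by blast
  let ?z = "restrict y {a..b}"
  have z: "is_sol c1 c2 a b u ?z" by (rule is_sol_cong[OF y(1)]) auto
  have "caratheodory_solution a b c1 c2 y0 u ?z"
    using z y(2) ab lipschitz_imp_abs_continuous_on_interval[of _ a b ?z]
    unfolding caratheodory_solution_def is_sol_def rhs_def lip_on_def by auto
  moreover have "\<psi> = ?z" if "\<psi> \<in> extensional {a..b}" "caratheodory_solution a b c1 c2 y0 u \<psi>" for \<psi>
  proof (rule extensionalityI[OF that(1) restrict_extensional])
    fix t assume t: "t \<in> {a..b}"
    show "\<psi> t = ?z t"
    proof (rule sol_unique[of a b \<psi> ?z u])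
      show "lip_on a b \<psi>" using caratheodory_lip[OF that(2) ub'] .
      show "AE t in lebesgue. t \<in> {a<..<b} \<longrightarrow> (\<psi> has_real_derivative rhs c1 c2 (\<psi> t) (u t)) (at t)"
        using that(2) unfolding caratheodory_solution_def rhs_def by auto
      show "\<psi> a = ?z a" using that(2) y(2) ab unfolding caratheodory_solution_def by auto
    qed (use is_sol_lip[OF z] is_sol_ae[OF z] ub' t in auto)
  qed
  ultimately have "(THE \<psi>. \<psi> \<in> extensional {a..b} \<and> caratheodory_solution a b c1 c2 y0 u \<psi>) = ?z"
    by (intro the_equality) auto
  then have P: "Psi a b c1 c2 t y0 u = ?z t" for t unfolding Psi_def by simp
  show "is_sol c1 c2 a b u (\<lambda>t. Psi a b c1 c2 t y0 u)" "Psi a b c1 c2 a y0 u = y0"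
    "\<And>t. t \<in> {a..b} \<Longrightarrow> Psi a b c1 c2 t y0 u \<le> ybar c1 c2"
    unfolding P using z y(2,3) ab by (simp_all add: restrict_def)
qed

lemma Psi_range:
  assumes "a \<le> b" "admissible_control a b w u" "0 \<le> w" "y0 \<in> {0..ybar c1 c2}" "t \<in> {a..b}"
  shows "Psi a b c1 c2 t y0 u \<in> {0..ybar c1 c2}"
  using Psi_is_sol(3)[OF assms] is_sol_nonneg[OF Psi_is_sol(1)[OF assms(1-4)] assms(5)] by simp

end

section \<open>The constant control and the exit time\<close>

context riccati_exit
begin

text \<open>With \<open>p > 0 > q\<close> the roots of the right-hand side, \<open>(y - p) / (y - q)\<close> decays
  exponentially at rate \<open>p - q\<close>; this is the resulting solution from \<open>0\<close>.\<close>

definition const_sol :: "real \<Rightarrow> real \<Rightarrow> real" where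
  "const_sol t0 t = (let s = sqrt ((c1 * w) ^ 2 + 4 * (c2 * w)); p = (c1 * w + s) / 2; q = (c1 * w - s) / 2
     in - p * q * (1 - exp (- (p - q) * (t - t0))) / (p * exp (- (p - q) * (t - t0)) - q))"

lemma const_sol_props:
  shows "const_sol t0 t0 = 0"
    and "(const_sol t0 has_real_derivative rhs c1 c2 (const_sol t0 t) w) (at t)"
    and "s < t \<Longrightarrow> const_sol t0 s < const_sol t0 t"
    and "\<exists>T\<ge>t0. const_sol t0 T = ys"
proof -
  define s where "s = sqrt ((c1 * w) ^ 2 + 4 * (c2 * w))"
  define p where "p = (c1 * w + s) / 2"
  define q where "q = (c1 * w - s) / 2"
  have cw: "c1 * w > 0" "c2 * w > 0" using c1 c2 w_pos by auto
  have s2: "s ^ 2 = (c1 * w) ^ 2 + 4 * (c2 * w)" unfolding s_def using cw by simp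
  have "s > c1 * w" unfolding s_def using cw by (intro real_less_rsqrt) auto
  then have p: "p > 0" and q: "q < 0" and pq: "p - q > 0" unfolding p_def q_def using cw by auto
  have sum: "p + q = c1 * w" unfolding p_def q_def by (simp add: field_simps)
  have "4 * (p * q) = (c1 * w) ^ 2 - s ^ 2"
    unfolding p_def q_def by (simp add: field_simps power2_eq_square)
  then have prod: "p * q = - (c2 * w)" using s2 by simp
  have rhs: "rhs c1 c2 y w = - ((y - p) * (y - q))" for y
  proof -
    have "- ((y - p) * (y - q)) = - (y ^ 2) + (p + q) * y - p * q"
      by (simp add: algebra_simps power2_eq_square)
    also have "\<dots> = rhs c1 c2 y w"
      unfolding sum prod by (simp add: rhs_def fun_a_def fun_b_def algebra_simps)
    finally show ?thesis by simp
  qed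
  define E where "E t = exp (- (p - q) * (t - t0))" for t
  define Dn where "Dn t = p * E t - q" for t
  have E: "E t > 0" for t unfolding E_def by simp
  have Dn: "Dn t > 0" for t unfolding Dn_def using mult_pos_pos[OF p E[of t]] q by linarith
  have eq: "const_sol t0 t = - p * q * (1 - E t) / Dn t" for t
    unfolding const_sol_def Let_def Dn_def E_def p_def q_def s_def by simp
  show "const_sol t0 t0 = 0" unfolding eq E_def by simp
  have yp: "const_sol t0 t - p = - p * (p - q) * E t / Dn t" for t
    unfolding eq using Dn[of t] by (simp add: field_simps Dn_def)
  have yq: "const_sol t0 t - q = - q * (p - q) / Dn t" for t
    unfolding eq using Dn[of t] by (simp add: field_simps Dn_def)
  have Ed: "(E has_real_derivative - (p - q) * E t) (at t)" for t
    unfolding E_def by (auto intro!: derivative_eq_intros)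
  have "((\<lambda>t. - p * q * (1 - E t) / (p * E t - q)) has_real_derivative
      ((- p * q * (0 - - (p - q) * E t)) * (p * E t - q) - (- p * q * (1 - E t)) * (p * (- (p - q) * E t) - 0))
        / ((p * E t - q) * (p * E t - q))) (at t)" for t
    by (rule derivative_eq_intros refl Ed)+ (use Dn[of t] in \<open>auto simp: Dn_def\<close>)
  moreover have "((- p * q * (0 - - (p - q) * E t)) * (p * E t - q) - (- p * q * (1 - E t)) * (p * (- (p - q) * E t) - 0))
      = - ((- p * (p - q) * E t) * (- q * (p - q)))" for t
    by (simp add: algebra_simps)
  ultimately have d: "((\<lambda>t. - p * q * (1 - E t) / (p * E t - q)) has_real_derivative rhs c1 c2 (const_sol t0 t) w) (at t)" for t
    unfolding rhs yp yq Dn_def by (simp only: times_divide_times_eq minus_divide_left)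
  have ceq: "const_sol t0 = (\<lambda>t. - p * q * (1 - E t) / (p * E t - q))"
    unfolding fun_eq_iff eq Dn_def by simp
  show deriv: "(const_sol t0 has_real_derivative rhs c1 c2 (const_sol t0 t) w) (at t)" for t
    unfolding ceq using d[of t] unfolding ceq .
  have pos: "rhs c1 c2 (const_sol t0 t) w > 0" for t
  proof -
    have "const_sol t0 t - p < 0" unfolding yp using p pq E[of t] Dn[of t]
      by (simp add: divide_neg_pos mult_neg_pos)
    moreover have "const_sol t0 t - q > 0" unfolding yq using q pq Dn[of t]
      by (intro divide_pos_pos mult_pos_pos) auto
    ultimately show ?thesis unfolding rhs by (simp add: mult_neg_pos)
  qed
  show "s < t \<Longrightarrow> const_sol t0 s < const_sol t0 t" for s t
    using DERIV_pos_imp_increasing[of s t "const_sol t0"] deriv pos by blast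
  \<comment> \<open>A positive right-hand side at \<open>ys > 0\<close> places \<open>ys\<close>
    below the larger root, so the trajectory, which tends to \<open>p\<close>, must pass
    \<open>ys\<close>.\<close>
  have ysp: "ys < p"
  proof (rule ccontr)
    assume "\<not> ys < p"
    then have "(ys - p) * (ys - q) \<ge> 0" using q ys by (intro mult_nonneg_nonneg) auto
    then show False using rhs_ys_pos unfolding rhs by simp
  qed
  \<comment> \<open>The value of \<open>E\<close> at the exit, obtained by solving
    \<open>(ys - p) / (ys - q) = (p / q) * E\<close>. Then \<open>e \<le> 1\<close> says that the
    exit is not before \<open>t0\<close>.\<close>
  define e where "e = - q * (p - ys) / (p * (ys - q))"
  have e: "e > 0" unfolding e_def using p q ys ysp by (intro divide_pos_pos mult_pos_pos) auto
  have "- q * (p - ys) \<le> p * (ys - q)" using pq ys mult_pos_pos[OF pq ys] by (simp add: algebra_simps)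
  moreover have "p * (ys - q) > 0" using p q ys by simp
  ultimately have e1: "e \<le> 1" unfolding e_def by (subst divide_le_eq_1_pos)
  show "\<exists>T\<ge>t0. const_sol t0 T = ys"
  proof (intro exI[of _ "t0 - ln e / (p - q)"] conjI)
    have "ln e / (p - q) \<le> 0" using e e1 pq by (simp add: divide_nonpos_pos)
    then show "t0 \<le> t0 - ln e / (p - q)" by simp
    have "- (p - q) * (t0 - ln e / (p - q) - t0) = ln e" using pq by (simp add: field_simps)
    then have Ee: "E (t0 - ln e / (p - q)) = e" unfolding E_def using e by (simp only: exp_ln)
    have "p * (ys - q) \<noteq> 0" using p q ys by auto
    then have pe: "p * e * (ys - q) = - q * (p - ys)" unfolding e_def by (simp add: field_simps)
    have "- p * q * (1 - e) = ys * (p * e - q)"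
    proof -
      have "p * e * ys - p * e * q = - q * p + q * ys" using pe by (simp add: algebra_simps)
      then show ?thesis by (simp add: algebra_simps)
    qed
    then show "const_sol t0 (t0 - ln e / (p - q)) = ys"
      unfolding eq Dn_def Ee using Dn[of "t0 - ln e / (p - q)"] unfolding Dn_def Ee
      by (simp add: divide_eq_eq)
  qed
qed

lemma const_sol_is_sol:
  shows "is_sol c1 c2 t0 b (\<lambda>_. w) (const_sol t0)"
proof -
  have cont: "continuous_on A (const_sol t0)" for A
    by (meson const_sol_props(2) DERIV_isCont continuous_at_imp_continuous_on)
  have "lip_on t0 b (const_sol t0)"
  proof (rule lip_on_C1[where F' = "\<lambda>t. rhs c1 c2 (const_sol t0 t) w"])
    show "(const_sol t0 has_real_derivative rhs c1 c2 (const_sol t0 x) w) (at x within {t0..b})" for x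
      by (rule has_field_derivative_at_within[OF const_sol_props(2)])
    show "continuous_on {t0..b} (\<lambda>t. rhs c1 c2 (const_sol t0 t) w)"
      unfolding rhs_def fun_a_def fun_b_def by (intro continuous_intros cont)
  qed
  moreover have "0 \<le> const_sol t0 t" if "t \<in> {t0..b}" for t
    using const_sol_props(1)[of t0] const_sol_props(3)[of t0 t t0] that by (cases "t = t0") auto
  ultimately show ?thesis
    unfolding is_sol_def using const_sol_props(2) by auto
qed

lemma const_sol_unique:
  assumes T: "t0 \<le> T" and y: "y t0 = 0"
    "\<And>t. t \<ge> t0 \<Longrightarrow> (y has_real_derivative rhs c1 c2 (y t) w) (at t within {t0..})"
  shows "y T = const_sol t0 T"
proof (rule sol_unique[of t0 T y "const_sol t0" "\<lambda>_. w"])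
  have within: "(y has_real_derivative rhs c1 c2 (y t) w) (at t within {t0..T})" if "t \<in> {t0..T}" for t
    using y(2)[of t] that by (auto intro: DERIV_subset)
  have "continuous_on {t0..T} y" by (rule DERIV_continuous_on[OF within])
  then show "lip_on t0 T y"
    by (intro lip_on_C1[OF within]) (auto simp: rhs_def fun_a_def fun_b_def intro!: continuous_intros)
  have "(y has_real_derivative rhs c1 c2 (y t) w) (at t)" if "t \<in> {t0<..<T}" for t
  proof -
    have "at t within {t0..} = at t" using that by (intro at_within_interior) simp
    then show ?thesis using y(2)[of t] that by simp
  qed
  then show "AE t in lebesgue. t \<in> {t0<..<T} \<longrightarrow> (y has_real_derivative rhs c1 c2 (y t) w) (at t)"
    by simp
  show "AE t in lebesgue. t \<in> {t0<..<T} \<longrightarrow> (const_sol t0 has_real_derivative rhs c1 c2 (const_sol t0 t) w) (at t)"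
    using const_sol_props(2) by simp
qed (use is_sol_lip[OF const_sol_is_sol] w_pos whi y const_sol_props(1) T in auto)

lemma exit_time_const_sol: "const_sol t0 (exit_time t0 c1 c2 ys w) = ys"
proof -
  obtain T where T: "t0 \<le> T" "const_sol t0 T = ys" using const_sol_props(4) by blast
  have "exit_time t0 c1 c2 ys w = T"
    unfolding exit_time_def
  proof (rule the_equality)
    have "\<forall>t\<ge>t0. (const_sol t0 has_real_derivative fun_a (const_sol t0 t) + fun_b c1 c2 (const_sol t0 t) * w) (at t within {t0..})"
      using const_sol_props(2) unfolding rhs_def by (auto intro: has_field_derivative_at_within)
    then show "t0 \<le> T \<and> (\<exists>y. y t0 = 0 \<and> (\<forall>t\<ge>t0. (y has_real_derivative fun_a (y t) + fun_b c1 c2 (y t) * w) (at t within {t0..})) \<and> y T = ys)"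
      using T const_sol_props(1) by blast
  next
    fix S assume S: "t0 \<le> S \<and> (\<exists>y. y t0 = 0 \<and> (\<forall>t\<ge>t0. (y has_real_derivative fun_a (y t) + fun_b c1 c2 (y t) * w) (at t within {t0..})) \<and> y S = ys)"
    then obtain y where "y t0 = 0" "\<And>t. t \<ge> t0 \<Longrightarrow> (y has_real_derivative rhs c1 c2 (y t) w) (at t within {t0..})" "y S = ys"
      unfolding rhs_def by blast
    then have "const_sol t0 S = ys" using const_sol_unique S by metis
    then show "S = T" using T(2) const_sol_props(3) by (metis linorder_neqE_linordered_idom less_irrefl)
  qed
  then show ?thesis using T by simp
qed

text \<open>The slowest characteristic starts at 0 under the smallest control \<open>w\<close>, and
  it has already passed \<open>ys\<close> before \<open>t1\<close>.\<close>

lemma sol_exits: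
  assumes sol: "is_sol c1 c2 t0 t1 u y" and u: "AE t in lebesgue. t \<in> {t0<..<t1} \<longrightarrow> w \<le> u t"
    and t1: "t0 \<le> t1" "exit_time t0 c1 c2 ys w < t1"
  shows "ys \<le> y t1"
proof -
  have "ys \<le> const_sol t0 t1"
    using const_sol_props(3)[OF t1(2), of t0] exit_time_const_sol by simp
  also have "\<dots> \<le> y t1"
    using sol_mono[OF const_sol_is_sol sol u] const_sol_props(1) is_sol_nonneg[OF sol] t1 by auto
  finally show ?thesis .
qed

end

section \<open>Growth factor and transported measures\<close>

lemma fun_c_measurable [measurable]: "fun_c cs ys \<in> borel_measurable borel"
  unfolding fun_c_def by measurable

lemma fun_c_bounds: "cs \<ge> 0 \<Longrightarrow> 0 \<le> fun_c cs ys y" "cs \<ge> 0 \<Longrightarrow> fun_c cs ys y \<le> cs"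
  unfolding fun_c_def by auto

lemma fun_c_comp_measurable:
  fixes a b :: real
  assumes "continuous_on {a..b} y"
  shows "(\<lambda>s. indicator {a..b} s *\<^sub>R fun_c cs ys (y s)) \<in> borel_measurable lebesgue"
proof -
  have y: "(\<lambda>s. if s \<in> {a..b} then y s else 0) \<in> borel_measurable borel"
    using assms by (intro borel_measurable_continuous_on_if) auto
  have "(\<lambda>s. indicator {a..b} s *\<^sub>R fun_c cs ys (if s \<in> {a..b} then y s else 0)) \<in> borel_measurable borel"
    by (intro borel_measurable_scaleR borel_measurable_indicator measurable_compose[OF y fun_c_measurable]) auto
  then have "(\<lambda>s. indicator {a..b} s *\<^sub>R fun_c cs ys (if s \<in> {a..b} then y s else 0)) \<in> borel_measurable lebesgue"
    by (intro measurable_completion) simp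
  moreover have "(\<lambda>s. indicator {a..b} s *\<^sub>R fun_c cs ys (if s \<in> {a..b} then y s else 0))
      = (\<lambda>s. indicator {a..b} s *\<^sub>R fun_c cs ys (y s))"
    by (auto simp: indicator_def)
  ultimately show ?thesis by simp
qed

lemma integrable_const_Icc:
  fixes a b c :: real
  shows "integrable lebesgue (\<lambda>s. indicator {a..b} s *\<^sub>R c)"
  by (intro integrable_scaleR_left integrable_real_indicator) (auto simp: emeasure_lborel_Icc_eq)

lemma fun_c_integral_le:
  fixes a b :: real
  assumes "cs \<ge> 0" "a \<le> b"
  shows "(LINT s:{a..b}|lebesgue. fun_c cs ys (y s)) \<le> cs * (b - a)"
proof -
  have "(LINT s:{a..b}|lebesgue. fun_c cs ys (y s)) \<le> (LINT s:{a..b}|lebesgue. cs)"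
    unfolding set_lebesgue_integral_def
  proof (rule integral_mono')
    show "integrable lebesgue (\<lambda>s. indicator {a..b} s *\<^sub>R cs)" by (rule integrable_const_Icc)
    show "indicator {a..b} s *\<^sub>R fun_c cs ys (y s) \<le> indicator {a..b} s *\<^sub>R cs" for s
      using fun_c_bounds[OF assms(1)] by (auto simp: indicator_def)
    show "0 \<le> indicator {a..b} s *\<^sub>R cs" for s using assms(1) by (auto simp: indicator_def)
  qed
  also have "\<dots> = cs * (b - a)" using assms(2) by (simp add: set_lebesgue_integral_def)
  finally show "(LINT s:{a..b}|lebesgue. fun_c cs ys (y s)) \<le> cs * (b - a)" .
qed

lemma fun_c_integral_exit:
  fixes a b :: real
  assumes \<tau>: "\<tau> \<in> {a..b}" and below: "\<And>s. s \<in> {a..<\<tau>} \<Longrightarrow> 0 \<le> y s \<and> y s < ys"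
    and above: "\<And>s. s \<in> {\<tau>..b} \<Longrightarrow> ys \<le> y s"
  shows "(LINT s:{a..b}|lebesgue. fun_c cs ys (y s)) = cs * (\<tau> - a)"
proof -
  \<comment> \<open>The interval is half-open because \<open>fun_c\<close> already vanishes at the
    value \<open>ys\<close>, which is attained at \<open>\<tau>\<close>.\<close>
  have "(\<lambda>s. indicator {a..b} s *\<^sub>R fun_c cs ys (y s)) = (\<lambda>s. indicator {a..<\<tau>} s *\<^sub>R cs)"
  proof
    fix s show "indicator {a..b} s *\<^sub>R fun_c cs ys (y s) = indicator {a..<\<tau>} s *\<^sub>R cs"
      using \<tau> below[of s] above[of s] by (cases "s < \<tau>") (auto simp: indicator_def fun_c_def)
  qed
  then show ?thesis using \<tau> by (simp add: set_lebesgue_integral_def)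
qed

text \<open>Although \<open>fun_c\<close> jumps, it is locally constant on the nonnegative values
  other than \<open>ys\<close>; wherever the limit differs from \<open>ys\<close> the integrands are
  eventually equal to their limit, and domination by \<open>cs\<close> does the rest.\<close>

lemma fun_c_integral_tendsto:
  fixes a b :: real
  assumes cs: "cs \<ge> 0"
    and cont: "\<And>n. continuous_on {a..b} (yn n)" "continuous_on {a..b} y"
    and nn: "\<And>n s. s \<in> {a..b} \<Longrightarrow> 0 \<le> yn n s" "\<And>s. s \<in> {a..b} \<Longrightarrow> 0 \<le> y s"
    and lim: "\<And>s. s \<in> {a..b} \<Longrightarrow> (\<lambda>n. yn n s) \<longlonglongrightarrow> y s"
    and ne: "AE s in lebesgue. s \<in> {a..b} \<longrightarrow> y s \<noteq> ys"
  shows "(\<lambda>n. LINT s:{a..b}|lebesgue. fun_c cs ys (yn n s)) \<longlonglongrightarrow> (LINT s:{a..b}|lebesgue. fun_c cs ys (y s))"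
  unfolding set_lebesgue_integral_def
proof (rule integral_dominated_convergence[where w = "\<lambda>s. indicator {a..b} s *\<^sub>R cs"])
  show "AE s in lebesgue. (\<lambda>n. indicator {a..b} s *\<^sub>R fun_c cs ys (yn n s)) \<longlonglongrightarrow> indicator {a..b} s *\<^sub>R fun_c cs ys (y s)"
    using ne
  proof eventually_elim
    case (elim s)
    show ?case
    proof (cases "s \<in> {a..b}")
      case True
      have "\<forall>\<^sub>F n in sequentially. fun_c cs ys (yn n s) = fun_c cs ys (y s)"
      proof (cases "y s < ys")
        case less: True
        show ?thesis
          using order_tendstoD(2)[OF lim[OF True] less]
          by eventually_elim (use nn True less in \<open>auto simp: fun_c_def\<close>)
      next
        case False
        then have gt: "ys < y s" using elim True by auto
        show ?thesis
          using order_tendstoD(1)[OF lim[OF True] gt]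
          by eventually_elim (use nn True gt in \<open>auto simp: fun_c_def\<close>)
      qed
      then have "(\<lambda>n. fun_c cs ys (yn n s)) \<longlonglongrightarrow> fun_c cs ys (y s)"
        by (rule tendsto_eventually)
      then show ?thesis by (intro tendsto_scaleR tendsto_const)
    qed simp
  qed
  show "AE s in lebesgue. norm (indicator {a..b} s *\<^sub>R fun_c cs ys (yn n s)) \<le> indicator {a..b} s *\<^sub>R cs" for n
    using fun_c_bounds[OF cs] by (intro AE_I2) (auto simp: indicator_def)
qed (rule fun_c_comp_measurable cont integrable_const_Icc)+

section \<open>Finite measures and continuous test functions\<close>

text \<open>Closed subsets of \<open>K\<close> generate the trace sigma-algebra and are stable under
  intersection, and their indicators are limits of continuous functions. This gives the uniqueness
  behind the description in \<open>rho_sol\<close>.\<close>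

lemma finite_measure_eq_continuous:
  fixes M N :: "'a::metric_space measure"
  assumes K: "closed K" "K \<noteq> {}" and sets: "sets M = sets (restrict_space borel K)" "sets N = sets (restrict_space borel K)"
    and fin: "finite_measure M" "finite_measure N"
    and eq: "\<And>\<phi> :: 'a \<Rightarrow> real. continuous_on K \<phi> \<Longrightarrow> (LINT z|M. \<phi> z) = (LINT z|N. \<phi> z)"
  shows "M = N"
proof -
  interpret M: finite_measure M by fact
  interpret N: finite_measure N by fact
  have space: "space M = K" "space N = K"
    using sets_eq_imp_space_eq[OF sets(1)] sets_eq_imp_space_eq[OF sets(2)] by (auto simp: space_restrict_space)
  define G where "G = {A. closed A \<and> A \<subseteq> K}"
  have sg: "sets (restrict_space borel K) = sigma_sets K G"
  proof -
    have b: "sets borel = sigma_sets UNIV {S :: 'a set. closed S}"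
      by (simp add: borel_eq_closed)
    have "sets (restrict_space borel K) = (\<inter>) K ` sigma_sets UNIV {S. closed S}"
      by (simp add: sets_restrict_space b)
    also have "\<dots> = sigma_sets K ((\<inter>) K ` {S. closed S})"
      using K(1) by (intro sigma_sets_Int) auto
    also have "(\<inter>) K ` {S. closed S} = G"
      unfolding G_def using K(1) by (auto simp: image_iff intro: closed_Int)
    finally show ?thesis .
  qed
  have meas: "A \<in> sets M" "A \<in> sets N" if "A \<in> G" for A
    unfolding sets sg using that by auto
  have cm: "\<phi> \<in> borel_measurable M" "\<phi> \<in> borel_measurable N" if "continuous_on K \<phi>" for \<phi> :: "'a \<Rightarrow> real"
    using borel_measurable_continuous_on_restrict[OF that] sets
    by (simp_all cong: measurable_cong_sets)
  have eqG: "emeasure M A = emeasure N A" if A: "A \<in> G" for A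
  proof (cases "A = {}")
    case False
    define f where "f n z = max 0 (1 - real n * infdist z A)" for n z
    have fc: "continuous_on K (f n)" for n
      unfolding f_def by (intro continuous_intros)
    have fb: "norm (f n z) \<le> 1" for n z
      unfolding f_def using infdist_nonneg[of z A] by (auto simp: max_def)
    have fl: "(\<lambda>n. f n z) \<longlonglongrightarrow> indicator A z" for z
    proof (cases "z \<in> A")
      case True
      then show ?thesis by (simp add: f_def)
    next
      case F: False
      then have d: "infdist z A > 0"
        using A False unfolding G_def by (auto simp: infdist_pos_not_in_closed)
      obtain m where m: "1 / infdist z A < real m" using reals_Archimedean2 by blast
      have "f n z = 0" if "n \<ge> m" for n
      proof -
        have "1 < real m * infdist z A" using m d by (simp add: divide_less_eq)
        also have "\<dots> \<le> real n * infdist z A" using that d by (intro mult_right_mono) auto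
        finally show ?thesis unfolding f_def by simp
      qed
      then have "\<forall>\<^sub>F n in sequentially. f n z = indicator A z"
        using F by (auto simp: eventually_sequentially intro!: exI[of _ m])
      then show ?thesis by (rule tendsto_eventually)
    qed
    have "(\<lambda>n. LINT z|M. f n z) \<longlonglongrightarrow> (LINT z|M. indicator A z)"
      by (rule integral_dominated_convergence[where w = "\<lambda>_. 1"]) (use fl fb cm(1)[OF fc] meas[OF A] in auto)
    moreover have "(\<lambda>n. LINT z|N. f n z) \<longlonglongrightarrow> (LINT z|N. indicator A z)"
      by (rule integral_dominated_convergence[where w = "\<lambda>_. 1"]) (use fl fb cm(2)[OF fc] meas[OF A] in auto)
    ultimately have "(LINT z|M. indicator A z :: real) = (LINT z|N. indicator A z)"
      using eq[OF fc] LIMSEQ_unique by simp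
    moreover have "A \<inter> K = A" using A unfolding G_def by auto
    ultimately have "measure M A = measure N A"
      by (simp add: space)
    then show ?thesis by (simp add: M.emeasure_eq_measure N.emeasure_eq_measure)
  qed simp
  show ?thesis
  proof (rule measure_eqI_generator_eq[where E = G and \<Omega> = K and A = "\<lambda>_. K"])
    show "Int_stable G" unfolding Int_stable_def G_def by auto
    show "G \<subseteq> Pow K" unfolding G_def by auto
    show "range (\<lambda>_. K) \<subseteq> G" unfolding G_def using K by auto
  qed (use eqG sets sg M.emeasure_finite in auto)
qed

text \<open>The measure is the image under the transport map of the initial measure with density
  \<open>g\<close>.\<close>

lemma weighted_pushforward_exists:
  fixes \<mu> :: "'a::t2_space measure" and \<Phi> :: "'a \<Rightarrow> 'b::{metric_space, second_countable_topology}" and g :: "'a \<Rightarrow> real"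
  assumes \<mu>: "sets \<mu> = sets borel" "finite_measure \<mu>" and X: "compact X"
    and \<Phi>: "continuous_on X \<Phi>" "\<Phi> ` X \<subseteq> K" and K: "K \<noteq> {}"
    and g: "continuous_on X g" "\<And>z. z \<in> X \<Longrightarrow> 0 \<le> g z"
  shows "\<exists>M. sets M = sets (restrict_space borel K) \<and> finite_measure M \<and>
    (\<forall>\<phi> :: 'b \<Rightarrow> real. continuous_on K \<phi> \<longrightarrow> (LINT z|M. \<phi> z) = (LINT z:X|\<mu>. \<phi> (\<Phi> z) * g z))"
proof -
  interpret finite_measure \<mu> by fact
  obtain k where k: "k \<in> K" using K by blast
  have Xm: "X \<in> sets borel" using X by (simp add: compact_imp_closed borel_closed)
  \<comment> \<open>Off \<open>X\<close> the map only has to land in \<open>K\<close>, since the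
    density \<open>h\<close> is 0 there.\<close>
  define \<Psi> where "\<Psi> z = (if z \<in> X then \<Phi> z else k)" for z
  define h where "h z = (if z \<in> X then g z else 0)" for z
  have mcong: "borel_measurable \<mu> = (borel_measurable borel :: ('a \<Rightarrow> real) set)"
    using \<mu>(1) by (rule measurable_cong_sets) simp
  have hm: "h \<in> borel_measurable \<mu>"
    unfolding h_def mcong using g(1) Xm by (intro borel_measurable_continuous_on_if) auto
  have "\<Psi> \<in> borel_measurable borel"
    unfolding \<Psi>_def using \<Phi>(1) Xm by (intro borel_measurable_continuous_on_if) auto
  then have \<Psi>m: "\<Psi> \<in> measurable \<mu> (restrict_space borel K)"
    using \<Phi>(2) k \<mu>(1) by (intro measurable_restrict_space2) (auto simp: \<Psi>_def image_subset_iff cong: measurable_cong_sets)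
  obtain B where B: "\<And>z. z \<in> X \<Longrightarrow> \<bar>g z\<bar> \<le> B"
    using compact_imp_bounded[OF compact_continuous_image[OF g(1) X]] unfolding bounded_iff by fastforce
  have hb: "0 \<le> h z" "h z \<le> \<bar>B\<bar>" for z using B[of z] g(2)[of z] by (auto simp: h_def)
  define N where "N = density \<mu> (\<lambda>z. ennreal (h z))"
  define M where "M = distr N (restrict_space borel K) \<Psi>"
  have \<Psi>N: "\<Psi> \<in> measurable N (restrict_space borel K)" unfolding N_def using \<Psi>m by simp
  have "emeasure N (space N) = (\<integral>\<^sup>+ z. ennreal (h z) \<partial>\<mu>)"
    unfolding N_def using hm by (simp add: emeasure_density)
  also have "\<dots> \<le> (\<integral>\<^sup>+ z. ennreal \<bar>B\<bar> \<partial>\<mu>)" using hb by (intro nn_integral_mono ennreal_leI) auto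
  also have "\<dots> < \<infinity>" by (simp add: emeasure_eq_measure ennreal_mult_less_top)
  finally have "finite_measure N" by (intro finite_measureI) auto
  then have "finite_measure M" unfolding M_def using \<Psi>N by (rule finite_measure.finite_measure_distr)
  moreover have "(LINT z|M. \<phi> z) = (LINT z:X|\<mu>. \<phi> (\<Phi> z) * g z)" if \<phi>: "continuous_on K \<phi>" for \<phi> :: "'b \<Rightarrow> real"
  proof -
    have \<phi>m: "\<phi> \<in> borel_measurable (restrict_space borel K)" by (rule borel_measurable_continuous_on_restrict[OF \<phi>])
    have "(LINT z|M. \<phi> z) = (LINT z|N. \<phi> (\<Psi> z))"
      unfolding M_def by (rule integral_distr[OF \<Psi>N \<phi>m])
    also have "\<dots> = (LINT z|\<mu>. h z *\<^sub>R \<phi> (\<Psi> z))"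
      unfolding N_def using hb(1) by (intro integral_density hm measurable_compose[OF \<Psi>m \<phi>m]) auto
    also have "\<dots> = (LINT z:X|\<mu>. \<phi> (\<Phi> z) * g z)"
      unfolding set_lebesgue_integral_def by (intro Bochner_Integration.integral_cong) (auto simp: h_def \<Psi>_def)
    finally show ?thesis .
  qed
  ultimately show ?thesis by (intro exI[of _ M]) (auto simp: M_def)
qed

section \<open>Dependence of the cost on the control\<close>

text \<open>The contribution of a unit mass starting at height \<open>y0\<close>:
  \<open>- J_cost\<close> is the integral of this function against the initial measure, see
  \<open>J_cost_eq\<close>.\<close>

definition gain :: "real \<Rightarrow> real \<Rightarrow> real \<Rightarrow> real \<Rightarrow> real \<Rightarrow> real \<Rightarrow> (real \<Rightarrow> real) \<Rightarrow> real \<Rightarrow> real" where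
  "gain t0 t1 c1 c2 cs ys u y0 = Psi t0 t1 c1 c2 t1 y0 u *
     exp (LINT s:{t0..t1}|lebesgue. fun_c cs ys (Psi t0 t1 c1 c2 s y0 u))"

definition bang_bang :: "real \<Rightarrow> real \<Rightarrow> real \<Rightarrow> real" where
  "bang_bang w s t = (if t < s then w else 1)"

lemma bang_bang_admissible:
  assumes "w \<le> 1"
  shows "admissible_control t0 t1 w (bang_bang w s)"
proof -
  have "bang_bang w s \<in> borel_measurable borel" unfolding bang_bang_def by measurable
  then have "bang_bang w s \<in> borel_measurable lebesgue" by (intro measurable_completion) simp
  then have "bang_bang w s \<in> borel_measurable (lebesgue_on {t0<..<t1})" by (rule measurable_restrict_space1)
  then show ?thesis using assms unfolding admissible_control_def bang_bang_def by auto
qed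

section \<open>Continuity in the initial value and in the switching time\<close>

context riccati
begin

lemma zeta_tendsto_imp:
  assumes "\<And>n. 0 \<le> yn n" "0 \<le> y" "(\<lambda>n. zeta c1 c2 (yn n)) \<longlonglongrightarrow> zeta c1 c2 y"
  shows "yn \<longlonglongrightarrow> y"
proof -
  have eq: "(exp (zeta c1 c2 x) - c2) / c1 = x" if "0 \<le> x" for x
    unfolding zeta_def using fun_b_pos[OF that] c1 by (simp add: fun_b_def)
  have "(\<lambda>n. (exp (zeta c1 c2 (yn n)) - c2) / c1) \<longlonglongrightarrow> (exp (zeta c1 c2 y) - c2) / c1"
    using c1 by (intro tendsto_intros assms(3)) auto
  then show ?thesis using eq assms by simp
qed

lemma zeta_continuous: "continuous_on {0..} (zeta c1 c2)"
  unfolding zeta_def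
proof (intro continuous_on_ln)
  show "continuous_on {0..} (fun_b c1 c2)" unfolding fun_b_def by (intro continuous_intros)
  show "\<forall>x\<in>{0..}. fun_b c1 c2 x \<noteq> 0" using fun_b_pos by force
qed

lemma zeta_contraction:
  assumes sol: "is_sol c1 c2 a b u y1" "is_sol c1 c2 a b u y2" and t: "t \<in> {a..b}"
  shows "\<bar>zeta c1 c2 (y1 t) - zeta c1 c2 (y2 t)\<bar> \<le> \<bar>zeta c1 c2 (y1 a) - zeta c1 c2 (y2 a)\<bar>"
proof -
  let ?C = "\<bar>zeta c1 c2 (y1 a) - zeta c1 c2 (y2 a)\<bar>"
  have d: "AE t in lebesgue. t \<in> {a<..<b} \<longrightarrow> (\<exists>D\<ge>c1 * (u t - u t). ((\<lambda>_. ?C) has_real_derivative D) (at t))"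
    by (intro AE_I2) (auto intro!: exI[of _ 0])
  have "zeta c1 c2 (y1 t) - zeta c1 c2 (y2 t) \<le> ?C"
    by (rule zeta_comparison[OF sol, where N = "\<lambda>_. ?C"]) (use d t in auto)
  moreover have "zeta c1 c2 (y2 t) - zeta c1 c2 (y1 t) \<le> ?C"
    by (rule zeta_comparison[OF sol(2,1), where N = "\<lambda>_. ?C"]) (use d t in auto)
  ultimately show ?thesis by linarith
qed

text \<open>The two controls differ only between \<open>s\<close> and \<open>s'\<close>, by at most
  1; there the distance in \<open>zeta\<close> grows at rate at most \<open>c1\<close>, and
  afterwards it does not grow.\<close>

lemma bang_bang_stability:
  assumes sol: "is_sol c1 c2 a b (bang_bang w s) y1" "is_sol c1 c2 a b (bang_bang w s') y2"
    and init: "y1 a = y2 a" and w: "0 \<le> w" "w \<le> 1" and s: "a \<le> s" "s \<le> s'" "s' \<le> b" and t: "t \<in> {a..b}"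
  shows "\<bar>zeta c1 c2 (y1 t) - zeta c1 c2 (y2 t)\<bar> \<le> c1 * (s' - s)"
proof -
  note n1 = is_sol_nonneg[OF sol(1)] and n2 = is_sol_nonneg[OF sol(2)]
  have "y2 t \<le> y1 t"
    using w s by (intro sol_mono[OF sol(2,1) _ _ t]) (auto simp: bang_bang_def init intro!: AE_I2)
  then have lower: "zeta c1 c2 (y2 t) \<le> zeta c1 c2 (y1 t)"
    using n1[OF t] n2[OF t] zeta_le_iff by simp
  have sub1: "is_sol c1 c2 p q (bang_bang w s) y1" and sub2: "is_sol c1 c2 p q (bang_bang w s') y2"
    if "a \<le> p" "q \<le> b" for p q
    using is_sol_subset[OF sol(1) that] is_sol_subset[OF sol(2) that] by auto
  let ?d = "\<lambda>t. zeta c1 c2 (y1 t) - zeta c1 c2 (y2 t)"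
  have p1: "?d t \<le> 0" if "t \<in> {a..s}" for t
    by (rule zeta_comparison[OF sub1 sub2, of a s "\<lambda>_. 0"])
      (use s that init w in \<open>auto simp: bang_bang_def intro!: AE_I2 exI[of _ 0]\<close>)
  have p2: "?d t \<le> c1 * (t - s)" if "t \<in> {s..s'}" for t
  proof (rule zeta_comparison[OF sub1 sub2, of s s' "\<lambda>t. c1 * (t - s)"])
    show "AE t in lebesgue. t \<in> {s<..<s'} \<longrightarrow>
        (\<exists>D\<ge>c1 * (bang_bang w s t - bang_bang w s' t). ((\<lambda>t. c1 * (t - s)) has_real_derivative D) (at t))"
      using w c1 by (intro AE_I2 impI exI[of _ c1]) (auto simp: bang_bang_def intro!: derivative_eq_intros)
    show "lip_on s s' (\<lambda>t. c1 * (t - s))" by (intro lip_on_mult lip_on_diff lip_on_id lip_on_const)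
  qed (use s that c1 p1[of s] in auto)
  have p3: "?d t \<le> c1 * (s' - s)" if "t \<in> {s'..b}" for t
    by (rule zeta_comparison[OF sub1 sub2, of s' b "\<lambda>_. c1 * (s' - s)"])
      (use s that c1 p2[of s'] in \<open>auto simp: bang_bang_def intro!: AE_I2 exI[of _ 0]\<close>)
  consider "t \<in> {a..s}" | "t \<in> {s..s'}" | "t \<in> {s'..b}" using t by fastforce
  then have "?d t \<le> c1 * (s' - s)"
  proof cases
    case 1
    have "0 \<le> c1 * (s' - s)" using c1 s by simp
    then show ?thesis using p1[OF 1] by linarith
  next
    case 2
    have "c1 * (t - s) \<le> c1 * (s' - s)" using c1 2 by simp
    then show ?thesis using p2[OF 2] by linarith
  qed (use p3 in auto)
  then show ?thesis using lower by simp
qed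

end

section \<open>The gain and its improvement by rearrangement\<close>

locale cost_setup = riccati_exit +
  fixes t0 t1 cs :: real
  assumes t01: "t0 < t1" and cs: "cs > 0" and exit: "exit_time t0 c1 c2 ys w < t1"
    and cs_big: "cs > (fun_a ys + fun_b c1 c2 ys) / ys"
begin

abbreviation "adm \<equiv> admissible_control t0 t1 w"
abbreviation "flow u y0 t \<equiv> Psi t0 t1 c1 c2 t y0 u"

lemma ys_ybar: "ys \<le> ybar c1 c2"
proof (rule ccontr)
  assume "\<not> ys \<le> ybar c1 c2"
  then have lt: "ybar c1 c2 < ys" by simp
  have B: "ybar c1 c2 > 0" "rhs c1 c2 (ybar c1 c2) 1 = 0" by (rule ybar_props)+
  have "rhs c1 c2 (ybar c1 c2) 1 > 0"
    using lt B whi by (intro rhs_pos_below) auto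
  then show False using B by simp
qed

lemma flow_sol:
  assumes "adm u" "y0 \<in> {0..ys}"
  shows "is_sol c1 c2 t0 t1 u (flow u y0)" "flow u y0 t0 = y0"
    "\<And>t. t \<in> {t0..t1} \<Longrightarrow> flow u y0 t \<in> {0..ybar c1 c2}"
  using Psi_is_sol(1,2)[of t0 t1 w u y0] Psi_range[of t0 t1 w u y0] assms t01 w_pos ys_ybar by auto

lemma adm_ae: "adm u \<Longrightarrow> AE t in lebesgue. t \<in> {t0<..<t1} \<longrightarrow> w \<le> u t \<and> u t \<le> 1"
  unfolding admissible_control_def by (auto intro!: AE_I2)

lemma flow_exit:
  assumes u: "adm u" and y0: "y0 \<in> {0..ys}"
  obtains \<tau> where "\<tau> \<in> {t0..t1}" "flow u y0 \<tau> = ys" "\<And>t. t \<in> {t0..<\<tau>} \<Longrightarrow> flow u y0 t < ys"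
    "\<And>t. t \<in> {\<tau><..t1} \<Longrightarrow> ys < flow u y0 t"
proof -
  note sol = flow_sol[OF u y0]
  have ae: "AE t in lebesgue. t \<in> {t0<..<t1} \<longrightarrow> w \<le> u t"
    using adm_ae[OF u] by eventually_elim auto
  have "ys \<le> flow u y0 t1" using sol_exits[OF sol(1) ae] t01 exit by simp
  then show ?thesis
    using exit_time_exists[OF sol(1) ae] t01 sol(2) y0 that by auto
qed

text \<open>The level is met only at the exit time, so the discontinuity of \<open>fun_c\<close>
  does not disturb limits.\<close>

lemma flow_ne_ys:
  assumes u: "adm u" and y0: "y0 \<in> {0..ys}"
  shows "AE s in lebesgue. s \<in> {t0..t1} \<longrightarrow> flow u y0 s \<noteq> ys"
proof -
  obtain \<tau> where \<tau>: "\<tau> \<in> {t0..t1}" "\<And>t. t \<in> {t0..<\<tau>} \<Longrightarrow> flow u y0 t < ys"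
    "\<And>t. t \<in> {\<tau><..t1} \<Longrightarrow> ys < flow u y0 t"
    using flow_exit[OF u y0] by metis
  show ?thesis
  proof (rule AE_I'[of "{\<tau>}"])
    show "{\<tau>} \<in> null_sets lebesgue" by (simp flip: negligible_iff_null_sets)
    show "{s \<in> space lebesgue. \<not> (s \<in> {t0..t1} \<longrightarrow> flow u y0 s \<noteq> ys)} \<subseteq> {\<tau>}"
    proof
      fix s assume "s \<in> {s \<in> space lebesgue. \<not> (s \<in> {t0..t1} \<longrightarrow> flow u y0 s \<noteq> ys)}"
      then have "s \<in> {t0..t1}" "flow u y0 s = ys" by auto
      then show "s \<in> {\<tau>}" using \<tau>(2)[of s] \<tau>(3)[of s] by (cases s \<tau> rule: linorder_cases) auto
    qed
  qed
qed

text \<open>Control and initial value vary together, so that one statement serves both kinds of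
  continuity.\<close>

lemma weight_tendsto:
  assumes un: "\<And>n. adm (un n)" "adm u" and y: "\<And>n. yn n \<in> {0..ys}" "y \<in> {0..ys}"
    and lim: "\<And>s. s \<in> {t0..t1} \<Longrightarrow> (\<lambda>n. flow (un n) (yn n) s) \<longlonglongrightarrow> flow u y s" and t: "t \<in> {t0..t1}"
  shows "(\<lambda>n. exp (LINT s:{t0..t}|lebesgue. fun_c cs ys (flow (un n) (yn n) s)))
    \<longlonglongrightarrow> exp (LINT s:{t0..t}|lebesgue. fun_c cs ys (flow u y s))"
proof (intro tendsto_exp fun_c_integral_tendsto)
  show "continuous_on {t0..t} (\<lambda>s. flow (un n) (yn n) s)" for n
    by (rule continuous_on_subset[OF lip_on_continuous[OF is_sol_lip[OF flow_sol(1)[OF un(1) y(1)]]]]) (use t in auto)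
  show "continuous_on {t0..t} (\<lambda>s. flow u y s)"
    by (rule continuous_on_subset[OF lip_on_continuous[OF is_sol_lip[OF flow_sol(1)[OF un(2) y(2)]]]]) (use t in auto)
  show "AE s in lebesgue. s \<in> {t0..t} \<longrightarrow> flow u y s \<noteq> ys"
    using flow_ne_ys[OF un(2) y(2)] by eventually_elim (use t in auto)
  show "0 \<le> flow (un n) (yn n) s" if "s \<in> {t0..t}" for n s using flow_sol(3)[OF un(1) y(1)] that t by auto
  show "0 \<le> flow u y s" if "s \<in> {t0..t}" for s using flow_sol(3)[OF un(2) y(2)] that t by auto
qed (use cs lim t in auto)

lemma flow_tendsto_initial:
  assumes u: "adm u" and y: "\<And>n. yn n \<in> {0..ys}" "y \<in> {0..ys}" "yn \<longlonglongrightarrow> y" and t: "t \<in> {t0..t1}"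
  shows "(\<lambda>n. flow u (yn n) t) \<longlonglongrightarrow> flow u y t"
proof (rule zeta_tendsto_imp)
  have z: "(\<lambda>n. zeta c1 c2 (yn n)) \<longlonglongrightarrow> zeta c1 c2 y"
    using y by (intro continuous_on_tendsto_compose[OF zeta_continuous]) auto
  show "(\<lambda>n. zeta c1 c2 (flow u (yn n) t)) \<longlonglongrightarrow> zeta c1 c2 (flow u y t)"
  proof (rule Lim_transform_bound[where g = "\<lambda>n. zeta c1 c2 (yn n) - zeta c1 c2 y" and f = "\<lambda>n. zeta c1 c2 (flow u (yn n) t) - zeta c1 c2 (flow u y t)", THEN LIM_zero_cancel])
    show "\<forall>\<^sub>F n in sequentially. norm (zeta c1 c2 (flow u (yn n) t) - zeta c1 c2 (flow u y t)) \<le> norm (zeta c1 c2 (yn n) - zeta c1 c2 y)"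
      using zeta_contraction[OF flow_sol(1)[OF u y(1)] flow_sol(1)[OF u y(2)] t]
      unfolding flow_sol(2)[OF u y(1)] flow_sol(2)[OF u y(2)] by simp
    show "(\<lambda>n. zeta c1 c2 (yn n) - zeta c1 c2 y) \<longlonglongrightarrow> 0" using z by (rule LIM_zero)
  qed
qed (use flow_sol(3)[OF u y(1) t] flow_sol(3)[OF u y(2) t] in auto)

lemma flow_continuous_initial:
  assumes u: "adm u" and t: "t \<in> {t0..t1}"
  shows "continuous_on {0..ys} (\<lambda>y0. flow u y0 t)"
    "continuous_on {0..ys} (\<lambda>y0. exp (LINT s:{t0..t}|lebesgue. fun_c cs ys (flow u y0 s)))"
  unfolding continuous_on_sequentially comp_def
  using flow_tendsto_initial[OF u _ _ _ t] weight_tendsto[OF u u _ _ flow_tendsto_initial[OF u] t]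
  by blast+

lemma flow_tendsto_switch:
  assumes s: "\<And>n. sn n \<in> {t0..t1}" "s \<in> {t0..t1}" "sn \<longlonglongrightarrow> s" and y0: "y0 \<in> {0..ys}" and t: "t \<in> {t0..t1}"
  shows "(\<lambda>n. flow (bang_bang w (sn n)) y0 t) \<longlonglongrightarrow> flow (bang_bang w s) y0 t"
proof (rule zeta_tendsto_imp)
  have adm: "adm (bang_bang w r)" for r using bang_bang_admissible whi by simp
  have bound: "\<bar>zeta c1 c2 (flow (bang_bang w r) y0 t) - zeta c1 c2 (flow (bang_bang w r') y0 t)\<bar> \<le> c1 * \<bar>r - r'\<bar>"
    if r: "r \<in> {t0..t1}" "r' \<in> {t0..t1}" for r r'
  proof (cases "r \<le> r'")
    case True
    then show ?thesis
      using bang_bang_stability[OF flow_sol(1)[OF adm y0] flow_sol(1)[OF adm y0], of r r' t] flow_sol(2)[OF adm y0] r w_pos whi t by auto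
  next
    case False
    then show ?thesis
      using bang_bang_stability[OF flow_sol(1)[OF adm y0] flow_sol(1)[OF adm y0], of r' r t] flow_sol(2)[OF adm y0] r w_pos whi t
      by (auto simp: abs_minus_commute)
  qed
  show "(\<lambda>n. zeta c1 c2 (flow (bang_bang w (sn n)) y0 t)) \<longlonglongrightarrow> zeta c1 c2 (flow (bang_bang w s) y0 t)"
  proof (rule Lim_transform_bound[where g = "\<lambda>n. c1 * \<bar>sn n - s\<bar>" and f = "\<lambda>n. zeta c1 c2 (flow (bang_bang w (sn n)) y0 t) - zeta c1 c2 (flow (bang_bang w s) y0 t)", THEN LIM_zero_cancel])
    show "\<forall>\<^sub>F n in sequentially. norm (zeta c1 c2 (flow (bang_bang w (sn n)) y0 t) - zeta c1 c2 (flow (bang_bang w s) y0 t)) \<le> norm (c1 * \<bar>sn n - s\<bar>)"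
      using bound[OF s(1) s(2)] c1 by (simp add: abs_mult)
    have "(\<lambda>n. c1 * \<bar>sn n - s\<bar>) \<longlonglongrightarrow> c1 * \<bar>s - s\<bar>" by (intro tendsto_intros s(3))
    then show "(\<lambda>n. c1 * \<bar>sn n - s\<bar>) \<longlonglongrightarrow> 0" by simp
  qed
  show "0 \<le> flow (bang_bang w (sn n)) y0 t" for n using flow_sol(3)[OF adm y0 t] by auto
  show "0 \<le> flow (bang_bang w s) y0 t" using flow_sol(3)[OF adm y0 t] by auto
qed

lemma gain_tendsto_switch:
  assumes s: "\<And>n. sn n \<in> {t0..t1}" "s \<in> {t0..t1}" "sn \<longlonglongrightarrow> s" and y0: "y0 \<in> {0..ys}"
  shows "(\<lambda>n. gain t0 t1 c1 c2 cs ys (bang_bang w (sn n)) y0) \<longlonglongrightarrow> gain t0 t1 c1 c2 cs ys (bang_bang w s) y0"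
  unfolding gain_def
  using t01 whi y0 bang_bang_admissible[of w]
  by (intro tendsto_mult flow_tendsto_switch[OF s y0] weight_tendsto) auto

lemma gain_continuous_initial:
  assumes u: "adm u"
  shows "continuous_on {0..ys} (gain t0 t1 c1 c2 cs ys u)"
  unfolding gain_def using t01 by (intro continuous_on_mult flow_continuous_initial[OF u]) auto

lemma gain_bounds:
  assumes u: "adm u" and y0: "y0 \<in> {0..ys}"
  shows "0 \<le> gain t0 t1 c1 c2 cs ys u y0"
    "gain t0 t1 c1 c2 cs ys u y0 \<le> ybar c1 c2 * exp (cs * (t1 - t0))"
proof -
  have f: "flow u y0 t1 \<in> {0..ybar c1 c2}" using flow_sol(3)[OF u y0] t01 by auto
  then show "0 \<le> gain t0 t1 c1 c2 cs ys u y0" unfolding gain_def by auto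
  show "gain t0 t1 c1 c2 cs ys u y0 \<le> ybar c1 c2 * exp (cs * (t1 - t0))"
    unfolding gain_def
    using f fun_c_integral_le[of cs t0 t1 ys "flow u y0"] cs t01
    by (intro mult_mono) auto
qed

lemma gain_exit:
  assumes u: "adm u" and y0: "y0 \<in> {0..ys}"
    and \<tau>: "\<tau> \<in> {t0..t1}" "flow u y0 \<tau> = ys" "\<And>t. t \<in> {t0..<\<tau>} \<Longrightarrow> flow u y0 t < ys"
    "\<And>t. t \<in> {\<tau><..t1} \<Longrightarrow> ys < flow u y0 t"
  shows "gain t0 t1 c1 c2 cs ys u y0 = flow u y0 t1 * exp (cs * (\<tau> - t0))"
proof -
  have "(LINT s:{t0..t1}|lebesgue. fun_c cs ys (flow u y0 s)) = cs * (\<tau> - t0)"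
  proof (rule fun_c_integral_exit[OF \<tau>(1)])
    show "0 \<le> flow u y0 s \<and> flow u y0 s < ys" if "s \<in> {t0..<\<tau>}" for s
      using \<tau>(1) \<tau>(3)[OF that] flow_sol(3)[OF u y0, of s] that by auto
    show "ys \<le> flow u y0 s" if "s \<in> {\<tau>..t1}" for s
      using \<tau>(2) \<tau>(4)[of s] that by (cases "s = \<tau>") auto
  qed
  then show ?thesis unfolding gain_def by simp
qed

text \<open>The switching time \<open>s\<close> is the one for which \<open>v\<close> and \<open>bang_bang w s\<close> have the same integral
  against the weight \<open>exp (zrate c1 c2 ys * t)\<close>.\<close>

lemma bang_bang_dominates:
  assumes v: "adm v"
  obtains s where "s \<in> {t0..t1}" "\<And>y0. y0 \<in> {0..ys} \<Longrightarrow>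
    gain t0 t1 c1 c2 cs ys v y0 \<le> gain t0 t1 c1 c2 cs ys (bang_bang w s) y0"
proof -
  define H where "H = zrate c1 c2 ys"
  define e where "e t = exp (H * t)" for t
  \<comment> \<open>Outside the open interval \<open>v\<close> is arbitrary; the value
    \<open>w\<close> keeps the bounds valid everywhere, also at the endpoints.\<close>
  define v' where "v' t = (if t \<in> {t0<..<t1} then v t else w)" for t
  have vb: "w \<le> v' t" "v' t \<le> 1" for t using v whi unfolding admissible_control_def v'_def by auto
  have v'm: "v' \<in> borel_measurable (lebesgue_on {t0<..<t1})"
    using v unfolding admissible_control_def by (subst measurable_cong[of _ v' v]) (auto simp: v'_def)
  have eint: "e integrable_on {p..q}" for p q
    unfolding e_def by (intro integrable_continuous_interval continuous_intros)
  have em: "e \<in> borel_measurable (lebesgue_on {t0<..<t1})"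
    unfolding e_def by (intro continuous_imp_measurable_on_sets_lebesgue continuous_intros) auto
  have epos: "e t > 0" for t unfolding e_def by simp
  obtain B where B0: "B \<ge> 0" and "\<And>t. t \<in> {t0..t1} \<Longrightarrow> \<bar>exp (H * t)\<bar> \<le> B"
    using lip_on_bounded[OF lip_on_exp, of t0 t1 H] by blast
  then have B: "\<And>t. t \<in> {t0..t1} \<Longrightarrow> e t \<le> B" unfolding e_def by force
  have prod: "(\<lambda>t. e t * f t) integrable_on {t0..t1}"
    if f: "f \<in> borel_measurable (lebesgue_on {t0<..<t1})" "\<And>t. w \<le> f t \<and> f t \<le> 1" for f
  proof (rule measurable_bounded_integrable)
    show "(\<lambda>t. e t * f t) \<in> borel_measurable (lebesgue_on {t0<..<t1})" using em f(1) by measurable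
    show "\<bar>e t * f t\<bar> \<le> B" if "t \<in> {t0<..<t1}" for t
    proof -
      have "\<bar>e t * f t\<bar> = e t * f t" using epos[of t] f(2)[of t] w_pos by (simp add: abs_mult)
      also have "\<dots> \<le> e t * 1" using epos[of t] f(2)[of t] by (intro mult_left_mono) auto
      finally show ?thesis using B[of t] that by simp
    qed
  qed
  have ev: "(\<lambda>t. e t * v' t) integrable_on {t0..t1}" using prod v'm vb by blast
  have evs: "(\<lambda>t. e t * v' t) integrable_on {p..q}" if "t0 \<le> p" "q \<le> t1" for p q
    using integrable_on_subinterval[OF ev] that by auto
  define I where "I = integral {t0..t1} (\<lambda>t. e t * v' t)"
  \<comment> \<open>The weighted integral of \<open>bang_bang w s\<close>. It equals the integral of
    \<open>e\<close> at \<open>s = t0\<close> and \<open>w\<close> times that at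
    \<open>s = t1\<close>, and \<open>I\<close> lies between the two.\<close>
  define F where "F s = w * integral {t0..s} e + integral {s..t1} e" for s
  have F: "F s = integral {t0..t1} e - (1 - w) * integral {t0..s} e" if "s \<in> {t0..t1}" for s
  proof -
    have "integral {t0..s} e + integral {s..t1} e = integral {t0..t1} e"
      using that by (intro Henstock_Kurzweil_Integration.integral_combine eint) auto
    then show ?thesis unfolding F_def by (simp add: algebra_simps)
  qed
  have "continuous_on {t0..t1} (\<lambda>s. integral {t0..t1} e - (1 - w) * integral {t0..s} e)"
    by (intro continuous_intros indefinite_integral_continuous_1 eint)
  then have contF: "continuous_on {t0..t1} F"
    using F by (subst continuous_on_cong[OF refl]) auto
  have "I \<le> integral {t0..t1} e"
    unfolding I_def using epos vb by (intro integral_le ev eint) (auto intro!: mult_left_le less_imp_le)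
  then have F0: "I \<le> F t0" using F[of t0] t01 by simp
  have "integral {t0..t1} (\<lambda>t. w * e t) \<le> I"
    unfolding I_def using epos vb by (intro integral_le ev integrable_on_mult_right eint) (auto simp: mult.commute)
  then have F1: "F t1 \<le> I" using t01 by (simp add: F_def)
  obtain s where s: "s \<in> {t0..t1}" "F s = I"
    using IVT2'[OF F1 F0 less_imp_le[OF t01] contF] by auto
  let ?u = "bang_bang w s"
  have admu: "adm ?u" using bang_bang_admissible whi by simp
  define r where "r t = e t * (?u t - v' t)" for t
  have "(\<lambda>t. e t * ?u t) integrable_on {t0..t1}"
    using admu whi unfolding admissible_control_def by (intro prod) (simp, simp add: bang_bang_def)
  then have eu: "(\<lambda>t. e t * ?u t) integrable_on {p..q}" if "t0 \<le> p" "q \<le> t1" for p q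
    using integrable_on_subinterval[where S = "{t0..t1}"] that by auto
  have rint: "r integrable_on {p..q}" if "t0 \<le> p" "q \<le> t1" for p q
    unfolding r_def right_diff_distrib using that by (intro integrable_diff eu evs)
  define R where "R t = integral {t0..t} r" for t
  have u_low: "integral {t0..s} (\<lambda>t. e t * ?u t) = w * integral {t0..s} e"
  proof -
    have "integral {t0..s} (\<lambda>t. e t * ?u t) = integral {t0..s} (\<lambda>t. w * e t)"
      by (rule integral_spike[of "{s}"]) (auto simp: bang_bang_def)
    then show ?thesis by simp
  qed
  have u_high: "integral {s..t1} (\<lambda>t. e t * ?u t) = integral {s..t1} e"
    by (intro integral_cong) (auto simp: bang_bang_def)
  have R1: "R t1 = 0"
  proof -
    have "integral {t0..t1} (\<lambda>t. e t * ?u t) = F s"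
      using Henstock_Kurzweil_Integration.integral_combine[of t0 s t1 "\<lambda>t. e t * ?u t"] s eu u_low u_high
      unfolding F_def by auto
    moreover have "R t1 = integral {t0..t1} (\<lambda>t. e t * ?u t) - I"
      unfolding R_def r_def I_def right_diff_distrib
      by (intro Henstock_Kurzweil_Integration.integral_diff eu ev) auto
    ultimately show ?thesis using s by simp
  qed
  have R0: "R t0 = 0" unfolding R_def by simp
  \<comment> \<open>Before \<open>s\<close> the new control is the smallest possible, so
    \<open>R\<close> decreases from 0; after \<open>s\<close> it is the largest possible, so
    \<open>R\<close> increases to its final value 0.\<close>
  have Rneg: "R t \<le> 0" if t: "t \<in> {t0..t1}" for t
  proof (cases "t < s")
    case True
    then have "R t \<le> integral {t0..t} (\<lambda>_. 0)"
      unfolding R_def using t epos vb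
      by (intro integral_le rint) (auto simp: r_def bang_bang_def mult_le_0_iff less_imp_le)
    then show ?thesis by simp
  next
    case False
    have "R t + integral {t..t1} r = R t1"
      unfolding R_def using t by (intro Henstock_Kurzweil_Integration.integral_combine rint) auto
    moreover have "integral {t..t1} (\<lambda>_. 0) \<le> integral {t..t1} r"
      using t
    proof (intro integral_le rint)
      fix x assume "x \<in> {t..t1}"
      then show "0 \<le> r x" using epos[of x] vb[of x] False by (simp add: r_def bang_bang_def)
    qed auto
    ultimately show ?thesis using R1 by simp
  qed
  have Rlip: "lip_on t0 t1 R"
    unfolding R_def
  proof (rule indefinite_integral_lip[OF rint])
    fix t assume t: "t \<in> {t0..t1}"
    have "\<bar>r t\<bar> = e t * \<bar>?u t - v' t\<bar>" unfolding r_def using epos[of t] by (simp add: abs_mult)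
    also have "\<dots> \<le> B * 1"
      using B[OF t] epos[of t] vb[of t] w_pos whi by (intro mult_mono) (auto simp: bang_bang_def)
    finally show "\<bar>r t\<bar> \<le> B" by simp
  qed (use B0 in auto)
  have Rd: "AE t in lebesgue. t \<in> {t0<..<t1} \<longrightarrow> (R has_real_derivative exp (zrate c1 c2 ys * t) * (?u t - v t)) (at t)"
    using indefinite_integral_deriv[OF rint[OF order_refl order_refl]]
    by eventually_elim (auto simp: R_def[abs_def] r_def e_def H_def v'_def)
  show ?thesis
  proof (rule that[OF s(1)])
    fix y0 assume y0: "y0 \<in> {0..ys}"
    obtain \<tau>1 where \<tau>1: "\<tau>1 \<in> {t0..t1}" "flow v y0 \<tau>1 = ys" "\<And>t. t \<in> {t0..<\<tau>1} \<Longrightarrow> flow v y0 t < ys"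
      "\<And>t. t \<in> {\<tau>1<..t1} \<Longrightarrow> ys < flow v y0 t"
      using flow_exit[OF v y0] by blast
    obtain \<tau>2 where \<tau>2: "\<tau>2 \<in> {t0..t1}" "flow ?u y0 \<tau>2 = ys" "\<And>t. t \<in> {t0..<\<tau>2} \<Longrightarrow> flow ?u y0 t < ys"
      "\<And>t. t \<in> {\<tau>2<..t1} \<Longrightarrow> ys < flow ?u y0 t"
      using flow_exit[OF admu y0] by blast
    have init: "flow ?u y0 t0 = flow v y0 t0" using flow_sol(2)[OF v y0] flow_sol(2)[OF admu y0] by simp
    have "flow v y0 t1 * exp (cs * (\<tau>1 - t0)) \<le> flow ?u y0 t1 * exp (cs * (\<tau>2 - t0))"
      using flow_sol(1)[OF v y0] flow_sol(1)[OF admu y0] adm_ae[OF v] adm_ae[OF admu]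
        less_imp_le[OF t01] init Rlip R0 R1 Rneg Rd \<tau>1 \<tau>2 less_imp_le[OF cs_big]
      by (rule exchange)
    then show "gain t0 t1 c1 c2 cs ys v y0 \<le> gain t0 t1 c1 c2 cs ys ?u y0"
      using gain_exit[OF v y0 \<tau>1] gain_exit[OF admu y0 \<tau>2] by simp
  qed
qed

end

section \<open>The transported measure and the optimal control\<close>

context cost_setup
begin

text \<open>The condition on the measures involves one time at a time, so existence and uniqueness
  are settled separately for each \<open>t\<close>. Continuity in \<open>y0\<close> of the flow and
  of its growth factor makes the pushforward construction applicable.\<close>

lemma rho_sol_transport:
  fixes \<rho>0 :: "(real \<times> real) measure"
  assumes \<rho>0: "sets \<rho>0 = sets borel" "finite_measure \<rho>0" and u: "adm u"
  shows "transport_solution t0 t1 c1 c2 cs ys \<rho>0 u (rho_sol t0 t1 c1 c2 cs ys \<rho>0 u)"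
proof -
  let ?K = "K_set t0 t1 c1 c2" and ?X = "{0..1} \<times> {0..ys} :: (real \<times> real) set"
  let ?\<Phi> = "\<lambda>t z. (fst z + t - t0, flow u (snd z) t)"
  let ?g = "\<lambda>t z. exp (LINT s:{t0..t}|lebesgue. fun_c cs ys (flow u (snd z) s))"
  define Q where "Q t M \<longleftrightarrow> sets M = sets (restrict_space borel ?K) \<and> finite_measure M \<and>
    (\<forall>\<phi> :: real \<times> real \<Rightarrow> real. continuous_on ?K \<phi> \<longrightarrow> (LINT z|M. \<phi> z) = (LINT z:?X|\<rho>0. \<phi> (?\<Phi> t z) * ?g t z))" for t M
  have ts: "transport_solution t0 t1 c1 c2 cs ys \<rho>0 u \<rho> \<longleftrightarrow> \<rho> \<in> extensional {t0..t1} \<and> (\<forall>t\<in>{t0..t1}. Q t (\<rho> t))" for \<rho>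
    unfolding transport_solution_def Q_def ..
  have K: "closed ?K" "?K \<noteq> {}"
    unfolding K_set_def using t01 ybar_props(1) by (auto intro!: closed_Times)
  have cont: "continuous_on ?X (\<lambda>z. f (snd z))" if "continuous_on {0..ys} f" for f :: "real \<Rightarrow> real"
    by (rule continuous_on_compose2[OF that]) (auto intro!: continuous_intros)
  have "\<exists>M. Q t M" if t: "t \<in> {t0..t1}" for t
    unfolding Q_def
  proof (rule weighted_pushforward_exists[OF \<rho>0])
    show "compact ?X" by (intro compact_Times compact_Icc)
    show "continuous_on ?X (?\<Phi> t)"
      by (intro continuous_intros cont flow_continuous_initial(1)[OF u t])
    show "continuous_on ?X (?g t)"
      by (rule cont[OF flow_continuous_initial(2)[OF u t]])
    show "?\<Phi> t ` ?X \<subseteq> ?K"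
      using flow_sol(3)[OF u _ t] t unfolding K_set_def by auto
  qed (use K in auto)
  then obtain \<rho>' where \<rho>': "\<And>t. t \<in> {t0..t1} \<Longrightarrow> Q t (\<rho>' t)" by metis
  have "\<exists>!\<rho>. transport_solution t0 t1 c1 c2 cs ys \<rho>0 u \<rho>"
  proof (rule ex1I)
    show "transport_solution t0 t1 c1 c2 cs ys \<rho>0 u (restrict \<rho>' {t0..t1})"
      unfolding ts using \<rho>' by auto
  next
    fix \<rho> assume "transport_solution t0 t1 c1 c2 cs ys \<rho>0 u \<rho>"
    then have \<rho>: "\<rho> \<in> extensional {t0..t1}" "\<And>t. t \<in> {t0..t1} \<Longrightarrow> Q t (\<rho> t)" unfolding ts by auto
    show "\<rho> = restrict \<rho>' {t0..t1}"
    proof (rule extensionalityI[OF \<rho>(1) restrict_extensional])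
      fix t assume t: "t \<in> {t0..t1}"
      have "\<rho> t = \<rho>' t"
        using \<rho>(2)[OF t] \<rho>'[OF t] unfolding Q_def by (intro finite_measure_eq_continuous[OF K]) auto
      then show "\<rho> t = restrict \<rho>' {t0..t1} t" using t by simp
    qed
  qed
  then show ?thesis unfolding rho_sol_def by (rule theI')
qed

lemma J_cost_eq:
  fixes \<rho>0 :: "(real \<times> real) measure"
  assumes \<rho>0: "sets \<rho>0 = sets borel" "finite_measure \<rho>0" and u: "adm u"
  shows "J_cost t0 t1 c1 c2 cs ys \<rho>0 u = - (LINT z:{0..1} \<times> {0..ys}|\<rho>0. gain t0 t1 c1 c2 cs ys u (snd z))"
proof -
  \<comment> \<open>The cost is the transport identity at \<open>t1\<close> for the test function
    \<open>snd\<close>.\<close>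
  have "continuous_on (K_set t0 t1 c1 c2) snd" by (intro continuous_intros)
  then show ?thesis
    using rho_sol_transport[OF \<rho>0 u] t01
    unfolding transport_solution_def J_cost_def gain_def by auto
qed

lemma gain_integrable:
  fixes \<rho>0 :: "(real \<times> real) measure"
  assumes \<rho>0: "sets \<rho>0 = sets borel" "finite_measure \<rho>0" and u: "adm u"
  shows "integrable \<rho>0 (\<lambda>z. indicator ({0..1} \<times> {0..ys}) z *\<^sub>R gain t0 t1 c1 c2 cs ys u (snd z))"
proof -
  let ?X = "{0..1} \<times> {0..ys} :: (real \<times> real) set"
  have "continuous_on ?X (\<lambda>z. gain t0 t1 c1 c2 cs ys u (snd z))"
    by (rule continuous_on_compose2[OF gain_continuous_initial[OF u]]) (auto intro!: continuous_intros)
  then have "(\<lambda>z. if z \<in> ?X then gain t0 t1 c1 c2 cs ys u (snd z) else 0) \<in> borel_measurable borel"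
    by (intro borel_measurable_continuous_on_if borel_closed closed_Times) auto
  moreover have "(\<lambda>z. if z \<in> ?X then gain t0 t1 c1 c2 cs ys u (snd z) else 0)
      = (\<lambda>z. indicator ?X z *\<^sub>R gain t0 t1 c1 c2 cs ys u (snd z))"
    by (auto simp: indicator_def)
  ultimately have "(\<lambda>z. indicator ?X z *\<^sub>R gain t0 t1 c1 c2 cs ys u (snd z)) \<in> borel_measurable \<rho>0"
    by (subst measurable_cong_sets[OF \<rho>0(1) refl]) simp
  then show ?thesis
  proof (rule finite_measure.integrable_const_bound[OF \<rho>0(2), where B = "ybar c1 c2 * exp (cs * (t1 - t0))", rotated])
    show "AE z in \<rho>0. norm (indicator ?X z *\<^sub>R gain t0 t1 c1 c2 cs ys u (snd z)) \<le> ybar c1 c2 * exp (cs * (t1 - t0))"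
      using gain_bounds[OF u] ybar_props(1) by (intro AE_I2) (auto simp: indicator_def)
  qed
qed

text \<open>Every control is dominated by a member of a family with one parameter in a compact
  interval, so no compactness of the set of controls enters. The dominating switching time depends
  on \<open>v\<close>, but the best one beats them all.\<close>

lemma optimal_bang_bang:
  fixes \<rho>0 :: "(real \<times> real) measure"
  assumes \<rho>0: "sets \<rho>0 = sets borel" "finite_measure \<rho>0"
  obtains s where "s \<in> {t0..t1}" "optimal_control t0 t1 c1 c2 cs ys w \<rho>0 (bang_bang w s)"
proof -
  let ?X = "{0..1} \<times> {0..ys} :: (real \<times> real) set"
  define G where "G u = (LINT z:?X|\<rho>0. gain t0 t1 c1 c2 cs ys u (snd z))" for u
  have adm: "adm (bang_bang w s)" for s using bang_bang_admissible whi by simp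
  have "continuous_on {t0..t1} (\<lambda>s. G (bang_bang w s))"
    unfolding continuous_on_sequentially comp_def
  proof (intro allI ballI impI)
    fix sn s assume s: "s \<in> {t0..t1}" and sn: "(\<forall>n. sn n \<in> {t0..t1}) \<and> sn \<longlonglongrightarrow> s"
    show "(\<lambda>n. G (bang_bang w (sn n))) \<longlonglongrightarrow> G (bang_bang w s)"
      unfolding G_def set_lebesgue_integral_def
    proof (rule integral_dominated_convergence[where w = "\<lambda>_. ybar c1 c2 * exp (cs * (t1 - t0))"])
      show "integrable \<rho>0 (\<lambda>_. ybar c1 c2 * exp (cs * (t1 - t0)))"
        using finite_measure.integrable_const[OF \<rho>0(2)] by blast
      show "AE z in \<rho>0. (\<lambda>n. indicator ?X z *\<^sub>R gain t0 t1 c1 c2 cs ys (bang_bang w (sn n)) (snd z))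
          \<longlonglongrightarrow> indicator ?X z *\<^sub>R gain t0 t1 c1 c2 cs ys (bang_bang w s) (snd z)"
      proof (rule AE_I2)
        fix z show "(\<lambda>n. indicator ?X z *\<^sub>R gain t0 t1 c1 c2 cs ys (bang_bang w (sn n)) (snd z))
          \<longlonglongrightarrow> indicator ?X z *\<^sub>R gain t0 t1 c1 c2 cs ys (bang_bang w s) (snd z)"
        proof (cases "z \<in> ?X")
          case True
          then have "snd z \<in> {0..ys}" by auto
          then show ?thesis using sn s by (intro tendsto_intros gain_tendsto_switch) auto
        qed simp
      qed
      show "AE z in \<rho>0. norm (indicator ?X z *\<^sub>R gain t0 t1 c1 c2 cs ys (bang_bang w (sn n)) (snd z)) \<le> ybar c1 c2 * exp (cs * (t1 - t0))" for n
        using gain_bounds[OF adm] ybar_props(1) by (intro AE_I2) (auto simp: indicator_def)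
    qed (use gain_integrable[OF \<rho>0 adm] in \<open>auto intro: borel_measurable_integrable\<close>)
  qed
  then obtain s where s: "s \<in> {t0..t1}" "\<And>r. r \<in> {t0..t1} \<Longrightarrow> G (bang_bang w r) \<le> G (bang_bang w s)"
    using continuous_attains_sup[of "{t0..t1}" "\<lambda>s. G (bang_bang w s)"] t01 by auto
  have "G v \<le> G (bang_bang w s)" if v: "adm v" for v
  proof -
    obtain r where r: "r \<in> {t0..t1}" "\<And>y0. y0 \<in> {0..ys} \<Longrightarrow>
      gain t0 t1 c1 c2 cs ys v y0 \<le> gain t0 t1 c1 c2 cs ys (bang_bang w r) y0"
      using bang_bang_dominates[OF v] by blast
    have "G v \<le> G (bang_bang w r)"
      unfolding G_def set_lebesgue_integral_def
      using r(2) by (intro integral_mono gain_integrable \<rho>0 v adm) (auto simp: indicator_def)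
    then show ?thesis using s(2)[OF r(1)] by simp
  qed
  then have "optimal_control t0 t1 c1 c2 cs ys w \<rho>0 (bang_bang w s)"
    unfolding optimal_control_def G_def using adm J_cost_eq[OF \<rho>0] by simp
  then show ?thesis using that s(1) by blast
qed

end

theorem theorem2p1:
  fixes t0 t1 c1 c2 cs ys w :: real
    and \<rho>0 :: "(real \<times> real) measure"
  assumes "t0 < t1"
    and "c1 > 0" and "c2 > 0" and "cs > 0" and "ys > 0"
    and "ys ^ 2 / (c1 * ys + c2) < 1"
    and "w \<in> {ys ^ 2 / (c1 * ys + c2) <..< 1}"
    and "sets \<rho>0 = sets borel"
    and "finite_measure \<rho>0"
    and "measure_support \<rho>0 \<subseteq> {0..1} \<times> {0..ys}"
    and "t1 > exit_time t0 c1 c2 ys w"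
    and "2 * ys - c1 > 0"
    and "cs > (fun_a ys + fun_b c1 c2 ys) / ys"
  shows "\<exists>u. optimal_control t0 t1 c1 c2 cs ys w \<rho>0 u \<and>
           (\<exists>ts\<in>{t0..t1}.
              (AE t in lebesgue. t \<in> {t0<..<ts} \<longrightarrow> u t = w) \<and>
              (AE t in lebesgue. t \<in> {ts<..<t1} \<longrightarrow> u t = 1))"
proof -
  interpret cost_setup c1 c2 ys w t0 t1 cs
    by unfold_locales (use assms in auto)
  obtain s where s: "s \<in> {t0..t1}" "optimal_control t0 t1 c1 c2 cs ys w \<rho>0 (bang_bang w s)"
    using optimal_bang_bang assms by blast
  moreover have "AE t in lebesgue. t \<in> {t0<..<s} \<longrightarrow> bang_bang w s t = w"
    "AE t in lebesgue. t \<in> {s<..<t1} \<longrightarrow> bang_bang w s t = 1"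
    by (auto simp: bang_bang_def)
  ultimately show ?thesis by blast
qed

end
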